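(* There exists a universal constant $c>0$ (one can take $c=1/100$) with the following property. Let $n,N\in\mathbb{N}$, $K\geq 1$ and $0<\varepsilon<(2K)^{-1}$ be such that $$6\leq n\leq c(\log\varepsilon^{-1})^{-1}\log N .$$ Let $(X,\|\cdot\|)$ be a real normed space of dimension $N$ with a basis $(e_i)_{i=1}^N$ of basis constant $K$ such that the norm is invariant under coordinate permutations with respect to this basis. Let $T$ be the explicit $N\times n$ matrix $T=T(N,n,\varepsilon)$ and let $v=v(N,n,\varepsilon)\in\mathbb{R}^N$ be the explicit vector, both defined in the context, and set $M=\left\|\sum_{i=1}^N v_ie_i\right\|$. Then for all $x\in\mathbb{R}^n$, $$(1-K\varepsilon)M\left(\sum_{i=1}^n x_i^2\right)^{1/2}\leq\left\|\sum_{i=1}^N\sum_{j=1}^n T_{i,j}x_je_i\right\|\leq(1+K\varepsilon)M\left(\sum_{i=1}^n x_i^2\right)^{1/2}.$$ Moreover, for $1\leq k<6$, if $N\in\mathbb{N}$, $K\geq 1$ and $0<\varepsilon<(2K)^{-1}$ satisfy $6\leq c(\log\varepsilon^{-1})^{-1}\log N$, if $(X,\|\cdot\|)$ is a real normed space of dimension $N$ with a basis $(e_i)_{i=1}^N$ of basis constant $K$ such that the norm is invariant under coordinate permutations with respect to this basis, and if $\widetilde T$ denotes the $N\times k$ matrix consisting of the first $k$ columns of the matrix $T=T(N,6,\varepsilon)$ for $n=6$ (with $M=\left\|\sum_{i=1}^N v_ie_i\right\|$, $v=v(N,6,\varepsilon)$, the corresponding constant for $n=6$), then for all $x\in\mathbb{R}^k$,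 $$(1-K\varepsilon)M\left(\sum_{i=1}^k x_i^2\right)^{1/2}\leq\left\|\sum_{i=1}^N\sum_{j=1}^k \widetilde T_{i,j}x_je_i\right\|\leq(1+K\varepsilon)M\left(\sum_{i=1}^k x_i^2\right)^{1/2}.$$
   Context: Permutation invariance of the norm means: for all $(a_i)_1^N\in\mathbb{R}^N$ and all permutations $\tau$ of $\{1,\dots,N\}$, $\|\sum_{i=1}^N a_{\tau(i)}e_i\|=\|\sum_{i=1}^N a_ie_i\|$. The basis constant of $(e_i)_1^N$ is the smallest $K\geq1$ such that $\|\sum_{i=1}^j a_ie_i\|\leq K\|\sum_{i=1}^N a_ie_i\|$ for all $(a_i)_1^N\in\mathbb{R}^N$ and all $j\leq N$. $|\cdot|$ is the Euclidean norm, $B_2^n$ the closed Euclidean unit ball of $\mathbb{R}^n$, $\log$ the natural logarithm, and $\Phi(t)=\int_{-\infty}^t(2\pi)^{-1/2}e^{-u^2/2}\,du$. Parameters: $\delta=\varepsilon/1429$, $\sigma=\delta^{-4}$, $\alpha=2\delta^{-4}(\log\delta^{-1})^{1/2}$. Definition of $T$. For each $x\in\mathbb{Z}^n\cap(\alpha\sqrt n B_2^n)$ let $$m(x)=\left\lfloor N\prod_{i=1}^n\left(\Phi\left(\frac{x_i+1/2}{\sigma}\right)-\Phi\left(\frac{x_i-1/2}{\sigma}\right)\right)\right\rfloor,\qquad N'=\sum_{x\in\mathbb{Z}^n,\ |x|\leq\alpha\sqrt n}m(x),$$ and let $m'(x)=m(x)$ if $x\neq0$, $m'(0)=m(0)+N-N'$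 (so the $m'(x)$ are nonnegative integers with sum $N$). $T$ is the $N\times n$ matrix in which, for each $x\in\mathbb{Z}^n\cap(\alpha\sqrt nB_2^n)$, the vector $x'=\sqrt n\,x/|x|$ (with $x'=0$ when $x=0$) is repeated exactly $m'(x)$ times as a row (the order of the rows is arbitrary). Definition of $v$. Let $\Phi_n(t)=\mathbb{P}\{\sqrt n\,X_1/(\sum_{i=1}^nX_i^2)^{1/2}\leq t\}$, where $(X_i)_1^n$ is a standard normal random vector in $\mathbb{R}^n$. $\Phi_n$ is a strictly increasing bijection from $[-\sqrt n,\sqrt n]$ onto $[0,1]$; $\Phi_n^{-1}$ denotes its inverse. Let $b=\Phi_n((1-17\delta)\sqrt n)$. For $1\leq i\leq N$, $$v_i=\begin{cases}-\sqrt n,&0\leq i-1/2<(1-b)N,\\ \Phi_n^{-1}((i-1/2)/N),&(1-b)N\leq i-1/2\leq bN,\\ \sqrt n,&bN<i-1/2\leq N.\end{cases}$$ *)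

theory Defs
  imports "HOL-Probability.Probability"
begin

text \<open>
  Vectors in \<open>\<real>\<^sup>n\<close> are functions on \<open>nat\<close> of which only the values at \<open>1, ..., n\<close> are used, since
  \<open>n\<close> varies inside the construction; \<open>L2_set x {1..n}\<close> is then the Euclidean norm of \<open>x\<close>.
\<close>

definition is_basis :: "nat \<Rightarrow> (nat \<Rightarrow> 'a::real_normed_vector) \<Rightarrow> bool" where
  "is_basis N e \<longleftrightarrow>
     inj_on e {1..N} \<and> independent (e ` {1..N}) \<and> span (e ` {1..N}) = UNIV"

definition permutation_invariant :: "nat \<Rightarrow> (nat \<Rightarrow> 'a::real_normed_vector) \<Rightarrow> bool" where
  "permutation_invariant N e \<longleftrightarrow>
     (\<forall>(a :: nat \<Rightarrow> real) \<tau>. \<tau> permutes {1..N} \<longrightarrow>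
        norm (\<Sum>i=1..N. a (\<tau> i) *\<^sub>R e i) = norm (\<Sum>i=1..N. a i *\<^sub>R e i))"

definition basis_bound :: "nat \<Rightarrow> (nat \<Rightarrow> 'a::real_normed_vector) \<Rightarrow> real \<Rightarrow> bool" where
  "basis_bound N e K \<longleftrightarrow> K \<ge> 1 \<and>
     (\<forall>(a :: nat \<Rightarrow> real) j. j \<le> N \<longrightarrow>
        norm (\<Sum>i=1..j. a i *\<^sub>R e i) \<le> K * norm (\<Sum>i=1..N. a i *\<^sub>R e i))"

definition is_basis_constant :: "nat \<Rightarrow> (nat \<Rightarrow> 'a::real_normed_vector) \<Rightarrow> real \<Rightarrow> bool" where
  "is_basis_constant N e K \<longleftrightarrow> basis_bound N e K \<and> (\<forall>K'. basis_bound N e K' \<longrightarrow> K \<le> K')"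

definition delta :: "real \<Rightarrow> real" where
  "delta \<epsilon> = \<epsilon> / 1429"

definition sigma :: "real \<Rightarrow> real" where
  "sigma \<epsilon> = 1 / delta \<epsilon> ^ 4"

definition alpha :: "real \<Rightarrow> real" where
  "alpha \<epsilon> = 2 * (1 / delta \<epsilon> ^ 4) * sqrt (ln (1 / delta \<epsilon>))"

definition std_Phi :: "real \<Rightarrow> real" where
  "std_Phi t = (LINT u:{..t}|lborel. exp (- u\<^sup>2 / 2) / sqrt (2 * pi))"

text \<open>
  Integer vectors are normalised to vanish outside \<open>{1..n}\<close>, so that each point of the lattice
  is represented by exactly one function.
\<close>

definition lattice_ball :: "nat \<Rightarrow> real \<Rightarrow> (nat \<Rightarrow> int) set" where
  "lattice_ball n \<epsilon> =
     {x. (\<forall>i. i \<notin> {1..n} \<longrightarrow> x i = 0) \<and>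
         L2_set (\<lambda>i. real_of_int (x i)) {1..n} \<le> alpha \<epsilon> * sqrt (real n)}"

definition row_mult :: "nat \<Rightarrow> nat \<Rightarrow> real \<Rightarrow> (nat \<Rightarrow> int) \<Rightarrow> int" where
  "row_mult N n \<epsilon> x =
     \<lfloor>real N * (\<Prod>i=1..n. std_Phi ((real_of_int (x i) + 1/2) / sigma \<epsilon>)
                       - std_Phi ((real_of_int (x i) - 1/2) / sigma \<epsilon>))\<rfloor>"

definition total_mult :: "nat \<Rightarrow> nat \<Rightarrow> real \<Rightarrow> int" where
  "total_mult N n \<epsilon> = (\<Sum>x\<in>lattice_ball n \<epsilon>. row_mult N n \<epsilon> x)"

definition row_mult' :: "nat \<Rightarrow> nat \<Rightarrow> real \<Rightarrow> (nat \<Rightarrow> int) \<Rightarrow> int" where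
  "row_mult' N n \<epsilon> x =
     (if x = (\<lambda>_. 0) then row_mult N n \<epsilon> x + int N - total_mult N n \<epsilon> else row_mult N n \<epsilon> x)"

definition row_vec :: "nat \<Rightarrow> (nat \<Rightarrow> int) \<Rightarrow> nat \<Rightarrow> real" where
  "row_vec n x j =
     (if x = (\<lambda>_. 0) then 0
      else sqrt (real n) * real_of_int (x j) / L2_set (\<lambda>i. real_of_int (x i)) {1..n})"

text \<open>
  The order of the rows is arbitrary, so this is a predicate satisfied by every admissible ordering.
  Distinct lattice points on a common ray give the same row; hence the multiplicities are
  prescribed for the labelling \<open>r\<close> of the rows by lattice points and not for the rows themselves.
\<close>

definition is_T_matrix :: "nat \<Rightarrow> nat \<Rightarrow> real \<Rightarrow> (nat \<Rightarrow> nat \<Rightarrow> real) \<Rightarrow> bool" where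
  "is_T_matrix N n \<epsilon> T \<longleftrightarrow>
     (\<exists>r. (\<forall>i\<in>{1..N}. r i \<in> lattice_ball n \<epsilon>) \<and>
          (\<forall>x\<in>lattice_ball n \<epsilon>. int (card {i\<in>{1..N}. r i = x}) = row_mult' N n \<epsilon> x) \<and>
          (\<forall>i\<in>{1..N}. \<forall>j\<in>{1..n}. T i j = row_vec n (r i) j))"

definition std_gaussian :: "nat \<Rightarrow> (nat \<Rightarrow> real) measure" where
  "std_gaussian n = (\<Pi>\<^sub>M i\<in>{1..n}. std_normal_distribution)"

definition sphere_Phi :: "nat \<Rightarrow> real \<Rightarrow> real" where
  "sphere_Phi n t =
     measure (std_gaussian n)
       {X \<in> space (std_gaussian n). sqrt (real n) * X 1 / L2_set X {1..n} \<le> t}"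

definition sphere_Phi_inv :: "nat \<Rightarrow> real \<Rightarrow> real" where
  "sphere_Phi_inv n = the_inv_into {- sqrt (real n)..sqrt (real n)} (sphere_Phi n)"

definition b_param :: "nat \<Rightarrow> real \<Rightarrow> real" where
  "b_param n \<epsilon> = sphere_Phi n ((1 - 17 * delta \<epsilon>) * sqrt (real n))"

definition v_vec :: "nat \<Rightarrow> nat \<Rightarrow> real \<Rightarrow> nat \<Rightarrow> real" where
  "v_vec N n \<epsilon> i =
     (if real i - 1/2 < (1 - b_param n \<epsilon>) * real N then - sqrt (real n)
      else if real i - 1/2 \<le> b_param n \<epsilon> * real N then sphere_Phi_inv n ((real i - 1/2) / real N)
      else sqrt (real n))"

definition M_const :: "nat \<Rightarrow> nat \<Rightarrow> real \<Rightarrow> (nat \<Rightarrow> 'a::real_normed_vector) \<Rightarrow> real" where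
  "M_const N n \<epsilon> e = norm (\<Sum>i=1..N. v_vec N n \<epsilon> i *\<^sub>R e i)"

end

theory Submission
  imports Defs
begin

text \<open>
  Write \<open>\<delta> = \<epsilon> / 1429\<close> and let \<open>X\<close> be a standard Gaussian vector in \<open>\<real>\<^sup>n\<close>. Rounding \<open>\<sigma> X\<close> to the integer
  lattice yields the point \<open>x\<close> with a probability that is, up to rounding, the proportion of rows of
  \<open>T\<close> labelled by \<open>x\<close>. So for a unit vector \<open>\<theta>\<close> the coordinates of \<open>T \<theta>\<close> are distributed almost like
  \<open>sqrt n * \<langle>X, \<theta>\<rangle> / |X|\<close>. By rotation invariance this law is the same for all \<open>\<theta>\<close>; its distribution
  function is \<open>sphere_Phi n\<close>, and \<open>v\<close> lists its quantiles. The norm does not see the order of the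
  coordinates, so \<open>T \<theta>\<close> may be sorted into a vector \<open>u\<close>, and \<open>u\<close> is close to \<open>v\<close>, whatever \<open>\<theta>\<close> is.

  Closeness is needed only in the sense \<open>|u i - v i| \<le> 18 * \<delta> * max 1 |v i|\<close>. Permutation invariance
  turns the basis constant \<open>K\<close> into a bound for all coordinate projections, hence by convexity for all
  diagonal operators with entries in \<open>[0, 1]\<close>. The difference \<open>u - v\<close> is a sum of boundedly many
  terms, each a diagonal operator with entries \<open>O(\<delta>)\<close> applied to a rearrangement of \<open>v\<close>: for
  \<open>|v i| \<ge> 1\<close> it is a small multiple of \<open>v i\<close> itself, and the other coordinates are cut into blocks
  which are compared with the coordinates where \<open>v i \<ge> 1/2\<close>, a fixed proportion of all. This is
  \<open>norm_comparison\<close>; it loses a single factor \<open>K\<close>.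

  The sorted coordinates are close to the quantiles (\<open>sorted_projection_close\<close>) because the mass that
  \<open>sphere_Phi n\<close> gives to an interval of length \<open>\<delta> * max 1 |t| / 2\<close> next to \<open>t\<close> exceeds all
  errors of the discretisation (\<open>sphere_Phi_gap\<close>). The mass is bounded below by means of the ratio of
  \<open>X 1\<close> to the norm of the other coordinates: it has a density proportional to
  \<open>(1 + u\<^sup>2) powr (- n / 2)\<close>, by scaling of the Gaussian density, and the constant follows from
  normalisation. As long as \<open>|t| \<le> (1 - 17 * \<delta>) * sqrt n\<close> the mass is at least of the order
  \<open>\<delta> * (4 * sqrt \<delta>) ^ n\<close> and of the order \<open>\<delta> * exp (- m\<^sup>2 / (16 * \<delta>))\<close> with \<open>m = max 1 |t|\<close>.
  The errors (\<open>empirical_distribution_le\<close>) are smaller than both. The events that \<open>|X|\<close> is very small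
  or very large, and the rounding of \<open>N\<close> times a probability to an integer, contribute at most
  \<open>3 * (2 * \<delta>) ^ n\<close>; the last one because the number of lattice points is at most
  \<open>(1 / \<delta>) ^ (7 * n)\<close> while \<open>N \<ge> (1 / \<delta>) ^ (8 * n)\<close>. Rounding moves \<open>X\<close> by up to
  \<open>sqrt n / (2 * \<sigma>)\<close>, but along \<open>\<theta>\<close> the displacement is a sum of independent centred bounded variables,
  so by Hoeffding's inequality it is of order \<open>1 / \<sigma>\<close> up to an exponentially small probability. Without
  this cancellation the bound would not be uniform in the dimension.
\<close>

section \<open>Permutation-invariant norms\<close>

lemma below_chord_le_endpoint_bound:
  fixes f :: "real \<Rightarrow> real"
  assumes "\<And>t. 0 \<le> t \<Longrightarrow> t \<le> 1 \<Longrightarrow> f t \<le> (1 - t) * f 0 + t * f 1" and "f 0 \<le> B" "f 1 \<le> B" and "0 \<le> t" "t \<le> 1"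
  shows "f t \<le> B"
proof -
  have "f t \<le> (1 - t) * f 0 + t * f 1" using assms by blast
  also have "\<dots> \<le> (1 - t) * B + t * B" using assms by (intro add_mono mult_left_mono) auto
  finally show ?thesis by (simp add: algebra_simps)
qed

text \<open>
  Up to a permutation of the coordinates, the projection onto the coordinates in \<open>S\<close> is the projection
  onto an initial segment, which is what the basis constant controls.
\<close>

lemma coordinate_projection_bound:
  fixes e :: "nat \<Rightarrow> 'a::real_normed_vector"
  assumes "basis_bound N e K" and "permutation_invariant N e" and S: "S \<subseteq> {1..N}"
  shows "norm (\<Sum>i=1..N. (of_bool (i \<in> S) * a i) *\<^sub>R e i) \<le> K * norm (\<Sum>i=1..N. a i *\<^sub>R e i)"
proof -
  define j where "j = card S"
  have fS: "finite S" using S finite_subset by blast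
  have jN: "j \<le> N" using card_mono[OF _ S] by (simp add: j_def)
  obtain p where p: "bij_betw p {1..j} S"
    using finite_same_card_bij[of "{1..j}" S] fS by (auto simp: j_def)
  obtain q where q: "bij_betw q ({1..N} - {1..j}) ({1..N} - S)"
  proof -
    have "card ({1..N} - {1..j}) = card ({1..N} - S)"
      using S fS jN by (simp add: card_Diff_subset j_def)
    then show ?thesis using that finite_same_card_bij[of "{1..N} - {1..j}" "{1..N} - S"] by auto
  qed
  define \<tau> where "\<tau> i = (if i \<in> {1..j} then p i else if i \<in> {1..N} then q i else i)" for i
  have b1: "bij_betw \<tau> {1..j} S"
    using p by (rule bij_betw_cong[THEN iffD1, rotated]) (auto simp: \<tau>_def)
  have b2: "bij_betw \<tau> ({1..N} - {1..j}) ({1..N} - S)"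
    using q by (rule bij_betw_cong[THEN iffD1, rotated]) (auto simp: \<tau>_def)
  have "bij_betw \<tau> ({1..j} \<union> ({1..N} - {1..j})) (S \<union> ({1..N} - S))"
    using b1 b2 by (rule bij_betw_combine) auto
  moreover have "{1..j} \<union> ({1..N} - {1..j}) = {1..N}" "S \<union> ({1..N} - S) = {1..N}"
    using S jN by auto
  ultimately have bij: "bij_betw \<tau> {1..N} {1..N}" by simp
  have perm: "\<tau> permutes {1..N}"
    using jN by (intro bij_imp_permutes[OF bij]) (auto simp: \<tau>_def)
  have inS: "\<tau> i \<in> S \<longleftrightarrow> i \<le> j" if "i \<in> {1..N}" for i
  proof (cases "i \<le> j")
    case True then show ?thesis using b1 that by (auto simp: bij_betw_def)
  next
    case False then show ?thesis using b2 that by (auto simp: bij_betw_def)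
  qed
  have bb: "norm (\<Sum>i=1..j. c i *\<^sub>R e i) \<le> K * norm (\<Sum>i=1..N. c i *\<^sub>R e i)" if "j \<le> N" for c :: "nat \<Rightarrow> real" and j
    using assms(1) that by (simp add: basis_bound_def)
  have inv: "norm (\<Sum>i=1..N. c (\<tau> i) *\<^sub>R e i) = norm (\<Sum>i=1..N. c i *\<^sub>R e i)" for c :: "nat \<Rightarrow> real"
    using assms(2) perm unfolding permutation_invariant_def by blast
  have "norm (\<Sum>i=1..N. (of_bool (i \<in> S) * a i) *\<^sub>R e i)
      = norm (\<Sum>i=1..N. (of_bool (\<tau> i \<in> S) * a (\<tau> i)) *\<^sub>R e i)"
    using inv[of "\<lambda>i. of_bool (i \<in> S) * a i"] by simp
  also have "(\<Sum>i=1..N. (of_bool (\<tau> i \<in> S) * a (\<tau> i)) *\<^sub>R e i) = (\<Sum>i=1..j. a (\<tau> i) *\<^sub>R e i)"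
    using jN inS by (intro sum.mono_neutral_cong_right) (auto simp: not_le)
  also have "norm \<dots> \<le> K * norm (\<Sum>i=1..N. a (\<tau> i) *\<^sub>R e i)"
    by (rule bb[OF jN])
  also have "\<dots> = K * norm (\<Sum>i=1..N. a i *\<^sub>R e i)" by (simp only: inv)
  finally show ?thesis .
qed

text \<open>
  The norm is a convex function of each single entry of \<open>d\<close>, so a bound that holds when the entry is
  \<open>0\<close> or \<open>1\<close> also holds in between. Moving the entries to the end points one by one leaves a
  coordinate projection.
\<close>

lemma diagonal_bound_unit:
  fixes e :: "nat \<Rightarrow> 'a::real_normed_vector"
  assumes "basis_bound N e K" and "permutation_invariant N e"
    and "\<And>i. i \<in> {1..N} \<Longrightarrow> 0 \<le> d i \<and> d i \<le> 1"
  shows "norm (\<Sum>i=1..N. (d i * a i) *\<^sub>R e i) \<le> K * norm (\<Sum>i=1..N. a i *\<^sub>R e i)"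
  using assms(3)
proof (induction "card {i\<in>{1..N}. d i \<noteq> 0 \<and> d i \<noteq> 1}" arbitrary: d)
  case 0
  then have "d i = of_bool (i \<in> {i\<in>{1..N}. d i = 1})" if "i \<in> {1..N}" for i
    using that by auto
  then have "(\<Sum>i=1..N. (d i * a i) *\<^sub>R e i)
      = (\<Sum>i=1..N. (of_bool (i \<in> {i\<in>{1..N}. d i = 1}) * a i) *\<^sub>R e i)"
    by (intro sum.cong) auto
  then show ?case
    using coordinate_projection_bound[OF assms(1,2), of "{i\<in>{1..N}. d i = 1}" a] by (simp only: Collect_subset subset_iff) simp
next
  case (Suc m)
  let ?F = "\<lambda>d. {i\<in>{1..N}. d i \<noteq> (0::real) \<and> d i \<noteq> 1}"
  have "?F d \<noteq> {}" using Suc.hyps(2) by (metis card.empty nat.distinct(1))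
  then obtain k where k: "k \<in> ?F d" by blast
  define f where "f t = norm (\<Sum>i=1..N. ((d(k:=t)) i * a i) *\<^sub>R e i)" for t
  have IH: "f t \<le> K * norm (\<Sum>i=1..N. a i *\<^sub>R e i)" if "t = 0 \<or> t = 1" for t
  proof -
    have "?F (d(k:=t)) = ?F d - {k}" using that by auto
    then have "card (?F (d(k:=t))) = m" using k Suc.hyps(2) by simp
    then show ?thesis unfolding f_def using Suc.prems that by (intro Suc.hyps(1)) auto
  qed
  have conv: "f t \<le> (1 - t) * f 0 + t * f 1" if t: "0 \<le> t" "t \<le> 1" for t
  proof -
    have dt: "(d(k:=t)) i = (1 - t) * (d(k:=0)) i + t * (d(k:=1)) i" for i
      by (simp add: algebra_simps)
    have "((d(k:=t)) i * a i) *\<^sub>R e i = (1 - t) *\<^sub>R (((d(k:=0)) i * a i) *\<^sub>R e i)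
      + t *\<^sub>R (((d(k:=1)) i * a i) *\<^sub>R e i)" for i
      by (subst dt) (simp only: scaleR_scaleR scaleR_left_distrib distrib_right mult.assoc)
    then have "(\<Sum>i=1..N. ((d(k:=t)) i * a i) *\<^sub>R e i)
      = (\<Sum>i=1..N. (1 - t) *\<^sub>R (((d(k:=0)) i * a i) *\<^sub>R e i) + t *\<^sub>R (((d(k:=1)) i * a i) *\<^sub>R e i))"
      by (simp only:)
    also have "\<dots> = (1 - t) *\<^sub>R (\<Sum>i=1..N. ((d(k:=0)) i * a i) *\<^sub>R e i)
      + t *\<^sub>R (\<Sum>i=1..N. ((d(k:=1)) i * a i) *\<^sub>R e i)"
      by (simp only: sum.distrib scaleR_right.sum)
    finally show ?thesis unfolding f_def
      using t norm_triangle_ineq[of "(1 - t) *\<^sub>R (\<Sum>i=1..N. ((d(k:=0)) i * a i) *\<^sub>R e i)" "t *\<^sub>R (\<Sum>i=1..N. ((d(k:=1)) i * a i) *\<^sub>R e i)"]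
      by simp
  qed
  have dk: "0 \<le> d k" "d k \<le> 1" using k Suc.prems by blast+
  have f01: "f 0 \<le> K * norm (\<Sum>i=1..N. a i *\<^sub>R e i)" "f 1 \<le> K * norm (\<Sum>i=1..N. a i *\<^sub>R e i)"
    by (rule IH, simp)+
  have "f (d k) \<le> K * norm (\<Sum>i=1..N. a i *\<^sub>R e i)"
    using conv f01 dk by (rule below_chord_le_endpoint_bound[of f])
  then show ?case by (simp add: f_def)
qed

lemma diagonal_bound:
  fixes e :: "nat \<Rightarrow> 'a::real_normed_vector"
  assumes "basis_bound N e K" and "permutation_invariant N e"
    and "\<And>i. i \<in> {1..N} \<Longrightarrow> 0 \<le> d i \<and> d i \<le> D" and "0 \<le> D"
  shows "norm (\<Sum>i=1..N. (d i * a i) *\<^sub>R e i) \<le> K * D * norm (\<Sum>i=1..N. a i *\<^sub>R e i)"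
proof (cases "D = 0")
  case True
  then have "d i = 0" if "i \<in> {1..N}" for i using assms(3)[OF that] by simp
  then show ?thesis using True by simp
next
  case False
  then have D: "D > 0" using assms(4) by simp
  have "(\<Sum>i=1..N. (d i * a i) *\<^sub>R e i) = D *\<^sub>R (\<Sum>i=1..N. ((d i / D) * a i) *\<^sub>R e i)"
    using D by (simp add: scaleR_sum_right)
  also have "norm \<dots> \<le> D * (K * norm (\<Sum>i=1..N. a i *\<^sub>R e i))"
    using D assms(3) diagonal_bound_unit[OF assms(1,2), of "\<lambda>i. d i / D" a] by simp
  finally show ?thesis by (simp add: mult_ac)
qed

text \<open>
  The positive and the negative part of \<open>d\<close> are treated separately, since the norm need not be invariant
  under changes of sign.
\<close>

lemma signed_diagonal_bound:
  fixes e :: "nat \<Rightarrow> 'a::real_normed_vector"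
  assumes "basis_bound N e K" and "permutation_invariant N e"
    and "\<And>i. i \<in> {1..N} \<Longrightarrow> \<bar>d i\<bar> \<le> D" and "0 \<le> D"
  shows "norm (\<Sum>i=1..N. (d i * a i) *\<^sub>R e i) \<le> 2 * K * D * norm (\<Sum>i=1..N. a i *\<^sub>R e i)"
proof -
  have eq: "(\<Sum>i=1..N. (d i * a i) *\<^sub>R e i)
     = (\<Sum>i=1..N. (max 0 (d i) * a i) *\<^sub>R e i) - (\<Sum>i=1..N. (max 0 (- d i) * a i) *\<^sub>R e i)"
    unfolding sum_subtractf[symmetric]
    by (intro sum.cong refl) (auto simp: max_def)
  have "norm (\<Sum>i=1..N. (max 0 (d i) * a i) *\<^sub>R e i) \<le> K * D * norm (\<Sum>i=1..N. a i *\<^sub>R e i)"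
       "norm (\<Sum>i=1..N. (max 0 (- d i) * a i) *\<^sub>R e i) \<le> K * D * norm (\<Sum>i=1..N. a i *\<^sub>R e i)"
    using assms(3,4) by (intro diagonal_bound[OF assms(1,2)]; force)+
  then show ?thesis unfolding eq
    by (intro order.trans[OF norm_triangle_ineq4]) simp
qed

lemma partition_into_small_blocks:
  fixes N m B :: nat
  assumes "N \<le> B * m"
  obtains g :: "nat \<Rightarrow> nat" where "\<And>i. i \<in> {1..N} \<Longrightarrow> g i < B" and "\<And>k. card {i\<in>{1..N}. g i = k} \<le> m"
proof (cases "m = 0")
  case True
  then have "N = 0" using assms by simp
  then show ?thesis using that[of "\<lambda>_. 0"] by simp
next
  case False
  show ?thesis
  proof (rule that[of "\<lambda>i. (i - 1) div m"])
    fix i assume "i \<in> {1..N}"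
    then have "i - 1 < B * m" using assms by auto
    then show "(i - 1) div m < B" by (simp add: less_mult_imp_div_less)
  next
    fix k
    have "{i\<in>{1..N}. (i - 1) div m = k} \<subseteq> {k * m + 1..k * m + m}"
    proof
      fix i assume i: "i \<in> {i\<in>{1..N}. (i - 1) div m = k}"
      have "i - 1 = k * m + (i - 1) mod m" using i by auto
      moreover have "(i - 1) mod m < m" using False by simp
      moreover have "1 \<le> i" using i by auto
      ultimately show "i \<in> {k * m + 1..k * m + m}" unfolding atLeastAtMost_iff by linarith
    qed
    then have "card {i\<in>{1..N}. (i - 1) div m = k} \<le> card {k * m + 1..k * m + m}"
      by (intro card_mono) auto
    then show "card {i\<in>{1..N}. (i - 1) div m = k} \<le> m" by simp
  qed
qed

lemma exists_permutation_into:
  fixes A S :: "nat set"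
  assumes "A \<subseteq> {1..N}" "S \<subseteq> {1..N}" "card A \<le> card S"
  obtains \<tau> where "\<tau> permutes {1..N}" and "\<And>i. i \<in> A \<Longrightarrow> \<tau> i \<in> S"
proof -
  have fin: "finite A" "finite S" using assms finite_subset by blast+
  obtain S' where S': "S' \<subseteq> S" "card S' = card A" "finite S'"
    using obtain_subset_with_card_n[OF assms(3)] by metis
  obtain p where p: "bij_betw p A S'"
    using finite_same_card_bij[of A S'] fin S' by auto
  have "card ({1..N} - A) = card ({1..N} - S')"
    using assms fin S' by (subst (1 2) card_Diff_subset) auto
  then obtain q where q: "bij_betw q ({1..N} - A) ({1..N} - S')"
    using finite_same_card_bij[of "{1..N} - A" "{1..N} - S'"] by auto
  define \<tau> where "\<tau> i = (if i \<in> A then p i else if i \<in> {1..N} then q i else i)" for i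
  have b1: "bij_betw \<tau> A S'"
    using p by (rule bij_betw_cong[THEN iffD1, rotated]) (auto simp: \<tau>_def)
  have b2: "bij_betw \<tau> ({1..N} - A) ({1..N} - S')"
    using q by (rule bij_betw_cong[THEN iffD1, rotated]) (auto simp: \<tau>_def)
  have "bij_betw \<tau> (A \<union> ({1..N} - A)) (S' \<union> ({1..N} - S'))"
    using b1 b2 by (rule bij_betw_combine) auto
  moreover have "A \<union> ({1..N} - A) = {1..N}" "S' \<union> ({1..N} - S') = {1..N}"
    using assms S' by auto
  ultimately have "bij_betw \<tau> {1..N} {1..N}" by simp
  then have "\<tau> permutes {1..N}"
    using assms by (intro bij_imp_permutes) (auto simp: \<tau>_def)
  moreover have "\<tau> i \<in> S" if "i \<in> A" for i using b1 S' that by (auto simp: bij_betw_def)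
  ultimately show ?thesis using that by blast
qed

text \<open>
  On the block \<open>A\<close>, the vector \<open>d\<close> is a diagonal multiple of a rearrangement of \<open>v\<close> that places large
  entries of \<open>v\<close> there. Comparing with \<open>v\<close> directly, rather than through a constant vector, keeps the
  bound linear in \<open>K\<close>.
\<close>

lemma small_block_bound:
  fixes e :: "nat \<Rightarrow> 'a::real_normed_vector"
  assumes "basis_bound N e K" and "permutation_invariant N e"
    and "A \<subseteq> {1..N}" and "card A \<le> card {i\<in>{1..N}. v i \<ge> c}" and "c > 0"
    and "\<And>i. i \<in> A \<Longrightarrow> \<bar>d i\<bar> \<le> \<eta>" and "\<eta> \<ge> 0"
  shows "norm (\<Sum>i=1..N. (of_bool (i \<in> A) * d i) *\<^sub>R e i) \<le> 2 * K * (\<eta> / c) * norm (\<Sum>i=1..N. v i *\<^sub>R e i)"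
proof -
  obtain \<tau> where \<tau>: "\<tau> permutes {1..N}" and AS: "\<And>i. i \<in> A \<Longrightarrow> \<tau> i \<in> {i\<in>{1..N}. v i \<ge> c}"
    using exists_permutation_into[OF assms(3) _ assms(4)] by blast
  define D where "D i = of_bool (i \<in> A) * d i / v (\<tau> i)" for i
  have vpos: "v (\<tau> i) \<ge> c" if "i \<in> A" for i using AS that by auto
  have "(\<Sum>i=1..N. (of_bool (i \<in> A) * d i) *\<^sub>R e i) = (\<Sum>i=1..N. (D i * v (\<tau> i)) *\<^sub>R e i)"
    using vpos assms(5) by (intro sum.cong refl) (fastforce simp: D_def)
  also have "norm \<dots> \<le> 2 * K * (\<eta> / c) * norm (\<Sum>i=1..N. v (\<tau> i) *\<^sub>R e i)"
  proof (rule signed_diagonal_bound[OF assms(1,2)])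
    fix i
    show "\<bar>D i\<bar> \<le> \<eta> / c"
    proof (cases "i \<in> A")
      case True
      then show ?thesis using vpos[OF True] assms(5,6,7) unfolding D_def
        by (simp add: abs_div frac_le)
    next
      case False
      then show ?thesis using assms by (simp add: D_def)
    qed
  qed (use assms in simp)
  also have "norm (\<Sum>i=1..N. v (\<tau> i) *\<^sub>R e i) = norm (\<Sum>i=1..N. v i *\<^sub>R e i)"
    using assms(2) \<tau> unfolding permutation_invariant_def by blast
  finally show ?thesis .
qed

text \<open>
  Where \<open>|v i| \<ge> 1\<close> the difference is a small multiple of \<open>v i\<close>. The remaining coordinates are cut into
  \<open>B\<close> blocks, each short enough to be compared with the coordinates where \<open>v\<close> is at least \<open>c\<close>.
\<close>

lemma norm_comparison:
  fixes e :: "nat \<Rightarrow> 'a::real_normed_vector" and B :: nat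
  assumes "basis_bound N e K" and "permutation_invariant N e"
    and close: "\<And>i. i \<in> {1..N} \<Longrightarrow> \<bar>u i - v i\<bar> \<le> \<eta> * max 1 \<bar>v i\<bar>" and "\<eta> \<ge> 0"
    and "N \<le> B * card {i\<in>{1..N}. v i \<ge> c}" and "c > 0"
  shows "norm ((\<Sum>i=1..N. u i *\<^sub>R e i) - (\<Sum>i=1..N. v i *\<^sub>R e i))
     \<le> (2 + 2 * real B / c) * \<eta> * K * norm (\<Sum>i=1..N. v i *\<^sub>R e i)"
proof -
  define M where "M = norm (\<Sum>i=1..N. v i *\<^sub>R e i)"
  \<comment> \<open>the coordinates whose error is relative to \<open>v i\<close>\<close>
  define L where "L = {i\<in>{1..N}. \<bar>v i\<bar> \<ge> 1}"
  obtain g where g: "\<And>i. i \<in> {1..N} \<Longrightarrow> g i < B"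
    "\<And>k. card {i\<in>{1..N}. g i = k} \<le> card {i\<in>{1..N}. v i \<ge> c}"
    using partition_into_small_blocks[OF assms(5)] by blast
  define A where "A k = {i\<in>{1..N}. g i = k} - L" for k
  define D where "D i = (if i \<in> L then (u i - v i) / v i else 0)" for i
  have split: "u i - v i = D i * v i + (\<Sum>k<B. of_bool (i \<in> A k) * (u i - v i))" if i: "i \<in> {1..N}" for i
  proof (cases "i \<in> L")
    case True
    then show ?thesis by (auto simp: D_def A_def L_def)
  next
    case False
    have "(\<Sum>k<B. of_bool (i \<in> A k) * (u i - v i)) = (\<Sum>k<B. if k = g i then u i - v i else 0)"
      using i False by (intro sum.cong) (auto simp: A_def)
    then show ?thesis using False g(1)[OF i] by (simp add: D_def)
  qed
  have "(\<Sum>i=1..N. u i *\<^sub>R e i) - (\<Sum>i=1..N. v i *\<^sub>R e i) = (\<Sum>i=1..N. (u i - v i) *\<^sub>R e i)"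
    by (simp add: sum_subtractf scaleR_left_diff_distrib)
  also have "\<dots> = (\<Sum>i=1..N. (D i * v i) *\<^sub>R e i + (\<Sum>k<B. (of_bool (i \<in> A k) * (u i - v i)) *\<^sub>R e i))"
    by (intro sum.cong refl, subst split) (simp_all only: scaleR_left_distrib scaleR_sum_left)
  also have "\<dots> = (\<Sum>i=1..N. (D i * v i) *\<^sub>R e i) + (\<Sum>k<B. \<Sum>i=1..N. (of_bool (i \<in> A k) * (u i - v i)) *\<^sub>R e i)"
    by (subst sum.swap) (simp add: sum.distrib)
  also have "norm \<dots> \<le> 2 * K * \<eta> * M + (\<Sum>k<B. 2 * K * (\<eta> / c) * M)"
  proof (intro norm_triangle_mono sum_norm_le)
    show "norm (\<Sum>i=1..N. (D i * v i) *\<^sub>R e i) \<le> 2 * K * \<eta> * M"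
      unfolding M_def
    proof (rule signed_diagonal_bound[OF assms(1,2)])
      fix i assume i: "i \<in> {1..N}"
      show "\<bar>D i\<bar> \<le> \<eta>"
      proof (cases "i \<in> L")
        case True
        then have "\<bar>u i - v i\<bar> \<le> \<eta> * \<bar>v i\<bar>" "\<bar>v i\<bar> \<ge> 1" using close[OF i] by (auto simp: L_def max_def split: if_splits)
        then show ?thesis using True by (auto simp: D_def abs_div divide_simps)
      qed (use assms in \<open>simp add: D_def\<close>)
    qed (use assms in simp)
    fix k
    show "norm (\<Sum>i=1..N. (of_bool (i \<in> A k) * (u i - v i)) *\<^sub>R e i) \<le> 2 * K * (\<eta> / c) * M"
      unfolding M_def
    proof (rule small_block_bound[OF assms(1,2)])
      have "card (A k) \<le> card {i\<in>{1..N}. g i = k}" unfolding A_def by (intro card_mono) auto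
      also note g(2)[of k]
      finally show "card (A k) \<le> card {i\<in>{1..N}. v i \<ge> c}" .
      fix i assume i: "i \<in> A k"
      then have "\<bar>v i\<bar> < 1" "i \<in> {1..N}" by (auto simp: A_def L_def)
      then show "\<bar>u i - v i\<bar> \<le> \<eta>" using close[of i] by (simp add: max_def)
    qed (use assms in \<open>auto simp: A_def\<close>)
  qed
  also have "\<dots> = (2 + 2 * real B / c) * \<eta> * K * M" by (simp add: algebra_simps)
  finally show ?thesis unfolding M_def .
qed


section \<open>Rotation invariance of the Gaussian measure\<close>

abbreviation gauss :: "real measure" where "gauss \<equiv> std_normal_distribution"

abbreviation gauss_power :: "nat set \<Rightarrow> (nat \<Rightarrow> real) measure" where
  "gauss_power J \<equiv> Pi\<^sub>M J (\<lambda>_. gauss)"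

lemma prob_space_gauss: "prob_space gauss"
  by (rule prob_space_normal_density) simp

lemma product_prob_space_gauss: "product_prob_space (\<lambda>_. gauss)"
  using prob_space_gauss by (simp add: product_prob_spaceI)

interpretation gauss: prob_space gauss by (rule prob_space_gauss)
interpretation gprod: product_prob_space "\<lambda>_::nat. gauss" UNIV
  by (rule product_prob_space_gauss)

lemma nn_integral_gauss:
  assumes [measurable]: "f \<in> borel_measurable borel"
  shows "(\<integral>\<^sup>+x. f x \<partial>gauss) = (\<integral>\<^sup>+x. ennreal (std_normal_density x) * f x \<partial>lborel)"
  by (subst nn_integral_density) auto

lemma nn_integral_gauss_uminus:
  assumes [measurable]: "f \<in> borel_measurable borel"
  shows "(\<integral>\<^sup>+x. f (- x) \<partial>gauss) = (\<integral>\<^sup>+x. f x \<partial>gauss)"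
proof -
  have "(\<integral>\<^sup>+x. f x \<partial>gauss) = (\<integral>\<^sup>+x. ennreal (std_normal_density x) * f x \<partial>lborel)"
    by (rule nn_integral_gauss) simp
  also have "\<dots> = (\<integral>\<^sup>+x. ennreal (std_normal_density (- x)) * f (- x) \<partial>lborel)"
    by (subst nn_integral_real_affine[where c = "-1" and t = 0]) auto
  also have "\<dots> = (\<integral>\<^sup>+x. f (- x) \<partial>gauss)"
    by (subst nn_integral_gauss) (auto simp: std_normal_density_def)
  finally show ?thesis ..
qed

text \<open>
  For \<open>c \<noteq> 0\<close> the rotation is a composition of two substitutions in one variable each, with Jacobians
  \<open>1 / c\<close> and \<open>c\<close>; for \<open>c = 0\<close> it exchanges the axes, up to signs.
\<close>

lemma lborel_rotation:
  fixes h :: "real \<times> real \<Rightarrow> ennreal"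
  assumes [measurable]: "h \<in> borel_measurable borel" and cs: "c\<^sup>2 + s\<^sup>2 = 1"
  shows "(\<integral>\<^sup>+y. \<integral>\<^sup>+x. h (c * y + s * x, c * x - s * y) \<partial>lborel \<partial>lborel) = (\<integral>\<^sup>+y. \<integral>\<^sup>+x. h (y, x) \<partial>lborel \<partial>lborel)"
proof (cases "c = 0")
  case True
  then have s: "s \<noteq> 0" "\<bar>s\<bar> = 1" using cs by (auto simp: power2_eq_1_iff)
  have "(\<integral>\<^sup>+y. \<integral>\<^sup>+x. h (y, x) \<partial>lborel \<partial>lborel) = (\<integral>\<^sup>+y. \<integral>\<^sup>+x. h (y, - s * x) \<partial>lborel \<partial>lborel)"
    by (rule nn_integral_cong, subst nn_integral_real_affine[where c = "-s" and t = 0]) (use s in auto)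
  also have "\<dots> = (\<integral>\<^sup>+y. \<integral>\<^sup>+x. h (s * y, - s * x) \<partial>lborel \<partial>lborel)"
    by (subst nn_integral_real_affine[where c = s and t = 0]) (use s in auto)
  also have "\<dots> = (\<integral>\<^sup>+x. \<integral>\<^sup>+y. h (s * y, - s * x) \<partial>lborel \<partial>lborel)"
    by (rule lborel_pair.Fubini') auto
  finally show ?thesis using True by simp
next
  case False
  have [measurable]: "h \<in> borel_measurable (borel \<Otimes>\<^sub>M borel)" by (simp add: borel_prod)
  let ?R = "\<integral>\<^sup>+y. \<integral>\<^sup>+x. h (y, x) \<partial>lborel \<partial>lborel"
  have inner: "c * y + s * ((x + s * y) / c) = (y + s * x) / c" for x y :: real
  proof -
    have "c * y + s * ((x + s * y) / c) = ((c\<^sup>2 + s\<^sup>2) * y + s * x) / c"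
      using False by (simp add: field_simps power2_eq_square)
    then show ?thesis using cs by simp
  qed
  have "(\<integral>\<^sup>+y. \<integral>\<^sup>+x. h (c * y + s * x, c * x - s * y) \<partial>lborel \<partial>lborel)
    = (\<integral>\<^sup>+y. ennreal \<bar>1 / c\<bar> * (\<integral>\<^sup>+x. h (c * y + s * ((x + s * y) / c), x) \<partial>lborel) \<partial>lborel)"
  proof (rule nn_integral_cong)
    fix y :: real
    have "(\<integral>\<^sup>+x. h (c * y + s * x, c * x - s * y) \<partial>lborel)
      = ennreal \<bar>1 / c\<bar> * (\<integral>\<^sup>+x. h (c * y + s * (s * y / c + 1 / c * x), c * (s * y / c + 1 / c * x) - s * y) \<partial>lborel)"
      using False by (intro nn_integral_real_affine) auto
    moreover have "c * (s * y / c + 1 / c * x) - s * y = x" "s * y / c + 1 / c * x = (x + s * y) / c" for x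
      using False by (simp_all add: field_simps)
    ultimately show "(\<integral>\<^sup>+x. h (c * y + s * x, c * x - s * y) \<partial>lborel)
      = ennreal \<bar>1 / c\<bar> * (\<integral>\<^sup>+x. h (c * y + s * ((x + s * y) / c), x) \<partial>lborel)"
      by simp
  qed
  also have "\<dots> = ennreal \<bar>1 / c\<bar> * (\<integral>\<^sup>+y. \<integral>\<^sup>+x. h ((y + s * x) / c, x) \<partial>lborel \<partial>lborel)"
    by (simp only: inner) (rule nn_integral_cmult, measurable)
  also have "(\<integral>\<^sup>+y. \<integral>\<^sup>+x. h ((y + s * x) / c, x) \<partial>lborel \<partial>lborel) = (\<integral>\<^sup>+x. \<integral>\<^sup>+y. h ((y + s * x) / c, x) \<partial>lborel \<partial>lborel)"
    by (rule lborel_pair.Fubini') auto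
  also have "\<dots> = (\<integral>\<^sup>+x. ennreal \<bar>c\<bar> * (\<integral>\<^sup>+y. h (y, x) \<partial>lborel) \<partial>lborel)"
  proof (rule nn_integral_cong)
    fix x :: real
    have eq: "(- s * x + c * y + s * x) / c = y" for y using False by simp
    show "(\<integral>\<^sup>+y. h ((y + s * x) / c, x) \<partial>lborel) = ennreal \<bar>c\<bar> * (\<integral>\<^sup>+y. h (y, x) \<partial>lborel)"
      using False by (subst nn_integral_real_affine[where c = c and t = "- s * x"]) (auto simp: eq)
  qed
  also have "\<dots> = ennreal \<bar>c\<bar> * (\<integral>\<^sup>+x. \<integral>\<^sup>+y. h (y, x) \<partial>lborel \<partial>lborel)"
    by (rule nn_integral_cmult) auto
  also have "(\<integral>\<^sup>+x. \<integral>\<^sup>+y. h (y, x) \<partial>lborel \<partial>lborel) = ?R"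
    by (rule lborel_pair.Fubini') auto
  also have "ennreal \<bar>1 / c\<bar> * (ennreal \<bar>c\<bar> * ?R) = ?R"
    using False by (simp add: mult.assoc[symmetric] ennreal_mult[symmetric])
  finally show ?thesis .
qed

lemma nn_integral_gauss_pair:
  fixes h :: "real \<times> real \<Rightarrow> ennreal"
  assumes [measurable]: "h \<in> borel_measurable borel"
  shows "(\<integral>\<^sup>+y. \<integral>\<^sup>+x. h (y, x) \<partial>gauss \<partial>gauss)
    = (\<integral>\<^sup>+y. \<integral>\<^sup>+x. ennreal (exp (- (y\<^sup>2 + x\<^sup>2) / 2) / (2 * pi)) * h (y, x) \<partial>lborel \<partial>lborel)"
proof -
  have [measurable]: "h \<in> borel_measurable (borel \<Otimes>\<^sub>M borel)" by (simp add: borel_prod)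
  have eq: "std_normal_density y * std_normal_density x = exp (- (y\<^sup>2 + x\<^sup>2) / 2) / (2 * pi)" for x y
    by (simp add: std_normal_density_def exp_add[symmetric] add_divide_distrib)
  have "(\<integral>\<^sup>+y. \<integral>\<^sup>+x. h (y, x) \<partial>gauss \<partial>gauss)
    = (\<integral>\<^sup>+y. ennreal (std_normal_density y) * (\<integral>\<^sup>+x. ennreal (std_normal_density x) * h (y, x) \<partial>lborel) \<partial>lborel)"
    by (subst nn_integral_gauss, measurable) (simp add: nn_integral_gauss)
  also have "\<dots> = (\<integral>\<^sup>+y. \<integral>\<^sup>+x. ennreal (exp (- (y\<^sup>2 + x\<^sup>2) / 2) / (2 * pi)) * h (y, x) \<partial>lborel \<partial>lborel)"
    by (intro nn_integral_cong, subst nn_integral_cmult[symmetric])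
       (auto simp: mult.assoc[symmetric] ennreal_mult[symmetric] eq)
  finally show ?thesis .
qed

text \<open>
  The density of a pair depends on \<open>y\<^sup>2 + x\<^sup>2\<close> only, so the invariance of Lebesgue measure carries over.
\<close>

lemma gauss_rotation:
  fixes h :: "real \<times> real \<Rightarrow> ennreal"
  assumes [measurable]: "h \<in> borel_measurable borel" and cs: "c\<^sup>2 + s\<^sup>2 = 1"
  shows "(\<integral>\<^sup>+y. \<integral>\<^sup>+x. h (c * y + s * x, c * x - s * y) \<partial>gauss \<partial>gauss) = (\<integral>\<^sup>+y. \<integral>\<^sup>+x. h (y, x) \<partial>gauss \<partial>gauss)"
proof -
  have [measurable]: "h \<in> borel_measurable (borel \<Otimes>\<^sub>M borel)" by (simp add: borel_prod)
  have inv: "(c * y + s * x)\<^sup>2 + (c * x - s * y)\<^sup>2 = y\<^sup>2 + x\<^sup>2" for x y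
  proof -
    have "(c * y + s * x)\<^sup>2 + (c * x - s * y)\<^sup>2 = (c\<^sup>2 + s\<^sup>2) * (y\<^sup>2 + x\<^sup>2)" by algebra
    then show ?thesis using cs by simp
  qed
  define g where "g = (\<lambda>z. ennreal (exp (- ((fst z)\<^sup>2 + (snd z)\<^sup>2) / 2) / (2 * pi)) * h z)"
  have [measurable]: "g \<in> borel_measurable borel" unfolding g_def borel_prod[symmetric] by measurable
  have "(\<integral>\<^sup>+y. \<integral>\<^sup>+x. h (c * y + s * x, c * x - s * y) \<partial>gauss \<partial>gauss)
     = (\<integral>\<^sup>+y. \<integral>\<^sup>+x. g (c * y + s * x, c * x - s * y) \<partial>lborel \<partial>lborel)"
  proof -
    have "(\<lambda>z. h (c * fst z + s * snd z, c * snd z - s * fst z)) \<in> borel_measurable borel"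
      unfolding borel_prod[symmetric] by measurable
    from nn_integral_gauss_pair[OF this] show ?thesis
      by (simp only: g_def fst_conv snd_conv inv)
  qed
  also have "\<dots> = (\<integral>\<^sup>+y. \<integral>\<^sup>+x. g (y, x) \<partial>lborel \<partial>lborel)"
    by (rule lborel_rotation) (use cs in auto)
  also have "\<dots> = (\<integral>\<^sup>+y. \<integral>\<^sup>+x. h (y, x) \<partial>gauss \<partial>gauss)"
    by (subst nn_integral_gauss_pair) (auto simp: g_def)
  finally show ?thesis .
qed

text \<open>
  Rotate the plane so that the direction of \<open>(p, q)\<close> is taken to the first axis.
\<close>

lemma gauss_linear_pair:
  fixes f :: "real \<times> real \<Rightarrow> ennreal"
  assumes [measurable]: "f \<in> borel_measurable borel"
  shows "(\<integral>\<^sup>+y. \<integral>\<^sup>+x. f (p * y + q * x, y\<^sup>2 + x\<^sup>2) \<partial>gauss \<partial>gauss)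
    = (\<integral>\<^sup>+y. \<integral>\<^sup>+x. f (sqrt (p\<^sup>2 + q\<^sup>2) * y, y\<^sup>2 + x\<^sup>2) \<partial>gauss \<partial>gauss)"
proof (cases "p = 0 \<and> q = 0")
  case True then show ?thesis by simp
next
  case False
  define r where "r = sqrt (p\<^sup>2 + q\<^sup>2)"
  have pos: "p\<^sup>2 + q\<^sup>2 > 0" using False by (simp add: sum_power2_gt_zero_iff)
  then have r: "r > 0" "r\<^sup>2 = p\<^sup>2 + q\<^sup>2" by (auto simp: r_def)
  have [measurable]: "f \<in> borel_measurable (borel \<Otimes>\<^sub>M borel)" by (simp add: borel_prod)
  have cs: "(p / r)\<^sup>2 + (q / r)\<^sup>2 = 1"
    using r(1) by (simp add: power_divide add_divide_distrib[symmetric] r(2)[symmetric])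
  have inv: "(p / r * y + q / r * x)\<^sup>2 + (p / r * x - q / r * y)\<^sup>2 = y\<^sup>2 + x\<^sup>2" for x y
  proof -
    have "(p / r * y + q / r * x)\<^sup>2 + (p / r * x - q / r * y)\<^sup>2 = ((p / r)\<^sup>2 + (q / r)\<^sup>2) * (y\<^sup>2 + x\<^sup>2)" by algebra
    then show ?thesis using cs by simp
  qed
  have lin: "r * (p / r * y + q / r * x) = p * y + q * x" for x y
    using r by (simp add: field_simps)
  define h where "h = (\<lambda>z. f (r * fst z, (fst z)\<^sup>2 + (snd z)\<^sup>2))"
  have [measurable]: "h \<in> borel_measurable borel" unfolding h_def borel_prod[symmetric] by measurable
  have "(\<integral>\<^sup>+y. \<integral>\<^sup>+x. f (p * y + q * x, y\<^sup>2 + x\<^sup>2) \<partial>gauss \<partial>gauss)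
    = (\<integral>\<^sup>+y. \<integral>\<^sup>+x. h (p / r * y + q / r * x, p / r * x - q / r * y) \<partial>gauss \<partial>gauss)"
    by (simp only: h_def fst_conv snd_conv inv lin)
  also have "\<dots> = (\<integral>\<^sup>+y. \<integral>\<^sup>+x. h (y, x) \<partial>gauss \<partial>gauss)"
    by (rule gauss_rotation) (use cs in auto)
  finally show ?thesis by (simp add: h_def r_def)
qed

text \<open>
  Rotation invariance, stated for the joint law of a linear form and the squared norm: it depends on the
  form only through its length. A variable \<open>y\<close> is kept apart from the coordinates in \<open>J\<close>, so that each
  of these can be absorbed by a rotation in the plane that it spans with \<open>y\<close>.
\<close>

lemma gauss_linear_form_law:
  fixes f :: "real \<times> real \<Rightarrow> ennreal" and \<theta> :: "nat \<Rightarrow> real"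
  assumes "f \<in> borel_measurable borel" and "finite J"
  shows "(\<integral>\<^sup>+y. \<integral>\<^sup>+x. f (p * y + (\<Sum>i\<in>J. \<theta> i * x i), y\<^sup>2 + (\<Sum>i\<in>J. (x i)\<^sup>2)) \<partial>Pi\<^sub>M J (\<lambda>_. gauss) \<partial>gauss)
    = (\<integral>\<^sup>+y. \<integral>\<^sup>+x. f (sqrt (p\<^sup>2 + (\<Sum>i\<in>J. (\<theta> i)\<^sup>2)) * y, y\<^sup>2 + (\<Sum>i\<in>J. (x i)\<^sup>2)) \<partial>Pi\<^sub>M J (\<lambda>_. gauss) \<partial>gauss)"
  using assms(2,1)
proof (induction J arbitrary: f p rule: finite_induct)
  case empty
  have [measurable]: "f \<in> borel_measurable (borel \<Otimes>\<^sub>M borel)" "f \<in> borel_measurable borel" using empty by (simp_all add: borel_prod)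
  have "(\<integral>\<^sup>+y. f (\<bar>p\<bar> * y, y\<^sup>2) \<partial>gauss) = (\<integral>\<^sup>+y. f (p * y, y\<^sup>2) \<partial>gauss)"
    using nn_integral_gauss_uminus[of "\<lambda>y. f (p * y, y\<^sup>2)"] by (cases "p \<ge> 0") auto
  moreover have "emeasure (Pi\<^sub>M {} (\<lambda>_::nat. gauss)) (space (Pi\<^sub>M {} (\<lambda>_::nat. gauss))) = 1"
    by (intro prob_space.emeasure_space_1 prob_space_PiM prob_space_gauss)
  ultimately show ?case by simp
next
  case (insert k J)
  let ?l = "\<lambda>x::nat \<Rightarrow> real. \<Sum>i\<in>J. \<theta> i * x i" and ?q = "\<lambda>x::nat \<Rightarrow> real. \<Sum>i\<in>J. (x i)\<^sup>2"
  note [simp] = \<open>finite J\<close> \<open>k \<notin> J\<close>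
  have [measurable]: "f \<in> borel_measurable (borel \<Otimes>\<^sub>M borel)" "f \<in> borel_measurable borel" using insert by (simp_all add: borel_prod)
  interpret J: finite_product_sigma_finite "\<lambda>_::nat. gauss" J by standard simp
  have upd: "(\<Sum>i\<in>J. \<theta> i * (if i = k then z else x i)) = ?l x" "(\<Sum>i\<in>J. (if i = k then z else x i)\<^sup>2) = (?q x)" for x :: "nat \<Rightarrow> real" and z
    using \<open>k \<notin> J\<close> by (auto intro!: sum.cong)
  have expand: "(\<integral>\<^sup>+x. g ((\<Sum>i\<in>insert k J. \<theta> i * x i), (\<Sum>i\<in>insert k J. (x i)\<^sup>2)) \<partial>Pi\<^sub>M (insert k J) (\<lambda>_. gauss))
     = (\<integral>\<^sup>+z. \<integral>\<^sup>+x. g (\<theta> k * z + ?l x, z\<^sup>2 + (?q x)) \<partial>Pi\<^sub>M J (\<lambda>_. gauss) \<partial>gauss)"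
    if [measurable]: "g \<in> borel_measurable (borel \<Otimes>\<^sub>M borel)" for g :: "real \<times> real \<Rightarrow> ennreal"
    by (subst gprod.product_nn_integral_insert_rev) (simp_all add: upd)
  define s where "s = sqrt (p\<^sup>2 + (\<theta> k)\<^sup>2)"
  have s2: "s\<^sup>2 = p\<^sup>2 + (\<theta> k)\<^sup>2" by (simp add: s_def)
  have swap3: "(\<integral>\<^sup>+y. \<integral>\<^sup>+z. \<integral>\<^sup>+x. F x (y, z) \<partial>Pi\<^sub>M J (\<lambda>_. gauss) \<partial>gauss \<partial>gauss)
     = (\<integral>\<^sup>+x. \<integral>\<^sup>+y. \<integral>\<^sup>+z. F x (y, z) \<partial>gauss \<partial>gauss \<partial>Pi\<^sub>M J (\<lambda>_. gauss))"
    if [measurable]: "case_prod F \<in> borel_measurable (Pi\<^sub>M J (\<lambda>_. gauss) \<Otimes>\<^sub>M (gauss \<Otimes>\<^sub>M gauss))" for F :: "(nat \<Rightarrow> real) \<Rightarrow> real \<times> real \<Rightarrow> ennreal"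
  proof -
    interpret pr: pair_sigma_finite gauss "Pi\<^sub>M J (\<lambda>_::nat. gauss)" by standard
    have "(\<integral>\<^sup>+y. \<integral>\<^sup>+z. \<integral>\<^sup>+x. F x (y, z) \<partial>Pi\<^sub>M J (\<lambda>_. gauss) \<partial>gauss \<partial>gauss)
      = (\<integral>\<^sup>+y. \<integral>\<^sup>+x. \<integral>\<^sup>+z. F x (y, z) \<partial>gauss \<partial>Pi\<^sub>M J (\<lambda>_. gauss) \<partial>gauss)"
      by (intro nn_integral_cong pr.Fubini'[symmetric]) measurable
    also have "\<dots> = (\<integral>\<^sup>+x. \<integral>\<^sup>+y. \<integral>\<^sup>+z. F x (y, z) \<partial>gauss \<partial>gauss \<partial>Pi\<^sub>M J (\<lambda>_. gauss))"
      by (intro pr.Fubini'[symmetric]) measurable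
    finally show ?thesis .
  qed
  have "(\<integral>\<^sup>+y. \<integral>\<^sup>+x. f (p * y + (\<Sum>i\<in>insert k J. \<theta> i * x i), y\<^sup>2 + (\<Sum>i\<in>insert k J. (x i)\<^sup>2)) \<partial>Pi\<^sub>M (insert k J) (\<lambda>_. gauss) \<partial>gauss)
    = (\<integral>\<^sup>+y. \<integral>\<^sup>+z. \<integral>\<^sup>+x. f ((p * y + \<theta> k * z) + ?l x, (y\<^sup>2 + z\<^sup>2) + (?q x)) \<partial>Pi\<^sub>M J (\<lambda>_. gauss) \<partial>gauss \<partial>gauss)"
    using expand[of "\<lambda>w. f (p * y + fst w, y\<^sup>2 + snd w)" for y] by (simp add: add.assoc)
  also have "\<dots> = (\<integral>\<^sup>+x. \<integral>\<^sup>+y. \<integral>\<^sup>+z. f ((p * y + \<theta> k * z) + ?l x, (y\<^sup>2 + z\<^sup>2) + (?q x)) \<partial>gauss \<partial>gauss \<partial>Pi\<^sub>M J (\<lambda>_. gauss))"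
    using swap3[of "\<lambda>x w. f ((p * fst w + \<theta> k * snd w) + ?l x, ((fst w)\<^sup>2 + (snd w)\<^sup>2) + (?q x))"]
    by simp
  also have "\<dots> = (\<integral>\<^sup>+x. \<integral>\<^sup>+y. \<integral>\<^sup>+z. f (s * y + ?l x, (y\<^sup>2 + z\<^sup>2) + (?q x)) \<partial>gauss \<partial>gauss \<partial>Pi\<^sub>M J (\<lambda>_. gauss))"
  proof (rule nn_integral_cong)
    fix x :: "nat \<Rightarrow> real"
    have "(\<lambda>w. f (fst w + ?l x, snd w + (?q x))) \<in> borel_measurable borel"
      unfolding borel_prod[symmetric] by measurable
    from gauss_linear_pair[OF this, of p "\<theta> k"]
    show "(\<integral>\<^sup>+y. \<integral>\<^sup>+z. f ((p * y + \<theta> k * z) + ?l x, (y\<^sup>2 + z\<^sup>2) + (?q x)) \<partial>gauss \<partial>gauss)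
      = (\<integral>\<^sup>+y. \<integral>\<^sup>+z. f (s * y + ?l x, (y\<^sup>2 + z\<^sup>2) + (?q x)) \<partial>gauss \<partial>gauss)"
      by (simp add: s_def)
  qed
  also have "\<dots> = (\<integral>\<^sup>+y. \<integral>\<^sup>+z. \<integral>\<^sup>+x. f (s * y + ?l x, (y\<^sup>2 + z\<^sup>2) + (?q x)) \<partial>Pi\<^sub>M J (\<lambda>_. gauss) \<partial>gauss \<partial>gauss)"
    using swap3[of "\<lambda>x w. f (s * fst w + ?l x, ((fst w)\<^sup>2 + (snd w)\<^sup>2) + (?q x))"]
    by simp
  also have "\<dots> = (\<integral>\<^sup>+z. \<integral>\<^sup>+y. \<integral>\<^sup>+x. f (s * y + ?l x, (y\<^sup>2 + z\<^sup>2) + (?q x)) \<partial>Pi\<^sub>M J (\<lambda>_. gauss) \<partial>gauss \<partial>gauss)"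
  proof -
    interpret pr: pair_sigma_finite gauss gauss by standard
    show ?thesis by (rule pr.Fubini') measurable
  qed
  also have "\<dots> = (\<integral>\<^sup>+z. \<integral>\<^sup>+y. \<integral>\<^sup>+x. f (sqrt (s\<^sup>2 + (\<Sum>i\<in>J. (\<theta> i)\<^sup>2)) * y, (y\<^sup>2 + z\<^sup>2) + (?q x)) \<partial>Pi\<^sub>M J (\<lambda>_. gauss) \<partial>gauss \<partial>gauss)"
  proof (rule nn_integral_cong)
    fix z :: real
    have "(\<lambda>w. f (fst w, snd w + z\<^sup>2)) \<in> borel_measurable borel"
      unfolding borel_prod[symmetric] by measurable
    from insert.IH[OF this, of s]
    show "(\<integral>\<^sup>+y. \<integral>\<^sup>+x. f (s * y + ?l x, (y\<^sup>2 + z\<^sup>2) + (?q x)) \<partial>Pi\<^sub>M J (\<lambda>_. gauss) \<partial>gauss)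
      = (\<integral>\<^sup>+y. \<integral>\<^sup>+x. f (sqrt (s\<^sup>2 + (\<Sum>i\<in>J. (\<theta> i)\<^sup>2)) * y, (y\<^sup>2 + z\<^sup>2) + (?q x)) \<partial>Pi\<^sub>M J (\<lambda>_. gauss) \<partial>gauss)"
      by (simp add: algebra_simps)
  qed
  also have "\<dots> = (\<integral>\<^sup>+y. \<integral>\<^sup>+z. \<integral>\<^sup>+x. f (sqrt (s\<^sup>2 + (\<Sum>i\<in>J. (\<theta> i)\<^sup>2)) * y, (y\<^sup>2 + z\<^sup>2) + (?q x)) \<partial>Pi\<^sub>M J (\<lambda>_. gauss) \<partial>gauss \<partial>gauss)"
  proof -
    interpret pr: pair_sigma_finite gauss gauss by standard
    show ?thesis by (rule pr.Fubini') measurable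
  qed
  also have "\<dots> = (\<integral>\<^sup>+y. \<integral>\<^sup>+x. f (sqrt (p\<^sup>2 + (\<Sum>i\<in>insert k J. (\<theta> i)\<^sup>2)) * y, y\<^sup>2 + (\<Sum>i\<in>insert k J. (x i)\<^sup>2)) \<partial>Pi\<^sub>M (insert k J) (\<lambda>_. gauss) \<partial>gauss)"
    using expand[of "\<lambda>w. f (sqrt (s\<^sup>2 + (\<Sum>i\<in>J. (\<theta> i)\<^sup>2)) * y, y\<^sup>2 + snd w)" for y] by (simp add: add.assoc s2)
  finally show ?case .
qed


section \<open>Radial scaling of the Gaussian measure\<close>

lemma gauss_1d_scaling:
  assumes [measurable]: "g \<in> borel_measurable borel" and l: "l > 0"
  shows "(\<integral>\<^sup>+z. ennreal (exp (- (l\<^sup>2 - 1) * z\<^sup>2 / 2)) * g z \<partial>gauss) = ennreal (1 / l) * (\<integral>\<^sup>+z. g (z / l) \<partial>gauss)"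
proof -
  have d: "std_normal_density (z / l) * exp (- (l\<^sup>2 - 1) * (z / l)\<^sup>2 / 2) = std_normal_density z" for z
  proof -
    have "- (z / l)\<^sup>2 / 2 + - (l\<^sup>2 - 1) * (z / l)\<^sup>2 / 2 = - z\<^sup>2 / 2"
      using l by (simp add: field_simps power2_eq_square)
    then show ?thesis by (simp add: std_normal_density_def exp_add[symmetric])
  qed
  have "(\<integral>\<^sup>+z. ennreal (exp (- (l\<^sup>2 - 1) * z\<^sup>2 / 2)) * g z \<partial>gauss)
    = (\<integral>\<^sup>+z. ennreal (std_normal_density z * exp (- (l\<^sup>2 - 1) * z\<^sup>2 / 2)) * g z \<partial>lborel)"
    by (subst nn_integral_gauss) (simp_all add: mult.assoc[symmetric] ennreal_mult[symmetric])
  also have "\<dots> = ennreal \<bar>1 / l\<bar> * (\<integral>\<^sup>+z. ennreal (std_normal_density (z / l) * exp (- (l\<^sup>2 - 1) * (z / l)\<^sup>2 / 2)) * g (z / l) \<partial>lborel)"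
    using l by (subst nn_integral_real_affine[where c = "1 / l" and t = 0]) auto
  also have "\<dots> = ennreal (1 / l) * (\<integral>\<^sup>+z. ennreal (std_normal_density z) * g (z / l) \<partial>lborel)"
    using l by (simp only: d) simp
  also have "\<dots> = ennreal (1 / l) * (\<integral>\<^sup>+z. g (z / l) \<partial>gauss)"
    by (subst nn_integral_gauss) simp_all
  finally show ?thesis .
qed

text \<open>
  A weight \<open>exp (- (l\<^sup>2 - 1) * |x|\<^sup>2 / 2)\<close> turns the standard Gaussian density into a multiple of the
  density of a vector that is shorter by the factor \<open>l\<close>. With constant \<open>f\<close> this computes the
  exponential moments of \<open>|x|\<^sup>2\<close>, positive ones for \<open>l < 1\<close>; with \<open>f\<close> a multiple of the square root it
  computes the density of the ratio of a coordinate to the norm of the others.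
\<close>

lemma gauss_radial_scaling:
  fixes f :: "real \<Rightarrow> ennreal" and J :: "nat set"
  assumes "f \<in> borel_measurable borel" and "finite J" and l: "l > 0"
  shows "(\<integral>\<^sup>+x. ennreal (exp (- (l\<^sup>2 - 1) * (\<Sum>i\<in>J. (x i)\<^sup>2) / 2)) * f (\<Sum>i\<in>J. (x i)\<^sup>2) \<partial>Pi\<^sub>M J (\<lambda>_. gauss))
    = ennreal ((1 / l) ^ card J) * (\<integral>\<^sup>+x. f ((\<Sum>i\<in>J. (x i)\<^sup>2) / l\<^sup>2) \<partial>Pi\<^sub>M J (\<lambda>_. gauss))"
  using assms(2,1)
proof (induction J arbitrary: f rule: finite_induct)
  case empty then show ?case by simp
next
  case (insert k J)
  let ?q = "\<lambda>x::nat \<Rightarrow> real. \<Sum>i\<in>J. (x i)\<^sup>2"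
  note [simp] = \<open>finite J\<close> \<open>k \<notin> J\<close>
  note [measurable] = \<open>f \<in> borel_measurable borel\<close>
  interpret J: finite_product_sigma_finite "\<lambda>_::nat. gauss" J by standard simp
  interpret pr: pair_sigma_finite gauss "Pi\<^sub>M J (\<lambda>_::nat. gauss)" by standard
  have upd: "(\<Sum>i\<in>J. (if i = k then z else x i)\<^sup>2) = (?q x)" for x :: "nat \<Rightarrow> real" and z
    using \<open>k \<notin> J\<close> by (auto intro!: sum.cong)
  have expand: "(\<integral>\<^sup>+x. g (\<Sum>i\<in>insert k J. (x i)\<^sup>2) \<partial>Pi\<^sub>M (insert k J) (\<lambda>_. gauss))
     = (\<integral>\<^sup>+z. \<integral>\<^sup>+x. g (z\<^sup>2 + (?q x)) \<partial>Pi\<^sub>M J (\<lambda>_. gauss) \<partial>gauss)"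
    if [measurable]: "g \<in> borel_measurable borel" for g :: "real \<Rightarrow> ennreal"
    by (subst gprod.product_nn_integral_insert_rev) (simp_all add: upd)
  let ?w = "\<lambda>t::real. ennreal (exp (- (l\<^sup>2 - 1) * t / 2))"
  have w_add: "?w (s + t) = ?w s * ?w t" for s t
    by (simp add: ennreal_mult[symmetric] exp_add[symmetric] algebra_simps add_divide_distrib diff_divide_distrib)
  have ih: "(\<integral>\<^sup>+x. ?w (?q x) * f (z\<^sup>2 + (?q x)) \<partial>Pi\<^sub>M J (\<lambda>_. gauss))
    = ennreal ((1 / l) ^ card J) * (\<integral>\<^sup>+x. f (z\<^sup>2 + (?q x) / l\<^sup>2) \<partial>Pi\<^sub>M J (\<lambda>_. gauss))" for z
  proof -
    have "(\<lambda>t. f (z\<^sup>2 + t)) \<in> borel_measurable borel" by measurable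
    from insert.IH[OF this] show ?thesis .
  qed
  have "(\<integral>\<^sup>+x. ?w (\<Sum>i\<in>insert k J. (x i)\<^sup>2) * f (\<Sum>i\<in>insert k J. (x i)\<^sup>2) \<partial>Pi\<^sub>M (insert k J) (\<lambda>_. gauss))
    = (\<integral>\<^sup>+z. \<integral>\<^sup>+x. ?w (z\<^sup>2 + (?q x)) * f (z\<^sup>2 + (?q x)) \<partial>Pi\<^sub>M J (\<lambda>_. gauss) \<partial>gauss)"
    by (rule expand[of "\<lambda>t. ?w t * f t"]) measurable
  also have "\<dots> = (\<integral>\<^sup>+z. ?w (z\<^sup>2) * (\<integral>\<^sup>+x. ?w (?q x) * f (z\<^sup>2 + (?q x)) \<partial>Pi\<^sub>M J (\<lambda>_. gauss)) \<partial>gauss)"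
    by (rule nn_integral_cong, subst nn_integral_cmult[symmetric]) (measurable, simp only: w_add mult.assoc)
  also have "\<dots> = (\<integral>\<^sup>+z. ?w (z\<^sup>2) * (ennreal ((1 / l) ^ card J) * (\<integral>\<^sup>+x. f (z\<^sup>2 + (?q x) / l\<^sup>2) \<partial>Pi\<^sub>M J (\<lambda>_. gauss))) \<partial>gauss)"
    by (simp only: ih)
  also have "\<dots> = ennreal ((1 / l) ^ card J) * (\<integral>\<^sup>+z. ?w (z\<^sup>2) * (\<integral>\<^sup>+x. f (z\<^sup>2 + (?q x) / l\<^sup>2) \<partial>Pi\<^sub>M J (\<lambda>_. gauss)) \<partial>gauss)"
    by (subst nn_integral_cmult[symmetric]) (measurable, simp add: mult_ac)
  also have "(\<integral>\<^sup>+z. ?w (z\<^sup>2) * (\<integral>\<^sup>+x. f (z\<^sup>2 + (?q x) / l\<^sup>2) \<partial>Pi\<^sub>M J (\<lambda>_. gauss)) \<partial>gauss)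
    = ennreal (1 / l) * (\<integral>\<^sup>+z. \<integral>\<^sup>+x. f ((z / l)\<^sup>2 + (?q x) / l\<^sup>2) \<partial>Pi\<^sub>M J (\<lambda>_. gauss) \<partial>gauss)"
    by (rule gauss_1d_scaling[OF _ l]) measurable
  also have "(\<integral>\<^sup>+z. \<integral>\<^sup>+x. f ((z / l)\<^sup>2 + (?q x) / l\<^sup>2) \<partial>Pi\<^sub>M J (\<lambda>_. gauss) \<partial>gauss)
    = (\<integral>\<^sup>+x. f ((\<Sum>i\<in>insert k J. (x i)\<^sup>2) / l\<^sup>2) \<partial>Pi\<^sub>M (insert k J) (\<lambda>_. gauss))"
    by (subst expand[of "\<lambda>t. f (t / l\<^sup>2)"]) (measurable, simp add: power_divide add_divide_distrib)
  finally show ?case using l by (simp add: mult.assoc[symmetric] ennreal_mult[symmetric] mult.commute)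
qed

text \<open>
  Compares the ratio density with the Cauchy density, whose integral is known. After squaring, the
  claim follows from the terms of \<open>(1 + u\<^sup>2) ^ n\<close> up to second order in \<open>u\<^sup>2\<close>.
\<close>

lemma one_plus_square_power_ge:
  fixes u :: real
  assumes "n \<ge> 2"
  shows "(sqrt (1 + u\<^sup>2)) ^ n \<ge> 1 + real n * u\<^sup>2 / 2"
proof -
  have binom: "(1 + y) ^ n \<ge> 1 + real n * y + real n * (real n - 1) / 2 * y\<^sup>2" if "y \<ge> 0" for y :: real
  proof (induction n)
    case (Suc n)
    have "1 + real (Suc n) * y + real (Suc n) * (real (Suc n) - 1) / 2 * y\<^sup>2
       \<le> (1 + y) * (1 + real n * y + real n * (real n - 1) / 2 * y\<^sup>2)"
    proof -
      have "(1 + y) * (1 + real n * y + real n * (real n - 1) / 2 * y\<^sup>2)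
       - (1 + real (Suc n) * y + real (Suc n) * (real (Suc n) - 1) / 2 * y\<^sup>2) = real n * (real n - 1) / 2 * y ^ 3"
        by (simp add: algebra_simps power2_eq_square power3_eq_cube add_divide_distrib diff_divide_distrib)
      moreover have "real n * (real n - 1) / 2 * y ^ 3 \<ge> 0" using that by (cases n) auto
      ultimately show ?thesis by linarith
    qed
    also have "\<dots> \<le> (1 + y) * (1 + y) ^ n" using Suc that by (intro mult_left_mono) auto
    finally show ?case by simp
  qed simp
  \<comment> \<open>\<open>n \<ge> 2\<close> makes the second-order term at least \<open>(n * u\<^sup>2 / 2)\<^sup>2\<close>\<close>
  define q where "q = (u\<^sup>2)\<^sup>2"
  have "real n * real n / 4 \<le> real n * (real n - 1) / 2"
    using assms mult_left_mono[of 2 "real n" "real n"] by (simp add: field_simps)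
  then have "real n * real n / 4 * q \<le> real n * (real n - 1) / 2 * q"
    by (rule mult_right_mono) (simp add: q_def)
  moreover have "(1 + real n * u\<^sup>2 / 2)\<^sup>2 = 1 + real n * u\<^sup>2 + real n * real n / 4 * q"
    by (simp add: q_def power2_eq_square algebra_simps)
  ultimately have "(1 + real n * u\<^sup>2 / 2)\<^sup>2 \<le> 1 + real n * u\<^sup>2 + real n * (real n - 1) / 2 * (u\<^sup>2)\<^sup>2"
    by (simp add: q_def)
  also have "\<dots> \<le> (1 + u\<^sup>2) ^ n" by (rule binom) simp
  also have "\<dots> = ((sqrt (1 + u\<^sup>2)) ^ n)\<^sup>2" by (simp add: power_mult[symmetric] mult.commute[of n] power_mult[of _ 2])
  finally show ?thesis by (rule power2_le_imp_le) simp
qed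

lemma nn_integral_inverse_one_plus_square:
  "(\<integral>\<^sup>+x. ennreal (1 / (1 + x\<^sup>2)) \<partial>lborel) = ennreal pi"
proof -
  let ?f = "\<lambda>x::real. 1 / (1 + x\<^sup>2)"
  have half: "(\<integral>\<^sup>+x. ennreal (?f x) * indicator {0..} x \<partial>lborel) = ennreal (pi / 2)"
  proof -
    have "(arctan has_real_derivative ?f x) (at x)" for x
      using DERIV_arctan[of x] by (simp add: inverse_eq_divide)
    from nn_integral_FTC_atLeast[of ?f 0 arctan, OF _ this _ tendsto_arctan_at_top]
    show ?thesis by (simp add: add_nonneg_nonneg)
  qed
  have "(\<integral>\<^sup>+x. ennreal (?f x) \<partial>lborel)
    = (\<integral>\<^sup>+x. ennreal (?f x) * indicator {0..} x + ennreal (?f x) * indicator {..0} x \<partial>lborel)"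
    by (intro nn_integral_cong_AE AE_I[where N = "{0}"]) (auto simp: indicator_def)
  also have "\<dots> = (\<integral>\<^sup>+x. ennreal (?f x) * indicator {0..} x \<partial>lborel) + (\<integral>\<^sup>+x. ennreal (?f x) * indicator {..0} x \<partial>lborel)"
    by (rule nn_integral_add) auto
  also have "(\<integral>\<^sup>+x. ennreal (?f x) * indicator {..0} x \<partial>lborel) = (\<integral>\<^sup>+x. ennreal (?f x) * indicator {0..} x \<partial>lborel)"
    by (subst nn_integral_real_affine[where c = "-1" and t = 0]) (auto simp: indicator_def intro!: nn_integral_cong)
  finally show ?thesis by (simp add: half ennreal_plus[symmetric] del: ennreal_plus)
qed

lemma cauchy_power_integral_bound:
  assumes "n \<ge> 2"
  shows "(\<integral>\<^sup>+u. ennreal ((1 / sqrt (1 + u\<^sup>2)) ^ n) \<partial>lborel) \<le> ennreal (pi * sqrt 2 / sqrt (real n))"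
proof -
  define c where "c = sqrt (real n / 2)"
  have c: "c > 0" "c\<^sup>2 = real n / 2" using assms by (auto simp: c_def)
  have "(\<integral>\<^sup>+u. ennreal ((1 / sqrt (1 + u\<^sup>2)) ^ n) \<partial>lborel) \<le> (\<integral>\<^sup>+u. ennreal (1 / (1 + (c * u)\<^sup>2)) \<partial>lborel)"
  proof (intro nn_integral_mono ennreal_leI)
    fix u :: real
    have "1 + (c * u)\<^sup>2 \<le> (sqrt (1 + u\<^sup>2)) ^ n"
      using one_plus_square_power_ge[OF assms, of u] by (simp add: power_mult_distrib c)
    moreover have "1 + (c * u)\<^sup>2 > 0" by (simp add: add_pos_nonneg)
    ultimately show "(1 / sqrt (1 + u\<^sup>2)) ^ n \<le> 1 / (1 + (c * u)\<^sup>2)"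
      by (simp add: power_divide frac_le)
  qed
  also have "\<dots> = ennreal (1 / c) * (\<integral>\<^sup>+u. ennreal (1 / (1 + u\<^sup>2)) \<partial>lborel)"
    using c by (subst nn_integral_real_affine[where c = "1 / c" and t = 0]) auto
  also have "\<dots> = ennreal (pi * sqrt 2 / sqrt (real n))"
    using c(1) by (simp add: nn_integral_inverse_one_plus_square ennreal_mult[symmetric])
      (simp add: c_def real_sqrt_divide)
  finally show ?thesis .
qed

section \<open>The law of a coordinate on the sphere\<close>

lemma std_gaussian_eq: "std_gaussian n = Pi\<^sub>M {1..n} (\<lambda>_. gauss)"
  by (simp add: std_gaussian_def)

lemma prob_space_std_gaussian: "prob_space (std_gaussian n)"
  unfolding std_gaussian_eq by (intro prob_space_PiM prob_space_gauss)

lemma measurable_std_gaussian_component: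
  "i \<in> {1..n} \<Longrightarrow> (\<lambda>x. x i) \<in> borel_measurable (std_gaussian n)"
  unfolding std_gaussian_eq by measurable

lemma measurable_L2_set_std_gaussian [measurable]: "(\<lambda>x. L2_set x {1..n}) \<in> borel_measurable (std_gaussian n)"
  unfolding L2_set_def std_gaussian_eq by measurable

lemma measurable_sum_squares_std_gaussian [measurable]: "(\<lambda>x. \<Sum>i=1..n. (x i)\<^sup>2) \<in> borel_measurable (std_gaussian n)"
  unfolding std_gaussian_eq by measurable

lemma measurable_linear_std_gaussian [measurable]:
  fixes \<theta> :: "nat \<Rightarrow> real"
  shows "(\<lambda>x. \<Sum>i=1..n. \<theta> i * x i) \<in> borel_measurable (std_gaussian n)"
  unfolding std_gaussian_eq by measurable

lemma std_gaussian_split: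
  assumes "n \<ge> 1" and [measurable]: "f \<in> borel_measurable (std_gaussian n)"
  shows "(\<integral>\<^sup>+x. f x \<partial>std_gaussian n) = (\<integral>\<^sup>+x. \<integral>\<^sup>+y. f (x(1 := y)) \<partial>gauss \<partial>gauss_power {2..n})"
    "(\<integral>\<^sup>+x. f x \<partial>std_gaussian n) = (\<integral>\<^sup>+y. \<integral>\<^sup>+x. f (x(1 := y)) \<partial>gauss_power {2..n} \<partial>gauss)"
proof -
  have I: "{1..n} = insert 1 {2..n}" using assms by auto
  have f: "f \<in> borel_measurable (Pi\<^sub>M (insert 1 {2..n}) (\<lambda>_. gauss))"
    using assms(2) unfolding std_gaussian_eq I .
  show "(\<integral>\<^sup>+x. f x \<partial>std_gaussian n) = (\<integral>\<^sup>+x. \<integral>\<^sup>+y. f (x(1 := y)) \<partial>gauss \<partial>gauss_power {2..n})"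
    unfolding std_gaussian_eq I by (rule gprod.product_nn_integral_insert[OF _ _ f]) auto
  show "(\<integral>\<^sup>+x. f x \<partial>std_gaussian n) = (\<integral>\<^sup>+y. \<integral>\<^sup>+x. f (x(1 := y)) \<partial>gauss_power {2..n} \<partial>gauss)"
    unfolding std_gaussian_eq I by (rule gprod.product_nn_integral_insert_rev[OF _ _ f]) auto
qed

lemma sum_update_first:
  fixes g :: "nat \<Rightarrow> real \<Rightarrow> real"
  assumes "n \<ge> 1"
  shows "(\<Sum>i=1..n. g i ((x(1 := y)) i)) = g 1 y + (\<Sum>i=2..n. g i (x i))"
proof -
  have "{1..n} = insert 1 {2..n}" using assms by auto
  then show ?thesis by (simp only: sum.insert[OF finite_atLeastAtMost]) (auto intro!: sum.cong)
qed

lemma std_gaussian_direction: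
  fixes f :: "real \<times> real \<Rightarrow> ennreal" and \<theta> :: "nat \<Rightarrow> real"
  assumes [measurable]: "f \<in> borel_measurable borel" and n: "n \<ge> 1" and \<theta>: "(\<Sum>i=1..n. (\<theta> i)\<^sup>2) = 1"
  shows "(\<integral>\<^sup>+x. f (\<Sum>i=1..n. \<theta> i * x i, \<Sum>i=1..n. (x i)\<^sup>2) \<partial>std_gaussian n)
     = (\<integral>\<^sup>+x. f (x 1, \<Sum>i=1..n. (x i)\<^sup>2) \<partial>std_gaussian n)"
proof -
  have [measurable]: "f \<in> borel_measurable (borel \<Otimes>\<^sub>M borel)" by (simp add: borel_prod)
  have "{1..n} = insert 1 {2..n}" using n by auto
  then have 1: "(\<theta> 1)\<^sup>2 + (\<Sum>i=2..n. (\<theta> i)\<^sup>2) = 1" using \<theta> by simp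
  have [measurable]: "(\<lambda>x. x 1) \<in> borel_measurable (std_gaussian n)"
    by (rule measurable_std_gaussian_component) (use n in auto)
  have "(\<integral>\<^sup>+x. f (\<Sum>i=1..n. \<theta> i * x i, \<Sum>i=1..n. (x i)\<^sup>2) \<partial>std_gaussian n)
    = (\<integral>\<^sup>+y. \<integral>\<^sup>+x. f (\<theta> 1 * y + (\<Sum>i=2..n. \<theta> i * x i), y\<^sup>2 + (\<Sum>i=2..n. (x i)\<^sup>2)) \<partial>gauss_power {2..n} \<partial>gauss)"
    by (subst std_gaussian_split(2)[OF n], measurable)
       (simp only: sum_update_first[OF n, of "\<lambda>i z. \<theta> i * z"] sum_update_first[OF n, of "\<lambda>i z. z\<^sup>2"])
  also have "\<dots> = (\<integral>\<^sup>+y. \<integral>\<^sup>+x. f (y, y\<^sup>2 + (\<Sum>i=2..n. (x i)\<^sup>2)) \<partial>gauss_power {2..n} \<partial>gauss)"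
    by (subst gauss_linear_form_law) (simp_all only: 1 real_sqrt_one mult_1 finite_atLeastAtMost assms(1))
  also have "\<dots> = (\<integral>\<^sup>+x. f (x 1, \<Sum>i=1..n. (x i)\<^sup>2) \<partial>std_gaussian n)"
    by (subst std_gaussian_split(2)[OF n], measurable)
       (simp only: sum_update_first[OF n, of "\<lambda>i z. z\<^sup>2"] fun_upd_same)
  finally show ?thesis .
qed

lemma sphere_Phi_direction:
  assumes n: "n \<ge> 1" and \<theta>: "(\<Sum>i=1..n. (\<theta> i)\<^sup>2) = 1"
  shows "measure (std_gaussian n) {x \<in> space (std_gaussian n). sqrt (real n) * (\<Sum>i=1..n. \<theta> i * x i) / L2_set x {1..n} \<le> t}
    = sphere_Phi n t"
proof -
  let ?g = "\<lambda>z::real\<times>real. indicator {z. sqrt (real n) * fst z / sqrt (snd z) \<le> t} z :: ennreal"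
  have m: "{z. sqrt (real n) * fst z / sqrt (snd z) \<le> t} \<in> sets (borel :: (real \<times> real) measure)"
  proof -
    have "{z \<in> space (borel \<Otimes>\<^sub>M borel :: (real \<times> real) measure). sqrt (real n) * fst z / sqrt (snd z) \<le> t} \<in> sets (borel \<Otimes>\<^sub>M borel)"
      by measurable
    then show ?thesis unfolding borel_prod[symmetric] by (simp add: space_pair_measure)
  qed
  have [measurable]: "(\<lambda>x. x 1) \<in> borel_measurable (std_gaussian n)"
    by (rule measurable_std_gaussian_component) (use n in auto)
  define A where "A = {x \<in> space (std_gaussian n). sqrt (real n) * (\<Sum>i=1..n. \<theta> i * x i) / L2_set x {1..n} \<le> t}"
  define B where "B = {x \<in> space (std_gaussian n). sqrt (real n) * x 1 / L2_set x {1..n} \<le> t}"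
  have sets [measurable]: "A \<in> sets (std_gaussian n)" "B \<in> sets (std_gaussian n)"
    unfolding A_def B_def by measurable
  have "emeasure (std_gaussian n) A = (\<integral>\<^sup>+x. indicator A x \<partial>std_gaussian n)" by simp
  also have "\<dots> = (\<integral>\<^sup>+x. ?g (\<Sum>i=1..n. \<theta> i * x i, \<Sum>i=1..n. (x i)\<^sup>2) \<partial>std_gaussian n)"
    by (rule nn_integral_cong) (simp add: A_def L2_set_def indicator_def)
  also have "\<dots> = (\<integral>\<^sup>+x. ?g (x 1, \<Sum>i=1..n. (x i)\<^sup>2) \<partial>std_gaussian n)"
    by (rule std_gaussian_direction[OF _ n \<theta>]) (use m in simp)
  also have "\<dots> = (\<integral>\<^sup>+x. indicator B x \<partial>std_gaussian n)"
    by (rule nn_integral_cong) (simp add: B_def L2_set_def indicator_def)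
  also have "\<dots> = emeasure (std_gaussian n) B" by simp
  finally have "emeasure (std_gaussian n) A = emeasure (std_gaussian n) B" .
  then show ?thesis by (simp add: sphere_Phi_def measure_def A_def B_def)
qed


text \<open>
  The map \<open>a \<mapsto> a / sqrt (1 - a\<^sup>2)\<close> expands distances, because \<open>1 / sqrt (1 - a\<^sup>2) - 1\<close> is nonnegative
  and increases with \<open>|a|\<close>.
\<close>

lemma div_sqrt_one_minus_square_diff_ge:
  fixes a a' :: real
  assumes "-1 < a" "a \<le> a'" "a' < 1"
  shows "a' - a \<le> a' / sqrt (1 - a'\<^sup>2) - a / sqrt (1 - a\<^sup>2)"
proof -
  define p where "p a = 1 / sqrt (1 - a\<^sup>2) - 1" for a :: real
  have p0: "0 \<le> p a" if "-1 < a" "a < 1" for a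
    using that abs_square_less_1[of a] by (auto simp: p_def)
  have pm: "p a \<le> p b" if "\<bar>a\<bar> \<le> \<bar>b\<bar>" "\<bar>b\<bar> < 1" for a b
  proof -
    have "a\<^sup>2 \<le> b\<^sup>2" "b\<^sup>2 < 1" using that abs_square_less_1[of b] by (auto simp: abs_le_square_iff)
    then show ?thesis unfolding p_def by (intro diff_right_mono divide_left_mono) auto
  qed
  have "a * p a \<le> a' * p a'"
  proof (cases "a \<ge> 0")
    case True
    then show ?thesis using assms by (intro mult_mono pm p0) auto
  next
    case False
    show ?thesis
    proof (cases "a' \<ge> 0")
      case True
      then have "a * p a \<le> 0" "0 \<le> a' * p a'"
        using False assms p0[of a] p0[of a'] by (auto simp: mult_nonpos_nonneg)
      then show ?thesis by linarith
    next
      case a': False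
      have "(- a') * p a' \<le> (- a) * p a" using assms False a' by (intro mult_mono pm p0) auto
      then show ?thesis by simp
    qed
  qed
  then show ?thesis by (simp add: p_def algebra_simps)
qed

text \<open>
  The two maps are inverse to each other, since \<open>w / sqrt (1 + w\<^sup>2)\<close> is the sine of \<open>arctan w\<close> and
  \<open>a / sqrt (1 - a\<^sup>2)\<close> is the tangent of \<open>arcsin a\<close>.
\<close>

lemma less_div_sqrt_one_plus_square_iff:
  fixes a w :: real
  assumes "\<bar>a\<bar> < 1"
  shows "a < w / sqrt (1 + w\<^sup>2) \<longleftrightarrow> a / sqrt (1 - a\<^sup>2) < w"
proof -
  have eq1: "tan (arcsin a) = a / sqrt (1 - a\<^sup>2)"
    using assms by (simp add: tan_def cos_arcsin)
  have b: "- (pi / 2) < arcsin a" "arcsin a < pi / 2"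
    using assms arcsin_lt_bounded[of a] by auto
  have "a / sqrt (1 - a\<^sup>2) < w \<longleftrightarrow> tan (arcsin a) < tan (arctan w)" by (simp add: eq1 tan_arctan)
  also have "\<dots> \<longleftrightarrow> arcsin a < arctan w"
    using b arctan_bounded[of w] by (intro tan_mono_lt_eq) auto
  also have "\<dots> \<longleftrightarrow> sin (arcsin a) < sin (arctan w)"
    using b arctan_bounded[of w] by (intro sin_mono_less_eq[symmetric]) auto
  also have "\<dots> \<longleftrightarrow> a < w / sqrt (1 + w\<^sup>2)" using assms by (simp add: sin_arctan)
  finally show ?thesis ..
qed

lemma nn_integral_gauss_scaled_interval:
  assumes R: "R > 0"
  shows "(\<integral>\<^sup>+y. indicator {z * R<..z' * R} y \<partial>gauss)
    = (\<integral>\<^sup>+u. ennreal (R / sqrt (2 * pi) * exp (- u\<^sup>2 * R\<^sup>2 / 2)) * indicator {z<..z'} u \<partial>lborel)"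
proof -
  have i: "indicator {z * R<..z' * R} (R * u) = (indicator {z<..z'} u :: ennreal)" for u
    using R by (auto simp: indicator_def mult.commute)
  have d: "R * std_normal_density (R * u) = R / sqrt (2 * pi) * exp (- u\<^sup>2 * R\<^sup>2 / 2)" for u
    by (simp add: std_normal_density_def power_mult_distrib mult.commute)
  have "(\<integral>\<^sup>+y. indicator {z * R<..z' * R} y \<partial>gauss)
    = ennreal R * (\<integral>\<^sup>+u. ennreal (std_normal_density (R * u)) * indicator {z<..z'} u \<partial>lborel)"
    using R by (subst nn_integral_gauss, simp, subst nn_integral_real_affine[where c = R and t = 0]) (auto simp: i)
  also have "\<dots> = (\<integral>\<^sup>+u. ennreal (R / sqrt (2 * pi) * exp (- u\<^sup>2 * R\<^sup>2 / 2)) * indicator {z<..z'} u \<partial>lborel)"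
    using R by (subst nn_integral_cmult[symmetric])
      (simp_all only: mult.assoc[symmetric] ennreal_mult'[OF less_imp_le[OF R], symmetric] d, simp_all)
  finally show ?thesis .
qed

text \<open>
  Under the Gaussian measure this radius is independent of the first coordinate, so that the ratio of the
  two has a density that can be computed.
\<close>

definition tail_radius :: "nat \<Rightarrow> (nat \<Rightarrow> real) \<Rightarrow> real" where
  "tail_radius n x = sqrt (\<Sum>i=2..n. (x i)\<^sup>2)"

lemma tail_radius_nonneg: "tail_radius n x \<ge> 0" by (simp add: tail_radius_def sum_nonneg)

abbreviation tail_gauss :: "nat \<Rightarrow> (nat \<Rightarrow> real) measure" where
  "tail_gauss n \<equiv> gauss_power {2..n}"

lemma measurable_tail_radius [measurable]: "tail_radius n \<in> borel_measurable (tail_gauss n)"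
  unfolding tail_radius_def by measurable

text \<open>
  The left-hand side is the density at \<open>u\<close> of the ratio \<open>X 1 / tail_radius n X\<close>: given the radius
  \<open>R\<close>, the ratio is normal with standard deviation \<open>1 / R\<close>. The scaling lemma evaluates its average over
  \<open>R\<close> up to a constant that does not depend on \<open>u\<close>.
\<close>

lemma ratio_density:
  assumes n: "n \<ge> 2"
  shows "(\<integral>\<^sup>+x. ennreal (tail_radius n x / sqrt (2 * pi) * exp (- u\<^sup>2 * (tail_radius n x)\<^sup>2 / 2)) \<partial>tail_gauss n)
    = ennreal ((1 / sqrt (1 + u\<^sup>2)) ^ n) * (\<integral>\<^sup>+x. ennreal (tail_radius n x / sqrt (2 * pi)) \<partial>tail_gauss n)"
proof -
  define l where "l = sqrt (1 + u\<^sup>2)"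
  have l: "l > 0" "l\<^sup>2 - 1 = u\<^sup>2" by (auto simp: l_def add_pos_nonneg)
  have [simp]: "(tail_radius n x)\<^sup>2 = (\<Sum>i=2..n. (x i)\<^sup>2)" for x by (simp add: tail_radius_def sum_nonneg)
  have sc: "sqrt ((\<Sum>i=2..n. (x i)\<^sup>2) / l\<^sup>2) / sqrt (2 * pi) = 1 / l * (tail_radius n x / sqrt (2 * pi))" for x
    using l by (simp add: real_sqrt_divide tail_radius_def)
  have "(\<integral>\<^sup>+x. ennreal (tail_radius n x / sqrt (2 * pi) * exp (- u\<^sup>2 * (tail_radius n x)\<^sup>2 / 2)) \<partial>tail_gauss n)
    = (\<integral>\<^sup>+x. ennreal (exp (- (l\<^sup>2 - 1) * (\<Sum>i\<in>{2..n}. (x i)\<^sup>2) / 2)) * ennreal (sqrt (\<Sum>i\<in>{2..n}. (x i)\<^sup>2) / sqrt (2 * pi)) \<partial>tail_gauss n)"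
    by (intro nn_integral_cong) (simp add: l(2) tail_radius_def ennreal_mult[symmetric] sum_nonneg mult.commute)
  also have "\<dots> = ennreal ((1 / l) ^ card {2..n}) * (\<integral>\<^sup>+x. ennreal (sqrt ((\<Sum>i=2..n. (x i)\<^sup>2) / l\<^sup>2) / sqrt (2 * pi)) \<partial>tail_gauss n)"
    by (rule gauss_radial_scaling[where f = "\<lambda>t. ennreal (sqrt t / sqrt (2 * pi))"]) (use l in auto)
  also have "\<dots> = ennreal ((1 / l) ^ card {2..n}) * (ennreal (1 / l) * (\<integral>\<^sup>+x. ennreal (tail_radius n x / sqrt (2 * pi)) \<partial>tail_gauss n))"
  proof -
    have "(\<integral>\<^sup>+x. ennreal (sqrt ((\<Sum>i=2..n. (x i)\<^sup>2) / l\<^sup>2) / sqrt (2 * pi)) \<partial>tail_gauss n)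
      = (\<integral>\<^sup>+x. ennreal (1 / l) * ennreal (tail_radius n x / sqrt (2 * pi)) \<partial>tail_gauss n)"
      by (rule nn_integral_cong, simp only: sc, rule ennreal_mult) (use l(1) tail_radius_nonneg in auto)
    also have "\<dots> = ennreal (1 / l) * (\<integral>\<^sup>+x. ennreal (tail_radius n x / sqrt (2 * pi)) \<partial>tail_gauss n)"
      by (rule nn_integral_cmult) measurable
    finally show ?thesis by simp
  qed
  also have "\<dots> = ennreal ((1 / l) ^ n) * (\<integral>\<^sup>+x. ennreal (tail_radius n x / sqrt (2 * pi)) \<partial>tail_gauss n)"
  proof -
    have "(1 / l) ^ card {2..n} * (1 / l) = (1 / l) ^ Suc (card {2..n})" by simp
    also have "Suc (card {2..n}) = n" using n by simp
    finally show ?thesis using l(1) by (simp add: mult.assoc[symmetric] ennreal_mult[symmetric])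
  qed
  finally show ?thesis by (simp add: l_def)
qed

lemma AE_tail_radius_pos:
  assumes n: "n \<ge> 2"
  shows "AE x in tail_gauss n. tail_radius n x > 0"
proof -
  interpret p: product_prob_space "\<lambda>_::nat. gauss" "{2..n}" by (rule product_prob_space_gauss)
  have "AE y in gauss. y \<noteq> 0"
    by (subst AE_density) (auto intro: AE_lborel_singleton eventually_mono)
  then have "AE x in tail_gauss n. x 2 \<noteq> 0"
    using n by (intro p.AE_component) auto
  then show ?thesis
  proof eventually_elim
    case (elim x)
    have "0 < (x 2)\<^sup>2" using elim by simp
    also have "\<dots> \<le> (\<Sum>i=2..n. (x i)\<^sup>2)" using n by (intro member_le_sum) auto
    finally show ?case by (simp add: tail_radius_def)
  qed
qed

text \<open>
  The ratio density has total mass \<open>1\<close>, so an upper bound for the integral of \<open>(1 + u\<^sup>2) powr (- n / 2)\<close>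
  is a lower bound for the constant in front of it.
\<close>

lemma expected_tail_radius_ge:
  assumes n: "n \<ge> 2"
  shows "(\<integral>\<^sup>+x. ennreal (tail_radius n x / sqrt (2 * pi)) \<partial>tail_gauss n) \<ge> ennreal (sqrt (real n) / (pi * sqrt 2))"
proof -
  let ?D = "\<integral>\<^sup>+x. ennreal (tail_radius n x / sqrt (2 * pi)) \<partial>tail_gauss n"
  let ?R = "tail_radius n"
  let ?f = "\<lambda>u x. ennreal (tail_radius n x / sqrt (2 * pi) * exp (- u\<^sup>2 * (tail_radius n x)\<^sup>2 / 2))"
  interpret pp: prob_space "tail_gauss n" by (intro prob_space_PiM prob_space_gauss)
  interpret pr: pair_sigma_finite lborel "tail_gauss n" ..
  have one: "(\<integral>\<^sup>+u. ennreal (R / sqrt (2 * pi) * exp (- u\<^sup>2 * R\<^sup>2 / 2)) \<partial>lborel) = 1" if "R > 0" for R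
  proof -
    have d: "R * std_normal_density (R * u) = R / sqrt (2 * pi) * exp (- u\<^sup>2 * R\<^sup>2 / 2)" for u
      by (simp add: std_normal_density_def power_mult_distrib mult.commute)
    have "(\<integral>\<^sup>+y. 1 \<partial>gauss) = ennreal R * (\<integral>\<^sup>+u. ennreal (std_normal_density (R * u)) \<partial>lborel)"
      using that by (subst nn_integral_gauss, simp, subst nn_integral_real_affine[where c = R and t = 0]) auto
    also have "\<dots> = (\<integral>\<^sup>+u. ennreal (R / sqrt (2 * pi) * exp (- u\<^sup>2 * R\<^sup>2 / 2)) \<partial>lborel)"
      using that by (subst nn_integral_cmult[symmetric])
        (simp_all only: ennreal_mult'[OF less_imp_le[OF that], symmetric] d, simp_all)
    finally show ?thesis using gauss.emeasure_space_1 by simp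
  qed
  have "1 = (\<integral>\<^sup>+x. 1 \<partial>tail_gauss n)" by (simp add: pp.emeasure_space_1)
  also have "\<dots> = (\<integral>\<^sup>+x. \<integral>\<^sup>+u. ?f u x \<partial>lborel \<partial>tail_gauss n)"
  proof (rule nn_integral_cong_AE)
    show "AE x in tail_gauss n. 1 = (\<integral>\<^sup>+u. ?f u x \<partial>lborel)"
      using AE_tail_radius_pos[OF n] by eventually_elim (rule one[symmetric])
  qed
  also have "\<dots> = (\<integral>\<^sup>+u. \<integral>\<^sup>+x. ?f u x \<partial>tail_gauss n \<partial>lborel)"
    by (rule pr.Fubini') measurable
  also have "\<dots> = (\<integral>\<^sup>+u. ennreal ((1 / sqrt (1 + u\<^sup>2)) ^ n) \<partial>lborel) * ?D"
    by (simp only: ratio_density[OF n]) (rule nn_integral_multc, measurable)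
  also have "\<dots> \<le> ennreal (pi * sqrt 2 / sqrt (real n)) * ?D"
    by (intro mult_right_mono cauchy_power_integral_bound n) simp
  finally have "ennreal (sqrt (real n) / (pi * sqrt 2)) * 1
    \<le> ennreal (sqrt (real n) / (pi * sqrt 2)) * (ennreal (pi * sqrt 2 / sqrt (real n)) * ?D)"
    by (intro mult_left_mono) auto
  also have "\<dots> = ?D" using n by (simp add: mult.assoc[symmetric] ennreal_mult[symmetric])
  finally show ?thesis by simp
qed

text \<open>
  In terms of the ratio \<open>u = x 1 / tail_radius n x\<close> the sphere coordinate is \<open>sqrt n * u / sqrt (1 + u\<^sup>2)\<close>.
  An interval of values \<open>t\<close> corresponds to an interval of ratios that is at least \<open>1 / sqrt n\<close> times as
  long, and there \<open>1 / sqrt (1 + u\<^sup>2) = sqrt (1 - t\<^sup>2 / n)\<close> bounds the ratio density from below.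
\<close>

lemma sphere_Phi_interval_ge:
  assumes n: "n \<ge> 2" and T: "\<bar>t\<bar> \<le> T" "\<bar>t'\<bar> \<le> T" "T < sqrt (real n)" and tt: "t \<le> t'"
  shows "sphere_Phi n t' - sphere_Phi n t \<ge> (t' - t) / (pi * sqrt 2) * (sqrt (1 - T\<^sup>2 / real n)) ^ n"
proof -
  interpret G: prob_space "std_gaussian n" by (rule prob_space_std_gaussian)
  interpret pr: pair_sigma_finite lborel "tail_gauss n"
    by (intro pair_sigma_finite.intro sigma_finite_lborel prob_space_imp_sigma_finite prob_space_PiM prob_space_gauss)
  let ?R = "tail_radius n"
  let ?D = "\<integral>\<^sup>+x. ennreal (?R x / sqrt (2 * pi)) \<partial>tail_gauss n"
  let ?f = "\<lambda>u x. ennreal (tail_radius n x / sqrt (2 * pi) * exp (- u\<^sup>2 * (tail_radius n x)\<^sup>2 / 2))" and ?W = "(sqrt (1 - T\<^sup>2 / real n)) ^ n"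
  define s where "s = sqrt (real n)"
  have s: "s > 0" "s\<^sup>2 = real n" using n by (auto simp: s_def)
  define a where "a = t / s" define a' where "a' = t' / s" define b where "b = T / s"
  have ab: "\<bar>a\<bar> \<le> b" "\<bar>a'\<bar> \<le> b" "b < 1" "0 \<le> b" "a \<le> a'"
    using T tt s by (auto simp: a_def a'_def b_def s_def[symmetric] divide_right_mono)
  then have ab1: "\<bar>a\<bar> < 1" "\<bar>a'\<bar> < 1" by auto
  define z where "z = a / sqrt (1 - a\<^sup>2)" define z' where "z' = a' / sqrt (1 - a'\<^sup>2)"
  have zz: "a' - a \<le> z' - z" unfolding z_def z'_def using ab ab1 by (intro div_sqrt_one_minus_square_diff_ge) auto
  have b2: "b\<^sup>2 < 1" "b\<^sup>2 = T\<^sup>2 / real n"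
    using ab abs_square_less_1[of b] by simp (simp add: b_def power_divide s)
  have W: "?W \<le> (1 / sqrt (1 + u\<^sup>2)) ^ n" if u: "u \<in> {z<..z'}" for u
  proof -
    have bounds: "- b \<le> a" "a' \<le> b" "-1 < a'" "a < 1" "-1 < - b" using ab ab1 by linarith+
    define q where "q = b / sqrt (1 - b\<^sup>2)"
    have "z' \<le> q"
      using div_sqrt_one_minus_square_diff_ge[OF bounds(3,2) ab(3)] bounds by (simp add: z'_def q_def)
    moreover have "- q \<le> z"
      using div_sqrt_one_minus_square_diff_ge[OF bounds(5,1,4)] bounds by (simp add: z_def q_def)
    ultimately have "\<bar>u\<bar> \<le> q" using u by auto
    then have "u\<^sup>2 \<le> q\<^sup>2" by (simp add: abs_le_square_iff[symmetric])
    also have "q\<^sup>2 = b\<^sup>2 / (1 - b\<^sup>2)" using b2 by (simp add: q_def power_divide)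
    finally have "1 + u\<^sup>2 \<le> 1 / (1 - b\<^sup>2)" using b2(1) by (simp add: field_simps)
    then have "sqrt (1 + u\<^sup>2) \<le> sqrt (1 / (1 - b\<^sup>2))" by simp
    then have "sqrt (1 + u\<^sup>2) * sqrt (1 - b\<^sup>2) \<le> 1" using b2 by (simp add: real_sqrt_divide field_simps)
    moreover have "sqrt (1 + u\<^sup>2) > 0" by (simp add: add_pos_nonneg)
    ultimately have "sqrt (1 - b\<^sup>2) \<le> 1 / sqrt (1 + u\<^sup>2)" by (simp add: field_simps)
    then show ?thesis using b2 by (intro power_mono) auto
  qed
  define A where "A = {x \<in> space (std_gaussian n). t < sqrt (real n) * x 1 / L2_set x {1..n} \<and> sqrt (real n) * x 1 / L2_set x {1..n} \<le> t'}"
  have [measurable]: "(\<lambda>x. x 1) \<in> borel_measurable (std_gaussian n)"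
    by (rule measurable_std_gaussian_component) (use n in auto)
  have Am [measurable]: "A \<in> sets (std_gaussian n)" unfolding A_def by measurable
  have inA: "x(1 := y) \<in> A" if x: "x \<in> space (tail_gauss n)" and y: "y \<in> {z * ?R x<..z' * ?R x}" for x y
  proof -
    have R: "?R x > 0"
    proof (rule ccontr)
      assume "\<not> ?R x > 0"
      then have "?R x = 0" using tail_radius_nonneg[of n x] by simp
      then show False using y by simp
    qed
    define w where "w = y / ?R x"
    have w: "z < w" "w \<le> z'" using y R by (auto simp: w_def field_simps)
    have "L2_set (x(1 := y)) {1..n} = sqrt (y\<^sup>2 + (?R x)\<^sup>2)"
      unfolding L2_set_def using sum_update_first[of n "\<lambda>i z. z\<^sup>2" x y] n by (simp add: tail_radius_def sum_nonneg)
    also have "\<dots> = ?R x * sqrt (1 + w\<^sup>2)"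
    proof -
      have "y\<^sup>2 + (?R x)\<^sup>2 = (?R x)\<^sup>2 * (1 + w\<^sup>2)" using R by (simp add: w_def field_simps)
      then show ?thesis using R by (simp add: real_sqrt_mult)
    qed
    finally have Y: "sqrt (real n) * y / L2_set (x(1 := y)) {1..n} = s * (w / sqrt (1 + w\<^sup>2))"
      using R by (simp add: w_def s_def)
    have "a < w / sqrt (1 + w\<^sup>2)" using less_div_sqrt_one_plus_square_iff[OF ab1(1), of w] w by (simp add: z_def)
    moreover have "w / sqrt (1 + w\<^sup>2) \<le> a'" using less_div_sqrt_one_plus_square_iff[OF ab1(2), of w] w by (simp add: z'_def)
    ultimately have "t < s * (w / sqrt (1 + w\<^sup>2))" "s * (w / sqrt (1 + w\<^sup>2)) \<le> t'"
      using s by (auto simp: a_def a'_def divide_less_eq le_divide_eq mult.commute)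
    moreover have "x(1 := y) \<in> space (std_gaussian n)"
    proof -
      have "{1..n} = insert 1 {2..n}" using n by auto
      then show ?thesis using x by (auto simp: std_gaussian_eq space_PiM PiE_iff extensional_def)
    qed
    ultimately show ?thesis unfolding A_def mem_Collect_eq fun_upd_same Y by blast
  qed
  have "ennreal ((z' - z) * ?W * (s / (pi * sqrt 2)))
     \<le> ennreal ((z' - z) * ?W) * ?D"
  proof -
    have "0 \<le> (z' - z) * ?W" using zz ab b2 by (intro mult_nonneg_nonneg) auto
    moreover have "ennreal (s / (pi * sqrt 2)) \<le> ?D" using expected_tail_radius_ge[OF n] by (simp only: s_def)
    ultimately show ?thesis
      using s(1) by (subst ennreal_mult) (auto intro: mult_left_mono)
  qed
  also have "\<dots> = (\<integral>\<^sup>+u. ennreal (?W) * ?D * indicator {z<..z'} u \<partial>lborel)"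
    using zz ab b2 by (subst nn_integral_cmult_indicator) (auto simp: ennreal_mult mult_ac)
  also have "\<dots> \<le> (\<integral>\<^sup>+u. ennreal ((1 / sqrt (1 + u\<^sup>2)) ^ n) * ?D * indicator {z<..z'} u \<partial>lborel)"
    using W by (intro nn_integral_mono) (auto simp: indicator_def intro!: mult_right_mono ennreal_leI)
  also have "\<dots> = (\<integral>\<^sup>+u. \<integral>\<^sup>+x. ?f u x * indicator {z<..z'} u \<partial>tail_gauss n \<partial>lborel)"
    by (subst nn_integral_multc, measurable, simp only: ratio_density[OF n])
  also have "\<dots> = (\<integral>\<^sup>+x. \<integral>\<^sup>+u. ?f u x * indicator {z<..z'} u \<partial>lborel \<partial>tail_gauss n)"
    by (rule pr.Fubini'[symmetric]) measurable
  also have "\<dots> \<le> (\<integral>\<^sup>+x. \<integral>\<^sup>+y. indicator A (x(1 := y)) \<partial>gauss \<partial>tail_gauss n)"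
  proof (rule nn_integral_mono)
    fix x assume x: "x \<in> space (tail_gauss n)"
    show "(\<integral>\<^sup>+u. ?f u x * indicator {z<..z'} u \<partial>lborel)
      \<le> (\<integral>\<^sup>+y. indicator A (x(1 := y)) \<partial>gauss)"
    proof (cases "?R x = 0")
      case False
      then have "?R x > 0" using tail_radius_nonneg[of n x] by simp
      then have "(\<integral>\<^sup>+u. ?f u x * indicator {z<..z'} u \<partial>lborel)
        = (\<integral>\<^sup>+y. indicator {z * ?R x<..z' * ?R x} y \<partial>gauss)"
        by (rule nn_integral_gauss_scaled_interval[symmetric])
      also have "\<dots> \<le> (\<integral>\<^sup>+y. indicator A (x(1 := y)) \<partial>gauss)"
        using inA[OF x] by (intro nn_integral_mono) (auto simp: indicator_def)
      finally show ?thesis .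
    qed simp
  qed
  also have "\<dots> = emeasure (std_gaussian n) A"
    using n by (subst std_gaussian_split(1)[symmetric]) auto
  finally have "ennreal ((z' - z) * ?W * (s / (pi * sqrt 2))) \<le> ennreal (G.prob A)"
    by (simp add: G.emeasure_eq_measure)
  then have le: "(z' - z) * ?W * (s / (pi * sqrt 2)) \<le> G.prob A"
    by (simp add: ennreal_le_iff)
  have "(t' - t) / (pi * sqrt 2) * ?W = (a' - a) * ?W * (s / (pi * sqrt 2))"
    using s by (simp add: a_def a'_def field_simps)
  also have "\<dots> \<le> (z' - z) * ?W * (s / (pi * sqrt 2))"
    using zz s b2 by (intro mult_right_mono) auto
  also note le
  also have "G.prob A = sphere_Phi n t' - sphere_Phi n t"
  proof -
    let ?E = "\<lambda>t. {x \<in> space (std_gaussian n). sqrt (real n) * x 1 / L2_set x {1..n} \<le> t}"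
    have "A = ?E t' - ?E t" unfolding A_def by auto
    moreover have "?E s \<in> sets (std_gaussian n)" for s by measurable
    moreover have "?E t \<subseteq> ?E t'" using tt by auto
    ultimately have "G.prob A = G.prob (?E t') - G.prob (?E t)"
      by (simp only: G.finite_measure_Diff)
    then show ?thesis by (simp add: sphere_Phi_def)
  qed
  finally show ?thesis .
qed


lemma emeasure_gauss_finite_set: "finite A \<Longrightarrow> emeasure gauss A = 0"
proof -
  assume A: "finite A"
  have "AE y in lborel. y \<notin> A" using A by (intro AE_I[where N = A]) (auto simp: emeasure_lborel_countable countable_finite borel_closed finite_imp_closed)
  then have "AE y in gauss. y \<notin> A" by (subst AE_density) auto
  then show ?thesis using A by (subst (asm) AE_iff_measurable[where N = A]) (auto simp: finite_imp_closed)
qed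

definition sphere_coord :: "nat \<Rightarrow> (nat \<Rightarrow> real) \<Rightarrow> real" where
  "sphere_coord n x = sqrt (real n) * x 1 / L2_set x {1..n}"

lemma measurable_sphere_coord: "n \<ge> 1 \<Longrightarrow> sphere_coord n \<in> borel_measurable (std_gaussian n)"
proof -
  assume n: "n \<ge> 1"
  have [measurable]: "(\<lambda>x. x 1) \<in> borel_measurable (std_gaussian n)"
    by (rule measurable_std_gaussian_component) (use n in auto)
  show ?thesis unfolding sphere_coord_def by measurable
qed

text \<open>
  For fixed other coordinates, at most two values of the first coordinate give the sphere coordinate \<open>t\<close>.
\<close>

lemma sphere_coord_no_atom:
  assumes n: "n \<ge> 2" and t: "\<bar>t\<bar> < sqrt (real n)"
  shows "emeasure (std_gaussian n) {x \<in> space (std_gaussian n). sphere_coord n x = t} = 0"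
proof -
  have [measurable]: "sphere_coord n \<in> borel_measurable (std_gaussian n)"
    by (rule measurable_sphere_coord) (use n in simp)
  define A where "A = {x \<in> space (std_gaussian n). sphere_coord n x = t}"
  have [measurable]: "A \<in> sets (std_gaussian n)" unfolding A_def by measurable
  have t2: "t\<^sup>2 < real n" using power_strict_mono[OF t, of 2] by simp
  have "emeasure (std_gaussian n) A = (\<integral>\<^sup>+x. indicator A x \<partial>std_gaussian n)" by simp
  also have "\<dots> = (\<integral>\<^sup>+x. \<integral>\<^sup>+y. indicator A (x(1 := y)) \<partial>gauss \<partial>tail_gauss n)"
    using n by (subst std_gaussian_split(1)) auto
  also have "\<dots> = (\<integral>\<^sup>+x. 0 \<partial>tail_gauss n)"
  proof (rule nn_integral_cong)
    fix x
    define r where "r = (tail_radius n x)\<^sup>2"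
    have r: "r \<ge> 0" by (simp add: r_def)
    define s where "s = sqrt (t\<^sup>2 * r / (real n - t\<^sup>2))"
    have "y \<in> {s, -s}" if "x(1 := y) \<in> A" for y
    proof -
      have "(L2_set (x(1 := y)) {1..n})\<^sup>2 = y\<^sup>2 + r"
        using sum_update_first[of n "\<lambda>i z. z\<^sup>2" x y] n by (simp add: L2_set_def tail_radius_def r_def sum_nonneg)
      moreover have eq: "sqrt (real n) * y / L2_set (x(1 := y)) {1..n} = t" using that by (simp add: A_def sphere_coord_def)
      ultimately have *: "real n * y\<^sup>2 / (y\<^sup>2 + r) = t\<^sup>2"
        by (metis power_divide power_mult_distrib real_sqrt_pow2 of_nat_0_le_iff)
      have "y\<^sup>2 * (real n - t\<^sup>2) = t\<^sup>2 * r"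
      proof (cases "y\<^sup>2 + r = 0")
        case True
        then have "y = 0" "r = 0" using r by (auto simp: add_nonneg_eq_0_iff)
        then show ?thesis by simp
      next
        case False
        then show ?thesis using * by (simp add: field_simps)
      qed
      then have "y\<^sup>2 = t\<^sup>2 * r / (real n - t\<^sup>2)" using t2 by (simp add: field_simps)
      also have "\<dots> = s\<^sup>2" using t2 r by (simp add: s_def)
      finally show ?thesis by (simp add: power2_eq_iff)
    qed
    then have "(\<integral>\<^sup>+y. indicator A (x(1 := y)) \<partial>gauss) \<le> (\<integral>\<^sup>+y. indicator {s, -s} y \<partial>gauss)"
      by (intro nn_integral_mono) (auto simp: indicator_def)
    also have "\<dots> = 0" using emeasure_gauss_finite_set[of "{s, -s}"] by (subst nn_integral_indicator) auto
    finally show "(\<integral>\<^sup>+y. indicator A (x(1 := y)) \<partial>gauss) = 0" by simp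
  qed
  finally show ?thesis by (simp add: A_def)
qed

lemma isCont_sphere_Phi:
  assumes n: "n \<ge> 2" and t: "\<bar>t\<bar> < sqrt (real n)"
  shows "isCont (sphere_Phi n) t"
proof -
  interpret G: prob_space "std_gaussian n" by (rule prob_space_std_gaussian)
  have m [measurable]: "sphere_coord n \<in> borel_measurable (std_gaussian n)"
    by (rule measurable_sphere_coord) (use n in simp)
  interpret D: real_distribution "distr (std_gaussian n) borel (sphere_coord n)"
    by (simp add: real_distribution_def real_distribution_axioms_def G.prob_space_distr)
  have "sphere_Phi n = cdf (distr (std_gaussian n) borel (sphere_coord n))"
    by (auto simp: fun_eq_iff cdf_def sphere_Phi_def measure_distr sphere_coord_def vimage_def Int_def conj_commute intro!: arg_cong[where f = "measure _"])
  moreover have "measure (distr (std_gaussian n) borel (sphere_coord n)) {t} = 0"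
  proof -
    have "sphere_coord n -` {t} \<inter> space (std_gaussian n) = {x \<in> space (std_gaussian n). sphere_coord n x = t}" by auto
    then show ?thesis using sphere_coord_no_atom[OF n t] by (simp add: measure_def emeasure_distr)
  qed
  ultimately show ?thesis using D.isCont_cdf by simp
qed

text \<open>
  Reflecting the first coordinate amounts to choosing the direction \<open>\<theta> = (-1, 0, \<dots>, 0)\<close>.
\<close>

lemma sphere_Phi_uminus:
  assumes n: "n \<ge> 2" and t: "\<bar>t\<bar> < sqrt (real n)"
  shows "sphere_Phi n (- t) = 1 - sphere_Phi n t"
proof -
  interpret G: prob_space "std_gaussian n" by (rule prob_space_std_gaussian)
  have m [measurable]: "sphere_coord n \<in> borel_measurable (std_gaussian n)"
    by (rule measurable_sphere_coord) (use n in simp)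
  let ?S = "space (std_gaussian n)"
  define \<theta> :: "nat \<Rightarrow> real" where "\<theta> i = (if i = 1 then -1 else 0)" for i
  have s1: "(\<Sum>i=1..n. (\<theta> i)\<^sup>2) = 1"
  proof -
    have "(\<Sum>i=1..n. (\<theta> i)\<^sup>2) = (\<Sum>i=1..n. if i = 1 then 1 else 0)" by (intro sum.cong) (auto simp: \<theta>_def)
    then show ?thesis using n by simp
  qed
  have s2: "(\<Sum>i=1..n. \<theta> i * x i) = - x 1" for x
  proof -
    have "(\<Sum>i=1..n. \<theta> i * x i) = (\<Sum>i=1..n. if i = 1 then - x 1 else 0)" by (intro sum.cong) (auto simp: \<theta>_def)
    then show ?thesis using n by simp
  qed
  have "sphere_Phi n (- t) = G.prob {x \<in> ?S. sqrt (real n) * (\<Sum>i=1..n. \<theta> i * x i) / L2_set x {1..n} \<le> - t}"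
    using sphere_Phi_direction[OF _ s1, of "- t"] n by simp
  also have "\<dots> = G.prob {x \<in> ?S. t \<le> sphere_coord n x}" unfolding s2 sphere_coord_def by simp
  also have "\<dots> = G.prob ({x \<in> ?S. t < sphere_coord n x} \<union> {x \<in> ?S. sphere_coord n x = t})"
    by (rule arg_cong[where f = G.prob]) auto
  also have "\<dots> = G.prob {x \<in> ?S. t < sphere_coord n x}"
    using sphere_coord_no_atom[OF n t] by (subst G.finite_measure_Union) (auto simp: measure_def)
  also have "{x \<in> ?S. t < sphere_coord n x} = ?S - {x \<in> ?S. sphere_coord n x \<le> t}" by auto
  also have "G.prob \<dots> = 1 - G.prob {x \<in> ?S. sphere_coord n x \<le> t}" by (rule G.prob_compl) measurable
  finally show ?thesis by (simp add: sphere_Phi_def sphere_coord_def)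
qed

lemma sphere_Phi_mono: "n \<ge> 1 \<Longrightarrow> s \<le> s' \<Longrightarrow> sphere_Phi n s \<le> sphere_Phi n s'"
proof -
  assume n: "n \<ge> 1" and s: "s \<le> s'"
  interpret G: prob_space "std_gaussian n" by (rule prob_space_std_gaussian)
  have m [measurable]: "sphere_coord n \<in> borel_measurable (std_gaussian n)"
    by (rule measurable_sphere_coord[OF n])
  show ?thesis
    unfolding sphere_Phi_def sphere_coord_def[symmetric] using s by (intro G.finite_measure_mono) auto
qed

lemma sphere_Phi_strict_mono:
  assumes n: "n \<ge> 2" and tt: "- sqrt (real n) \<le> t" "t < t'" "t' \<le> sqrt (real n)"
  shows "sphere_Phi n t < sphere_Phi n t'"
proof -
  have mono: "sphere_Phi n s \<le> sphere_Phi n s'" if "s \<le> s'" for s s'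
    using n that by (intro sphere_Phi_mono) auto
  \<comment> \<open>a closed subinterval, to stay away from \<open>\<plusminus> sqrt n\<close>\<close>
  define s where "s = (2 * t + t') / 3" define s' where "s' = (t + 2 * t') / 3"
  have s: "t < s" "s < s'" "s' < t'" using tt by (auto simp: s_def s'_def)
  define T where "T = max \<bar>s\<bar> \<bar>s'\<bar>"
  have T: "\<bar>s\<bar> \<le> T" "\<bar>s'\<bar> \<le> T" "T < sqrt (real n)" using s tt by (auto simp: T_def)
  have "T\<^sup>2 < (sqrt (real n))\<^sup>2" using T by (intro power_strict_mono) auto
  then have "0 < (s' - s) / (pi * sqrt 2) * (sqrt (1 - T\<^sup>2 / real n)) ^ n"
    using s n by (intro mult_pos_pos zero_less_power) auto
  also have "\<dots> \<le> sphere_Phi n s' - sphere_Phi n s"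
    using s by (intro sphere_Phi_interval_ge n T) auto
  finally show ?thesis using mono[of t s] mono[of s' t'] s by linarith
qed

lemma sphere_Phi_inv_eq:
  assumes n: "n \<ge> 2" and t: "- sqrt (real n) \<le> t" "t \<le> sqrt (real n)"
  shows "sphere_Phi_inv n (sphere_Phi n t) = t"
  unfolding sphere_Phi_inv_def
proof (rule the_inv_into_f_f)
  show "inj_on (sphere_Phi n) {- sqrt (real n)..sqrt (real n)}"
    using sphere_Phi_strict_mono[OF n] by (intro linorder_inj_onI') force
qed (use t in auto)

lemma sphere_Phi_quantile:
  assumes n: "n \<ge> 2" and T: "0 \<le> T" "T < sqrt (real n)" and y: "1 - sphere_Phi n T \<le> y" "y \<le> sphere_Phi n T"
  obtains t where "\<bar>t\<bar> \<le> T" "sphere_Phi n t = y" "sphere_Phi_inv n y = t"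
proof -
  have "sphere_Phi n (- T) \<le> y" using y sphere_Phi_uminus[OF n, of T] T by simp
  moreover have "\<forall>x. - T \<le> x \<and> x \<le> T \<longrightarrow> isCont (sphere_Phi n) x"
    using T by (auto intro!: isCont_sphere_Phi n)
  ultimately obtain t where t: "- T \<le> t" "t \<le> T" "sphere_Phi n t = y"
    using IVT[of "sphere_Phi n" "- T" y T] y T by auto
  moreover have "sphere_Phi_inv n y = t" using sphere_Phi_inv_eq[OF n, of t] t T by auto
  ultimately show ?thesis using that[of t] by auto
qed


section \<open>Rounding to the lattice\<close>

text \<open>
  Rounding by a ceiling makes the cell of an integer half-open on the left, so that its probability is
  exactly a difference of two values of \<open>std_Phi\<close>.
\<close>

definition lattice_round :: "real \<Rightarrow> nat \<Rightarrow> (nat \<Rightarrow> real) \<Rightarrow> nat \<Rightarrow> int" where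
  "lattice_round \<sigma> n x i = (if i \<in> {1..n} then \<lceil>\<sigma> * x i - 1/2\<rceil> else 0)"

lemma ceiling_half_eq_iff: "\<sigma> > 0 \<Longrightarrow> \<lceil>\<sigma> * y - 1/2\<rceil> = k \<longleftrightarrow> y \<in> {(real_of_int k - 1/2) / \<sigma><..(real_of_int k + 1/2) / \<sigma>}"
  for \<sigma> y :: real
  by (auto simp: ceiling_eq_iff field_simps)

lemma rounding_error_le: "\<sigma> > 0 \<Longrightarrow> \<bar>y - real_of_int \<lceil>\<sigma> * y - 1/2\<rceil> / \<sigma>\<bar> \<le> 1 / (2 * \<sigma>)" for \<sigma> y :: real
proof -
  assume s: "\<sigma> > 0"
  have "\<bar>\<sigma> * y - real_of_int \<lceil>\<sigma> * y - 1/2\<rceil>\<bar> \<le> 1/2" by linarith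
  then have "\<bar>\<sigma> * y - real_of_int \<lceil>\<sigma> * y - 1/2\<rceil>\<bar> / \<sigma> \<le> 1/2 / \<sigma>"
    by (rule divide_right_mono) (use s in simp)
  also have "\<bar>\<sigma> * y - real_of_int \<lceil>\<sigma> * y - 1/2\<rceil>\<bar> / \<sigma> = \<bar>y - real_of_int \<lceil>\<sigma> * y - 1/2\<rceil> / \<sigma>\<bar>"
    using s by (simp add: abs_div_pos diff_divide_distrib)
  finally show ?thesis by simp
qed

lemma std_Phi_eq_measure: "std_Phi t = measure gauss {..t}"
proof -
  have "measure gauss {..t} = (\<integral>y. indicator {..t} y \<partial>gauss)" by simp
  also have "\<dots> = (\<integral>y. std_normal_density y * indicator {..t} y \<partial>lborel)"
    by (subst integral_density) auto
  also have "\<dots> = std_Phi t"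
    unfolding std_Phi_def set_lebesgue_integral_def
    by (intro Bochner_Integration.integral_cong) (auto simp: std_normal_density_def)
  finally show ?thesis by simp
qed

lemma measure_gauss_interval: "a \<le> b \<Longrightarrow> measure gauss {a<..b} = std_Phi b - std_Phi a"
proof -
  assume "a \<le> b"
  have "{a<..b} = {..b} - {..a}" by auto
  then show ?thesis using \<open>a \<le> b\<close> by (simp add: std_Phi_eq_measure gauss.finite_measure_Diff)
qed

lemma lattice_round_eq_event:
  assumes s: "\<sigma> > 0" and k: "\<And>i. i \<notin> {1..n} \<Longrightarrow> k i = 0"
  shows "{x \<in> space (std_gaussian n). lattice_round \<sigma> n x = k}
    = Pi\<^sub>E {1..n} (\<lambda>i. {(real_of_int (k i) - 1/2) / \<sigma><..(real_of_int (k i) + 1/2) / \<sigma>})"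
  using k ceiling_half_eq_iff[OF s]
  by (auto simp: std_gaussian_eq space_PiM PiE_def Pi_def extensional_def lattice_round_def fun_eq_iff)

lemma prob_lattice_round:
  assumes s: "\<sigma> > 0" and k: "\<And>i. i \<notin> {1..n} \<Longrightarrow> k i = 0"
  shows "{x \<in> space (std_gaussian n). lattice_round \<sigma> n x = k} \<in> sets (std_gaussian n)"
    and "measure (std_gaussian n) {x \<in> space (std_gaussian n). lattice_round \<sigma> n x = k}
    = (\<Prod>i=1..n. std_Phi ((real_of_int (k i) + 1/2) / \<sigma>) - std_Phi ((real_of_int (k i) - 1/2) / \<sigma>))"
proof -
  interpret p: finite_product_prob_space "\<lambda>_::nat. gauss" "{1..n}"
    by standard simp
  have ev: "{x \<in> space (std_gaussian n). lattice_round \<sigma> n x = k}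
    = Pi\<^sub>E {1..n} (\<lambda>i. {(real_of_int (k i) - 1/2) / \<sigma><..(real_of_int (k i) + 1/2) / \<sigma>})"
    by (rule lattice_round_eq_event[OF s k])
  show "{x \<in> space (std_gaussian n). lattice_round \<sigma> n x = k} \<in> sets (std_gaussian n)"
    unfolding ev unfolding std_gaussian_eq by (intro sets_PiM_I_finite) auto
  show "measure (std_gaussian n) {x \<in> space (std_gaussian n). lattice_round \<sigma> n x = k}
    = (\<Prod>i=1..n. std_Phi ((real_of_int (k i) + 1/2) / \<sigma>) - std_Phi ((real_of_int (k i) - 1/2) / \<sigma>))"
    unfolding ev unfolding std_gaussian_eq using s
    by (subst p.prob_times) (auto intro!: prod.cong measure_gauss_interval divide_right_mono)
qed

lemma prob_lattice_round_in:
  assumes s: "\<sigma> > 0" and A: "finite A" "\<And>k i. k \<in> A \<Longrightarrow> i \<notin> {1..n} \<Longrightarrow> k i = 0"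
  shows "{x \<in> space (std_gaussian n). lattice_round \<sigma> n x \<in> A} \<in> sets (std_gaussian n)"
    and "measure (std_gaussian n) {x \<in> space (std_gaussian n). lattice_round \<sigma> n x \<in> A}
      = (\<Sum>k\<in>A. measure (std_gaussian n) {x \<in> space (std_gaussian n). lattice_round \<sigma> n x = k})"
proof -
  interpret G: prob_space "std_gaussian n" by (rule prob_space_std_gaussian)
  have eq: "{x \<in> space (std_gaussian n). lattice_round \<sigma> n x \<in> A} = (\<Union>k\<in>A. {x \<in> space (std_gaussian n). lattice_round \<sigma> n x = k})"
    by auto
  have m: "{x \<in> space (std_gaussian n). lattice_round \<sigma> n x = k} \<in> sets (std_gaussian n)" if "k \<in> A" for k
    using that A by (intro prob_lattice_round(1) s) auto
  show "{x \<in> space (std_gaussian n). lattice_round \<sigma> n x \<in> A} \<in> sets (std_gaussian n)"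
    unfolding eq using A m by auto
  show "measure (std_gaussian n) {x \<in> space (std_gaussian n). lattice_round \<sigma> n x \<in> A}
      = (\<Sum>k\<in>A. measure (std_gaussian n) {x \<in> space (std_gaussian n). lattice_round \<sigma> n x = k})"
    unfolding eq using A m by (intro G.finite_measure_finite_Union) (auto simp: disjoint_family_on_def)
qed

section \<open>Tails of the Gaussian norm\<close>

text \<open>
  Markov's inequality for the exponential moments computed by scaling; \<open>l > 1\<close> serves for small norms and
  \<open>l < 1\<close> for large ones.
\<close>

lemma prob_le_exp_moment:
  assumes l: "l > 0" and P: "{x \<in> space (std_gaussian n). P x} \<in> sets (std_gaussian n)"
    and le: "\<And>x. P x \<Longrightarrow> 1 \<le> c * exp (- (l\<^sup>2 - 1) * (\<Sum>i=1..n. (x i)\<^sup>2) / 2)" and c: "c \<ge> 0"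
  shows "measure (std_gaussian n) {x \<in> space (std_gaussian n). P x} \<le> c * (1 / l) ^ n"
proof -
  interpret G: prob_space "std_gaussian n" by (rule prob_space_std_gaussian)
  have "emeasure (std_gaussian n) {x \<in> space (std_gaussian n). P x}
    = (\<integral>\<^sup>+x. indicator {x \<in> space (std_gaussian n). P x} x \<partial>std_gaussian n)" using P by simp
  also have "\<dots> \<le> (\<integral>\<^sup>+x. ennreal c * ennreal (exp (- (l\<^sup>2 - 1) * (\<Sum>i=1..n. (x i)\<^sup>2) / 2)) \<partial>std_gaussian n)"
    using le c by (intro nn_integral_mono) (auto simp: indicator_def ennreal_mult[symmetric] simp flip: ennreal_1 intro!: ennreal_leI)
  also have "\<dots> = ennreal c * (\<integral>\<^sup>+x. ennreal (exp (- (l\<^sup>2 - 1) * (\<Sum>i=1..n. (x i)\<^sup>2) / 2)) \<partial>std_gaussian n)"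
    by (rule nn_integral_cmult) measurable
  also have "(\<integral>\<^sup>+x. ennreal (exp (- (l\<^sup>2 - 1) * (\<Sum>i=1..n. (x i)\<^sup>2) / 2)) \<partial>std_gaussian n) = ennreal ((1 / l) ^ n)"
    using gauss_radial_scaling[of "\<lambda>_. 1" "{1..n}" l, folded std_gaussian_eq] l G.emeasure_space_1 by simp
  finally show ?thesis using c l by (simp add: G.emeasure_eq_measure ennreal_mult[symmetric])
qed

text \<open>
  The choice \<open>l\<^sup>2 = 1 + 1 / d\<^sup>2\<close> gives the bound \<open>(sqrt (exp 1) * d) ^ n\<close>.
\<close>

lemma prob_small_norm:
  assumes d: "d > 0"
  shows "measure (std_gaussian n) {x \<in> space (std_gaussian n). L2_set x {1..n} < d * sqrt (real n)} \<le> (2 * d) ^ n"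
proof -
  \<comment> \<open>the weight is then \<open>exp (- |x|\<^sup>2 / (2 * d\<^sup>2))\<close>\<close>
  define l where "l = sqrt (1 + 1 / d\<^sup>2)"
  have "1 / d = sqrt (1 / d\<^sup>2)" using d by (simp add: real_sqrt_divide)
  also have "\<dots> \<le> l" unfolding l_def by simp
  finally have ld: "1 / d \<le> l" .
  then have l: "l > 0" using d by (meson less_le_trans zero_less_divide_1_iff)
  have l2: "l\<^sup>2 - 1 = 1 / d\<^sup>2" using d by (simp add: l_def)
  have "measure (std_gaussian n) {x \<in> space (std_gaussian n). L2_set x {1..n} < d * sqrt (real n)}
      \<le> exp (real n / 2) * (1 / l) ^ n"
  proof (rule prob_le_exp_moment[OF l])
    show "{x \<in> space (std_gaussian n). L2_set x {1..n} < d * sqrt (real n)} \<in> sets (std_gaussian n)" by measurable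
    fix x assume "L2_set x {1..n} < d * sqrt (real n)"
    then have "(L2_set x {1..n})\<^sup>2 \<le> (d * sqrt (real n))\<^sup>2" by (intro power_mono) auto
    then have "(\<Sum>i=1..n. (x i)\<^sup>2) \<le> d\<^sup>2 * real n" by (simp add: L2_set_def sum_nonneg power_mult_distrib)
    then have "(\<Sum>i=1..n. (x i)\<^sup>2) / d\<^sup>2 \<le> real n" using d by (simp add: field_simps)
    then have "0 \<le> real n / 2 + - (l\<^sup>2 - 1) * (\<Sum>i=1..n. (x i)\<^sup>2) / 2" by (simp add: l2)
    then show "1 \<le> exp (real n / 2) * exp (- (l\<^sup>2 - 1) * (\<Sum>i=1..n. (x i)\<^sup>2) / 2)"
      by (simp only: exp_add[symmetric] one_le_exp_iff)
  qed simp
  also have "exp (real n / 2) = exp (1 / 2) ^ n" by (simp add: exp_of_nat_mult[symmetric])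
  also have "exp (1 / 2) ^ n * (1 / l) ^ n = (exp (1 / 2) * (1 / l)) ^ n" by (simp only: power_mult_distrib)
  also have "\<dots> \<le> (2 * d) ^ n"
  proof (intro power_mono mult_mono)
    have "exp (1 / 2 :: real) \<le> 2"
      using exp_bound[of "1 / 2 :: real"] by (simp add: power2_eq_square)
    then show "exp (1 / 2 :: real) \<le> 2" .
    show "1 / l \<le> d" using ld d l by (simp add: field_simps)
  qed (use l in auto)
  finally show ?thesis .
qed

text \<open>
  The choice \<open>l = 1/2\<close>, that is, the moment of \<open>exp (3/8 * |x|\<^sup>2)\<close>, which equals \<open>2 ^ n\<close>.
\<close>

lemma prob_large_norm:
  assumes d: "0 < d"
  shows "measure (std_gaussian n) {x \<in> space (std_gaussian n). (\<Sum>i=1..n. (x i)\<^sup>2) \<ge> 8/3 * ln (1 / d) * real n} \<le> (2 * d) ^ n"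
proof -
  have "measure (std_gaussian n) {x \<in> space (std_gaussian n). (\<Sum>i=1..n. (x i)\<^sup>2) \<ge> 8/3 * ln (1 / d) * real n}
      \<le> exp (real n * ln d) * (1 / (1/2)) ^ n"
  proof (rule prob_le_exp_moment)
    show "{x \<in> space (std_gaussian n). (\<Sum>i=1..n. (x i)\<^sup>2) \<ge> 8/3 * ln (1 / d) * real n} \<in> sets (std_gaussian n)" by measurable
    fix x :: "nat \<Rightarrow> real" assume "(\<Sum>i=1..n. (x i)\<^sup>2) \<ge> 8/3 * ln (1 / d) * real n"
    then have "0 \<le> real n * ln d + - ((1/2)\<^sup>2 - 1) * (\<Sum>i=1..n. (x i)\<^sup>2) / 2"
      using d by (simp add: power2_eq_square ln_div field_simps)
    then show "1 \<le> exp (real n * ln d) * exp (- ((1/2)\<^sup>2 - 1) * (\<Sum>i=1..n. (x i)\<^sup>2) / 2)"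
      by (simp only: exp_add[symmetric] one_le_exp_iff)
  qed auto
  also have "\<dots> = (2 * d) ^ n" using d by (simp add: power_mult_distrib exp_of_nat_mult)
  finally show ?thesis .
qed

section \<open>The accumulated rounding error\<close>

definition rounding_error :: "real \<Rightarrow> real \<Rightarrow> real" where
  "rounding_error \<sigma> y = y - real_of_int \<lceil>\<sigma> * y - 1/2\<rceil> / \<sigma>"

lemma measurable_rounding_error [measurable]: "rounding_error \<sigma> \<in> borel_measurable borel"
  unfolding rounding_error_def by measurable

text \<open>
  The rounding error is an odd function except at the countably many points where rounding has to break a
  tie.
\<close>

lemma integral_rounding_error:
  assumes s: "\<sigma> > 0"
  shows "(\<integral>y. rounding_error \<sigma> y \<partial>gauss) = 0"
proof -
  have "(\<integral>y. rounding_error \<sigma> y \<partial>gauss) = (\<integral>y. std_normal_density y * rounding_error \<sigma> y \<partial>lborel)"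
    by (subst integral_density) auto
  also have "\<dots> = (\<integral>y. std_normal_density (- y) * rounding_error \<sigma> (- y) \<partial>lborel)"
    by (subst lborel_integral_real_affine[where c = "-1" and t = 0]) auto
  also have "\<dots> = (\<integral>y. - (std_normal_density y * rounding_error \<sigma> y) \<partial>lborel)"
  proof (rule integral_cong_AE)
    \<comment> \<open>the points at which rounding breaks a tie\<close>
    define Z where "Z = range (\<lambda>k::int. (real_of_int k + 1/2) / \<sigma>)"
    have "countable Z" unfolding Z_def by auto
    then have "AE y in lborel. y \<notin> Z"
      by (intro AE_I[where N = Z]) (auto simp: emeasure_lborel_countable sets.countable)
    then show "AE y in lborel. std_normal_density (- y) * rounding_error \<sigma> (- y) = - (std_normal_density y * rounding_error \<sigma> y)"
    proof eventually_elim
      case (elim y)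
      have ni: "\<sigma> * y - 1/2 \<noteq> real_of_int k" for k
      proof
        assume "\<sigma> * y - 1/2 = real_of_int k"
        then have "y = (real_of_int k + 1/2) / \<sigma>" using s by (simp add: field_simps)
        then show False using elim by (auto simp: Z_def)
      qed
      define m where "m = \<lceil>\<sigma> * y - 1/2\<rceil>"
      have "real_of_int m - 1 < \<sigma> * y - 1/2" "\<sigma> * y - 1/2 < real_of_int m"
        using ni[of m] unfolding m_def by linarith+
      then have "\<lceil>\<sigma> * (- y) - 1/2\<rceil> = - m" by (intro ceiling_unique) auto
      then have "rounding_error \<sigma> (- y) = - rounding_error \<sigma> y"
        unfolding rounding_error_def m_def[symmetric] by simp
      moreover have "std_normal_density (- y) = std_normal_density y" by (simp add: std_normal_density_def)
      ultimately show ?case by simp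
    qed
  qed auto
  also have "\<dots> = - (\<integral>y. std_normal_density y * rounding_error \<sigma> y \<partial>lborel)" by simp
  also have "(\<integral>y. std_normal_density y * rounding_error \<sigma> y \<partial>lborel) = (\<integral>y. rounding_error \<sigma> y \<partial>gauss)"
    by (subst integral_density) auto
  finally show ?thesis by simp
qed

lemma indep_coordinates_std_gaussian:
  assumes n: "n \<ge> 1"
  shows "prob_space.indep_vars (std_gaussian n) (\<lambda>_. gauss) (\<lambda>i x. x i) {1..n}"
proof -
  interpret p: product_prob_space "\<lambda>_::nat. gauss" "{1..n}" by (rule product_prob_space_gauss)
  interpret G: prob_space "std_gaussian n" by (rule prob_space_std_gaussian)
  have "distr (std_gaussian n) (Pi\<^sub>M {1..n} (\<lambda>_. gauss)) (\<lambda>x. \<lambda>i\<in>{1..n}. x i) = distr (std_gaussian n) (std_gaussian n) (\<lambda>x. x)"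
    unfolding std_gaussian_eq by (intro distr_cong) (auto simp: space_PiM)
  also have "\<dots> = Pi\<^sub>M {1..n} (\<lambda>i. distr (std_gaussian n) gauss (\<lambda>x. x i))"
    unfolding distr_id std_gaussian_eq by (intro PiM_cong p.PiM_component[symmetric]) simp_all
  finally show ?thesis
    using n by (subst G.indep_vars_iff_distr_eq_PiM') (auto simp: std_gaussian_eq)
qed

text \<open>
  Hoeffding's inequality for independent centred errors of range \<open>|\<theta> i| / \<sigma>\<close>. The bound is free of \<open>n\<close>,
  whereas the largest possible error grows like \<open>sqrt n\<close>.
\<close>

lemma prob_rounding_error_large:
  assumes n: "n \<ge> 1" and s: "\<sigma> > 0" and \<theta>: "(\<Sum>i=1..n. (\<theta> i)\<^sup>2) = 1" and \<tau>: "\<tau> \<ge> 0"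
  shows "measure (std_gaussian n) {x \<in> space (std_gaussian n). (\<Sum>i=1..n. \<theta> i * rounding_error \<sigma> (x i)) \<ge> \<tau> / \<sigma>} \<le> exp (- 2 * \<tau>\<^sup>2)"
proof -
  interpret G: prob_space "std_gaussian n" by (rule prob_space_std_gaussian)
  interpret p: product_prob_space "\<lambda>_::nat. gauss" "{1..n}" by (rule product_prob_space_gauss)
  have ex: "G.expectation (\<lambda>x. \<theta> i * rounding_error \<sigma> (x i)) = 0" if i: "i \<in> {1..n}" for i
  proof -
    have m: "(\<lambda>x. x i) \<in> measurable (std_gaussian n) gauss"
      using measurable_std_gaussian_component[OF i] by simp
    have d: "distr (std_gaussian n) gauss (\<lambda>x. x i) = gauss"
      unfolding std_gaussian_eq by (rule p.PiM_component[OF i])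
    have "G.expectation (\<lambda>x. rounding_error \<sigma> (x i)) = (\<integral>y. rounding_error \<sigma> y \<partial>distr (std_gaussian n) gauss (\<lambda>x. x i))"
      by (rule integral_distr[symmetric, OF m]) simp
    also have "\<dots> = 0" unfolding d by (rule integral_rounding_error[OF s])
    finally show ?thesis by simp
  qed
  interpret H: Hoeffding_ineq "std_gaussian n" "{1..n}" "\<lambda>i x. \<theta> i * rounding_error \<sigma> (x i)"
    "\<lambda>i. - (\<bar>\<theta> i\<bar> / (2 * \<sigma>))" "\<lambda>i. \<bar>\<theta> i\<bar> / (2 * \<sigma>)" 0
  proof unfold_locales
    show "G.indep_vars (\<lambda>_. borel) (\<lambda>i x. \<theta> i * rounding_error \<sigma> (x i)) {1..n}"
      by (rule G.indep_vars_compose2[OF indep_coordinates_std_gaussian[OF n]]) simp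
    show "AE x in std_gaussian n. \<theta> i * rounding_error \<sigma> (x i) \<in> {- (\<bar>\<theta> i\<bar> / (2 * \<sigma>))..\<bar>\<theta> i\<bar> / (2 * \<sigma>)}" for i
    proof (rule AE_I2)
      fix x :: "nat \<Rightarrow> real"
      have "\<bar>\<theta> i * rounding_error \<sigma> (x i)\<bar> \<le> \<bar>\<theta> i\<bar> * (1 / (2 * \<sigma>))"
        unfolding abs_mult rounding_error_def by (intro mult_left_mono rounding_error_le s) simp
      then show "\<theta> i * rounding_error \<sigma> (x i) \<in> {- (\<bar>\<theta> i\<bar> / (2 * \<sigma>))..\<bar>\<theta> i\<bar> / (2 * \<sigma>)}"
        by (simp add: abs_le_iff)
    qed
    show "0 \<equiv> (\<Sum>i=1..n. G.expectation (\<lambda>x. \<theta> i * rounding_error \<sigma> (x i)))"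
      by (rule eq_reflection, subst sum.neutral) (use ex in blast, simp)
  qed simp
  have "(\<Sum>i=1..n. (\<bar>\<theta> i\<bar> / (2 * \<sigma>) - - (\<bar>\<theta> i\<bar> / (2 * \<sigma>)))\<^sup>2) = (\<Sum>i=1..n. (\<theta> i)\<^sup>2 / \<sigma>\<^sup>2)"
    using s by (intro sum.cong) (auto simp: power_divide)
  also have "\<dots> = 1 / \<sigma>\<^sup>2" by (simp only: sum_divide_distrib[symmetric] \<theta>)
  finally have sum: "(\<Sum>i=1..n. (\<bar>\<theta> i\<bar> / (2 * \<sigma>) - - (\<bar>\<theta> i\<bar> / (2 * \<sigma>)))\<^sup>2) = 1 / \<sigma>\<^sup>2" .
  have "G.prob {x \<in> space (std_gaussian n). 0 + \<tau> / \<sigma> \<le> (\<Sum>i=1..n. \<theta> i * rounding_error \<sigma> (x i))}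
    \<le> exp (- 2 * (\<tau> / \<sigma>)\<^sup>2 / (1 / \<sigma>\<^sup>2))"
    using H.Hoeffding_ineq_ge[of "\<tau> / \<sigma>"] s \<tau> unfolding sum by simp
  also have "- 2 * (\<tau> / \<sigma>)\<^sup>2 / (1 / \<sigma>\<^sup>2) = - 2 * \<tau>\<^sup>2" using s by (simp add: power_divide)
  finally show ?thesis by simp
qed


section \<open>Parameters\<close>

lemma delta_bounds:
  assumes "0 < \<epsilon>" "\<epsilon> < 1/2"
  shows "0 < delta \<epsilon>" "delta \<epsilon> < 1/2858" "6 \<le> ln (1 / delta \<epsilon>)" "ln (1 / delta \<epsilon>) \<le> 12 * ln (1 / \<epsilon>)"
proof -
  show d: "0 < delta \<epsilon>" "delta \<epsilon> < 1/2858" using assms by (auto simp: delta_def)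
  have "exp (6 :: real) = exp 1 ^ 6" by (simp add: exp_of_nat_mult[symmetric])
  also have "\<dots> \<le> 3 ^ 6" using exp_le by (intro power_mono) auto
  also have "\<dots> \<le> 1 / delta \<epsilon>" using d by (simp add: field_simps)
  finally show "6 \<le> ln (1 / delta \<epsilon>)" using d by (simp add: ln_ge_iff)
  have "1 / delta \<epsilon> = 1429 * (1 / \<epsilon>)" by (simp add: delta_def)
  also have "\<dots> \<le> 2 ^ 11 * (1 / \<epsilon>)" using assms by (intro mult_right_mono) auto
  also have "\<dots> \<le> (1 / \<epsilon>) ^ 11 * (1 / \<epsilon>)" using assms by (intro mult_right_mono power_mono) (auto simp: field_simps)
  also have "\<dots> = (1 / \<epsilon>) ^ 12" by (simp add: power_numeral_reduce)
  finally have "ln (1 / delta \<epsilon>) \<le> ln ((1 / \<epsilon>) ^ 12)" using assms d by (subst ln_le_cancel_iff) auto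
  also have "\<dots> = 12 * ln (1 / \<epsilon>)" using assms by (subst ln_realpow) auto
  finally show "ln (1 / delta \<epsilon>) \<le> 12 * ln (1 / \<epsilon>)" .
qed

text \<open>
  By the hypothesis, \<open>ln N \<ge> 100 * n * ln (1 / \<epsilon>)\<close>, and \<open>ln (1 / \<delta>) \<le> 12 * ln (1 / \<epsilon>)\<close>; the resulting exponent
  \<open>100 / 12\<close> is larger than \<open>8\<close>.
\<close>

lemma sample_size_ge:
  assumes e: "0 < \<epsilon>" "\<epsilon> < 1/2" and n: "n \<ge> 1" and N: "real n \<le> (1/100) * inverse (ln (1 / \<epsilon>)) * ln (real N)"
  shows "N \<ge> 1" "1 \<le> real N * (delta \<epsilon> ^ 8) ^ n"
proof -
  have l: "ln (1 / \<epsilon>) > 0" using e by (subst ln_gt_zero_iff) auto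
  have "real n * (100 * ln (1 / \<epsilon>)) \<le> ((1/100) * inverse (ln (1 / \<epsilon>)) * ln (real N)) * (100 * ln (1 / \<epsilon>))"
    using N l by (intro mult_right_mono) auto
  also have "\<dots> = ln (real N)" using l by (simp add: field_simps)
  finally have 1: "100 * real n * ln (1 / \<epsilon>) \<le> ln (real N)" by (simp add: mult_ac)
  have "0 < 100 * real n * ln (1 / \<epsilon>)" using l n by simp
  then have "ln (real N) > 0" using 1 by linarith
  then show N1: "N \<ge> 1" by (cases N) auto
  have d: "0 < delta \<epsilon>" using delta_bounds[OF e] by simp
  have "8 * real n * ln (1 / delta \<epsilon>) \<le> 8 * real n * (12 * ln (1 / \<epsilon>))"
    using delta_bounds(4)[OF e] by (intro mult_left_mono) auto
  also have "\<dots> \<le> 100 * real n * ln (1 / \<epsilon>)" using l by simp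
  also note 1
  finally have "8 * real n * ln (1 / delta \<epsilon>) \<le> ln (real N)" .
  then have "0 \<le> ln (real N) + real (8 * n) * ln (delta \<epsilon>)" using d by (simp add: ln_div)
  also have "\<dots> = ln (real N * (delta \<epsilon> ^ 8) ^ n)"
    using d N1 by (simp add: ln_mult ln_realpow power_mult[symmetric])
  finally show "1 \<le> real N * (delta \<epsilon> ^ 8) ^ n" using d N1 by (subst (asm) ln_ge_zero_iff) auto
qed

lemma sigma_pos: "0 < \<epsilon> \<Longrightarrow> 0 < sigma \<epsilon>"
  by (simp add: sigma_def delta_def)

lemma alpha_eq: "alpha \<epsilon> = 2 * sigma \<epsilon> * sqrt (ln (1 / delta \<epsilon>))"
  by (simp add: alpha_def sigma_def)

section \<open>Probabilities of the lattice cells\<close>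

lemma finite_lattice_ball: "finite (lattice_ball n \<epsilon>)"
proof -
  define B where "B = alpha \<epsilon> * sqrt (real n)"
  have "lattice_ball n \<epsilon> \<subseteq> {x. \<forall>i. (i \<in> {1..n} \<longrightarrow> x i \<in> {- \<lceil>B\<rceil>..\<lceil>B\<rceil>}) \<and> (i \<notin> {1..n} \<longrightarrow> x i = 0)}"
  proof
    fix x assume x: "x \<in> lattice_ball n \<epsilon>"
    have "x i \<in> {- \<lceil>B\<rceil>..\<lceil>B\<rceil>}" if i: "i \<in> {1..n}" for i
    proof -
      have "real_of_int (x i) \<le> L2_set (\<lambda>i. \<bar>real_of_int (x i)\<bar>) {1..n}" "- real_of_int (x i) \<le> L2_set (\<lambda>i. \<bar>real_of_int (x i)\<bar>) {1..n}"
        using member_le_L2_set[OF _ i, of "\<lambda>i. \<bar>real_of_int (x i)\<bar>"] by auto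
      moreover have "L2_set (\<lambda>i. \<bar>real_of_int (x i)\<bar>) {1..n} \<le> B"
        using x by (simp add: lattice_ball_def B_def L2_set_def)
      ultimately show ?thesis by (simp; linarith)
    qed
    then show "x \<in> {x. \<forall>i. (i \<in> {1..n} \<longrightarrow> x i \<in> {- \<lceil>B\<rceil>..\<lceil>B\<rceil>}) \<and> (i \<notin> {1..n} \<longrightarrow> x i = 0)}"
      using x by (auto simp: lattice_ball_def)
  qed
  moreover have "finite {x. \<forall>i. (i \<in> {1..n} \<longrightarrow> x i \<in> {- \<lceil>B\<rceil>..\<lceil>B\<rceil>}) \<and> (i \<notin> {1..n} \<longrightarrow> x i = 0)}"
    by (rule finite_set_of_finite_funs) auto
  ultimately show ?thesis by (rule finite_subset)
qed

definition cell_prob :: "real \<Rightarrow> nat \<Rightarrow> (nat \<Rightarrow> int) \<Rightarrow> real" where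
  "cell_prob \<sigma> n k = measure (std_gaussian n) {x \<in> space (std_gaussian n). lattice_round \<sigma> n x = k}"

lemma row_mult_eq:
  assumes "0 < \<epsilon>" "k \<in> lattice_ball n \<epsilon>"
  shows "row_mult N n \<epsilon> k = \<lfloor>real N * cell_prob (sigma \<epsilon>) n k\<rfloor>"
  using prob_lattice_round(2)[OF sigma_pos[OF assms(1)], of n k] assms(2)
  by (simp add: row_mult_def cell_prob_def lattice_ball_def)

lemma prob_round_in_eq_sum:
  assumes "0 < \<epsilon>" "A \<subseteq> lattice_ball n \<epsilon>"
  shows "{x \<in> space (std_gaussian n). lattice_round (sigma \<epsilon>) n x \<in> A} \<in> sets (std_gaussian n)"
    "measure (std_gaussian n) {x \<in> space (std_gaussian n). lattice_round (sigma \<epsilon>) n x \<in> A} = (\<Sum>k\<in>A. cell_prob (sigma \<epsilon>) n k)"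
proof -
  have f: "finite A" using finite_subset[OF assms(2) finite_lattice_ball] .
  have z: "k i = 0" if "k \<in> A" "i \<notin> {1..n}" for k i using that assms(2) unfolding lattice_ball_def by auto
  note P = prob_lattice_round_in[where \<sigma> = "sigma \<epsilon>" and A = A and n = n, OF sigma_pos[OF assms(1)] f]
  show "{x \<in> space (std_gaussian n). lattice_round (sigma \<epsilon>) n x \<in> A} \<in> sets (std_gaussian n)" by (rule P(1), rule z)
  show "measure (std_gaussian n) {x \<in> space (std_gaussian n). lattice_round (sigma \<epsilon>) n x \<in> A} = (\<Sum>k\<in>A. cell_prob (sigma \<epsilon>) n k)"
    unfolding cell_prob_def by (rule P(2), rule z)
qed

lemma measure_gauss_interval_ge:
  assumes "a \<le> b" "\<bar>a\<bar> \<le> c" "\<bar>b\<bar> \<le> c"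
  shows "measure gauss {a<..b} \<ge> (b - a) * std_normal_density c"
proof -
  have "ennreal ((b - a) * std_normal_density c) = (\<integral>\<^sup>+y. ennreal (std_normal_density c) * indicator {a<..b} y \<partial>lborel)"
    using assms by (subst nn_integral_cmult_indicator) (auto simp: ennreal_mult mult.commute)
  also have "\<dots> \<le> (\<integral>\<^sup>+y. ennreal (std_normal_density y) * indicator {a<..b} y \<partial>lborel)"
  proof (rule nn_integral_mono)
    fix y
    show "ennreal (std_normal_density c) * indicator {a<..b} y \<le> ennreal (std_normal_density y) * indicator {a<..b} y"
    proof (cases "y \<in> {a<..b}")
      case True
      then have "\<bar>y\<bar> \<le> \<bar>c\<bar>" using assms by auto
      then have "y\<^sup>2 \<le> c\<^sup>2" by (simp add: abs_le_square_iff)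
      then show ?thesis by (auto simp: std_normal_density_def intro!: mult_right_mono ennreal_leI divide_right_mono)
    qed simp
  qed
  also have "\<dots> = emeasure gauss {a<..b}" by (subst emeasure_density) auto
  finally show ?thesis by (simp add: gauss.emeasure_eq_measure)
qed

text \<open>
  The cell has volume \<open>\<delta> ^ (4 * n)\<close>, and at distance at most \<open>2 * sqrt (n * ln (1 / \<delta>))\<close> from the origin
  the Gaussian density is at least of the order \<open>\<delta> ^ (2 * n)\<close>. The exponent \<open>7\<close> instead of \<open>6\<close> leaves
  room for the factors \<open>sqrt (2 * pi)\<close> and for the distance between the centre of the cell and its
  farthest corner.
\<close>

lemma cell_prob_ge:
  assumes e: "0 < \<epsilon>" "\<epsilon> < 1/2" and k: "k \<in> lattice_ball n \<epsilon>"
  shows "cell_prob (sigma \<epsilon>) n k \<ge> (delta \<epsilon> ^ 7) ^ n"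
proof -
  define d L \<sigma> where "d = delta \<epsilon>" and "L = ln (1 / d)" and "\<sigma> = sigma \<epsilon>"
  have d: "0 < d" "d < 1/2858" "6 \<le> L" using delta_bounds[OF e] by (auto simp: d_def L_def)
  have s: "\<sigma> > 0" "1 / \<sigma> = d ^ 4" using sigma_pos[OF e(1)] by (auto simp: \<sigma>_def sigma_def d_def)
  have s1: "1 \<le> \<sigma>\<^sup>2"
  proof -
    have "d ^ 4 \<le> 1" using d by (intro power_le_one) auto
    then have "1 / \<sigma> \<le> 1" by (simp only: s(2))
    then have "1 \<le> \<sigma>" using s(1) by (simp add: divide_le_eq_1)
    then show ?thesis by simp
  qed
  define c where "c i = (\<bar>real_of_int (k i)\<bar> + 1/2) / \<sigma>" for i
  let ?C = "\<Sum>i=1..n. (c i)\<^sup>2" and ?K = "\<Sum>i=1..n. (real_of_int (k i))\<^sup>2"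
  have "cell_prob \<sigma> n k = (\<Prod>i=1..n. measure gauss {(real_of_int (k i) - 1/2) / \<sigma><..(real_of_int (k i) + 1/2) / \<sigma>})"
    using prob_lattice_round(2)[OF s(1), of n k] k s
    by (simp add: cell_prob_def lattice_ball_def measure_gauss_interval divide_right_mono)
  also have "\<dots> \<ge> (\<Prod>i=1..n. 1 / \<sigma> * std_normal_density (c i))"
  proof (intro prod_mono conjI)
    fix i
    let ?l = "(real_of_int (k i) - 1/2) / \<sigma>" and ?u = "(real_of_int (k i) + 1/2) / \<sigma>"
    have len: "?u - ?l = 1 / \<sigma>" by (simp add: diff_divide_distrib[symmetric])
    have abs: "\<bar>z / \<sigma>\<bar> \<le> c i" if "\<bar>z\<bar> \<le> \<bar>real_of_int (k i)\<bar> + 1/2" for z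
      unfolding c_def abs_divide abs_of_pos[OF s(1)] using that s(1) by (intro divide_right_mono) auto
    have "?l \<le> ?u" using s(1) by (intro divide_right_mono) auto
    moreover have "\<bar>?l\<bar> \<le> c i" by (rule abs) linarith
    moreover have "\<bar>?u\<bar> \<le> c i" by (rule abs) linarith
    ultimately show "1 / \<sigma> * std_normal_density (c i) \<le> measure gauss {?l<..?u}"
      using measure_gauss_interval_ge[of ?l ?u "c i"] unfolding len by blast
  qed (use s in auto)
  also have "(\<Prod>i=1..n. 1 / \<sigma> * std_normal_density (c i)) = (d ^ 4 / sqrt (2 * pi)) ^ n * exp (- ?C / 2)"
  proof -
    have "1 / \<sigma> * std_normal_density (c i) = d ^ 4 / sqrt (2 * pi) * exp (- (c i)\<^sup>2 / 2)" for i
      by (simp add: s(2) std_normal_density_def)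
    then have "(\<Prod>i=1..n. 1 / \<sigma> * std_normal_density (c i)) = (d ^ 4 / sqrt (2 * pi)) ^ n * exp (\<Sum>i=1..n. - (c i)\<^sup>2 / 2)"
      by (simp only: prod.distrib exp_sum[OF finite_atLeastAtMost]) simp
    also have "(\<Sum>i=1..n. - (c i)\<^sup>2 / 2) = - ?C / 2" by (simp add: sum_negf sum_divide_distrib)
    finally show ?thesis .
  qed
  also have "\<dots> \<ge> (d ^ 4 / sqrt (2 * pi)) ^ n * exp (- real n * (3 * L - 2))"
  proof (intro mult_left_mono)
    have ci: "(c i)\<^sup>2 \<le> (5/4 * (real_of_int (k i))\<^sup>2 + 5/4) / \<sigma>\<^sup>2" for i
    proof -
      have "(\<bar>real_of_int (k i)\<bar> + 1/2)\<^sup>2 \<le> 5/4 * (real_of_int (k i))\<^sup>2 + 5/4"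
      proof -
        define a where "a = \<bar>real_of_int (k i)\<bar>"
        have "(real_of_int (k i))\<^sup>2 = a\<^sup>2" by (simp add: a_def)
        moreover have "5/4 * a\<^sup>2 + 5/4 - (a + 1/2)\<^sup>2 = (a / 2 - 1)\<^sup>2" by (simp add: power2_eq_square field_simps)
        moreover have "0 \<le> (a / 2 - 1)\<^sup>2" by simp
        ultimately show ?thesis unfolding a_def[symmetric] by linarith
      qed
      then show ?thesis by (simp add: c_def power_divide divide_right_mono)
    qed
    have "L2_set (\<lambda>i. real_of_int (k i)) {1..n} \<le> alpha \<epsilon> * sqrt (real n)" using k by (simp add: lattice_ball_def)
    then have "(L2_set (\<lambda>i. real_of_int (k i)) {1..n})\<^sup>2 \<le> (alpha \<epsilon> * sqrt (real n))\<^sup>2" by (intro power_mono) auto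
    also have "(alpha \<epsilon> * sqrt (real n))\<^sup>2 = 4 * \<sigma>\<^sup>2 * L * real n"
      using d(3) by (simp add: alpha_eq power_mult_distrib \<sigma>_def[symmetric] L_def[symmetric] d_def[symmetric])
    finally have K: "?K \<le> 4 * \<sigma>\<^sup>2 * L * real n" by (simp add: L2_set_def sum_nonneg)
    have "?C \<le> (\<Sum>i=1..n. (5/4 * (real_of_int (k i))\<^sup>2 + 5/4) / \<sigma>\<^sup>2)" by (intro sum_mono ci)
    also have "\<dots> = (5/4 * ?K + 5/4 * real n) / \<sigma>\<^sup>2"
      by (simp add: sum_divide_distrib[symmetric] sum.distrib sum_distrib_left)
    also have "\<dots> \<le> (5/4 * (4 * \<sigma>\<^sup>2 * L * real n) + 5/4 * real n * \<sigma>\<^sup>2) / \<sigma>\<^sup>2"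
    proof (intro divide_right_mono add_mono)
      show "5/4 * ?K \<le> 5/4 * (4 * \<sigma>\<^sup>2 * L * real n)"
        by (rule mult_left_mono[OF K]) simp
      show "5/4 * real n \<le> 5/4 * real n * \<sigma>\<^sup>2"
        using mult_left_mono[OF s1, of "5/4 * real n"] by simp
    qed simp
    also have "\<dots> = real n * (5 * L + 5/4)" using s by (simp add: field_simps)
    also have "\<dots> \<le> real n * (2 * (3 * L - 2))" using d by (intro mult_left_mono) auto
    finally have "?C \<le> 2 * (real n * (3 * L - 2))" by (simp only: mult.left_commute)
    then have "- real n * (3 * L - 2) \<le> - ?C / 2" by linarith
    then show "exp (- real n * (3 * L - 2)) \<le> exp (- ?C / 2)" by (simp only: exp_le_cancel_iff)
  qed (use d in auto)
  also have "(d ^ 4 / sqrt (2 * pi)) ^ n * exp (- real n * (3 * L - 2)) = (d ^ 4 / sqrt (2 * pi) * exp (- (3 * L - 2))) ^ n"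
  proof -
    have "exp (- real n * (3 * L - 2)) = exp (- (3 * L - 2)) ^ n" by (subst exp_of_nat_mult[symmetric]) (simp add: algebra_simps)
    then show ?thesis by (simp only: power_mult_distrib)
  qed
  also have "\<dots> \<ge> (d ^ 7) ^ n"
  proof (intro power_mono)
    have "exp (- (3 * L - 2)) = exp (- L) ^ 3 * exp 2"
      by (simp add: exp_of_nat_mult[symmetric] exp_add[symmetric])
    also have "exp (- L) = d" using d by (simp add: L_def ln_div)
    finally have eq: "exp (- (3 * L - 2)) = d ^ 3 * exp 2" .
    have "sqrt (2 * pi) \<le> sqrt (3\<^sup>2)" using pi_less_4 by (intro real_sqrt_le_mono) simp
    also have "\<dots> \<le> exp 2" using exp_ge_add_one_self[of 2] by simp
    finally have "1 \<le> exp 2 / sqrt (2 * pi)" by simp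
    then have "d ^ 7 * 1 \<le> d ^ 7 * (exp 2 / sqrt (2 * pi))" using d by (intro mult_left_mono) auto
    also have "\<dots> = d ^ 4 / sqrt (2 * pi) * exp (- (3 * L - 2))" unfolding eq by (simp add: power_numeral_reduce)
    finally show "d ^ 7 \<le> d ^ 4 / sqrt (2 * pi) * exp (- (3 * L - 2))" by simp
  qed (use d in simp)
  finally show ?thesis by (simp add: \<sigma>_def d_def)
qed

text \<open>
  The cells are disjoint, and none of them has a probability below \<open>\<delta> ^ (7 * n)\<close>.
\<close>

lemma card_lattice_ball_le:
  assumes e: "0 < \<epsilon>" "\<epsilon> < 1/2"
  shows "real (card (lattice_ball n \<epsilon>)) * (delta \<epsilon> ^ 7) ^ n \<le> 1"
proof -
  interpret G: prob_space "std_gaussian n" by (rule prob_space_std_gaussian)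
  have "real (card (lattice_ball n \<epsilon>)) * (delta \<epsilon> ^ 7) ^ n \<le> (\<Sum>k\<in>lattice_ball n \<epsilon>. cell_prob (sigma \<epsilon>) n k)"
    using cell_prob_ge[OF e] by (intro sum_bounded_below) auto
  also have "\<dots> = G.prob {x \<in> space (std_gaussian n). lattice_round (sigma \<epsilon>) n x \<in> lattice_ball n \<epsilon>}"
    using prob_round_in_eq_sum(2)[OF e(1) order_refl] by simp
  also have "\<dots> \<le> 1" by simp
  finally show ?thesis .
qed

lemma L2_set_round_diff:
  assumes s: "\<sigma> > 0"
  shows "\<bar>L2_set (\<lambda>i. real_of_int (lattice_round \<sigma> n x i)) {1..n} / \<sigma> - L2_set x {1..n}\<bar> \<le> sqrt (real n) / (2 * \<sigma>)"
proof -
  let ?k = "\<lambda>i. real_of_int (lattice_round \<sigma> n x i) / \<sigma>"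
  have e: "\<bar>x i - ?k i\<bar> \<le> 1 / (2 * \<sigma>)" if "i \<in> {1..n}" for i
    using rounding_error_le[OF s, of "x i"] that by (simp add: lattice_round_def)
  have D: "L2_set (\<lambda>i. \<bar>x i - ?k i\<bar>) {1..n} \<le> sqrt (real n) / (2 * \<sigma>)"
  proof -
    have "L2_set (\<lambda>i. \<bar>x i - ?k i\<bar>) {1..n} \<le> L2_set (\<lambda>i. 1 / (2 * \<sigma>)) {1..n}"
      using e by (intro L2_set_mono) auto
    also have "\<dots> = sqrt (real n) / (2 * \<sigma>)" using s by (simp add: L2_set_constant)
    finally show ?thesis .
  qed
  have abs: "L2_set (\<lambda>i. \<bar>f i\<bar>) {1..n} = L2_set f {1..n}" for f by (simp add: L2_set_def)
  have sc: "L2_set ?k {1..n} = L2_set (\<lambda>i. real_of_int (lattice_round \<sigma> n x i)) {1..n} / \<sigma>"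
    using L2_set_left_distrib[of "1 / \<sigma>" "\<lambda>i. real_of_int (lattice_round \<sigma> n x i)" "{1..n}"] s by simp
  have "L2_set x {1..n} \<le> L2_set ?k {1..n} + L2_set (\<lambda>i. x i - ?k i) {1..n}"
    using L2_set_triangle_ineq[of ?k "\<lambda>i. x i - ?k i" "{1..n}"] by simp
  moreover have "L2_set ?k {1..n} \<le> L2_set x {1..n} + L2_set (\<lambda>i. - (x i - ?k i)) {1..n}"
    using L2_set_triangle_ineq[of x "\<lambda>i. - (x i - ?k i)" "{1..n}"] by simp
  moreover have "L2_set (\<lambda>i. - (x i - ?k i)) {1..n} = L2_set (\<lambda>i. x i - ?k i) {1..n}"
    using abs[of "\<lambda>i. - (x i - ?k i)"] abs[of "\<lambda>i. x i - ?k i"] by (simp only: abs_minus_cancel)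
  ultimately show ?thesis using D unfolding abs sc by linarith
qed

text \<open>
  Rounding changes the norm by at most \<open>sqrt n / (2 * \<sigma>)\<close>, so a point that is rounded to the outside of the
  ball has a norm of at least \<open>7/4 * sqrt (n * ln (1 / \<delta>))\<close>.
\<close>

lemma prob_round_outside_ball:
  assumes e: "0 < \<epsilon>" "\<epsilon> < 1/2"
  shows "1 - (\<Sum>k\<in>lattice_ball n \<epsilon>. cell_prob (sigma \<epsilon>) n k) \<le> (2 * delta \<epsilon>) ^ n"
proof -
  interpret G: prob_space "std_gaussian n" by (rule prob_space_std_gaussian)
  define d L \<sigma> where "d = delta \<epsilon>" and "L = ln (1 / d)" and "\<sigma> = sigma \<epsilon>"
  have d: "0 < d" "d < 1/2858" "6 \<le> L" using delta_bounds[OF e] by (auto simp: d_def L_def)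
  have s: "\<sigma> > 0" "1 / \<sigma> = d ^ 4" using sigma_pos[OF e(1)] by (auto simp: \<sigma>_def sigma_def d_def)
  have "d ^ 4 \<le> 1" using d by (intro power_le_one) auto
  then have "1 / \<sigma> \<le> 1" by (simp only: s(2))
  then have s1: "1 / (2 * \<sigma>) \<le> 1/2" by simp
  let ?E = "{x \<in> space (std_gaussian n). lattice_round \<sigma> n x \<in> lattice_ball n \<epsilon>}"
  let ?F = "{x \<in> space (std_gaussian n). (\<Sum>i=1..n. (x i)\<^sup>2) \<ge> 8/3 * ln (1 / d) * real n}"
  have Es: "?E \<in> sets (std_gaussian n)" using prob_round_in_eq_sum(1)[OF e(1) order_refl] by (simp add: \<sigma>_def)
  have Fs: "?F \<in> sets (std_gaussian n)" by measurable
  have sub: "space (std_gaussian n) - ?E \<subseteq> ?F"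
  proof
    fix x assume x: "x \<in> space (std_gaussian n) - ?E"
    then have "lattice_round \<sigma> n x \<notin> lattice_ball n \<epsilon>" by simp
    then have "L2_set (\<lambda>i. real_of_int (lattice_round \<sigma> n x i)) {1..n} > alpha \<epsilon> * sqrt (real n)"
      by (auto simp: lattice_ball_def lattice_round_def)
    then have "L2_set (\<lambda>i. real_of_int (lattice_round \<sigma> n x i)) {1..n} / \<sigma> > alpha \<epsilon> * sqrt (real n) / \<sigma>"
      using s by (intro divide_strict_right_mono)
    also have "alpha \<epsilon> * sqrt (real n) / \<sigma> = 2 * sqrt L * sqrt (real n)"
      using s by (simp add: alpha_eq \<sigma>_def[symmetric] L_def d_def)
    finally have "L2_set x {1..n} \<ge> 2 * sqrt L * sqrt (real n) - sqrt (real n) / (2 * \<sigma>)"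
      using L2_set_round_diff[OF s(1), of n x] by linarith
    also have "2 * sqrt L * sqrt (real n) - sqrt (real n) / (2 * \<sigma>) = (2 * sqrt L - 1 / (2 * \<sigma>)) * sqrt (real n)"
      by (simp add: algebra_simps)
    also have "\<dots> \<ge> (7/4 * sqrt L) * sqrt (real n)"
    proof (intro mult_right_mono)
      have "2 \<le> sqrt L" using d by (intro real_le_rsqrt) simp
      then show "7/4 * sqrt L \<le> 2 * sqrt L - 1 / (2 * \<sigma>)" using s1 by linarith
    qed simp
    finally have "((7/4 * sqrt L) * sqrt (real n))\<^sup>2 \<le> (L2_set x {1..n})\<^sup>2"
      using d by (intro power_mono) auto
    then have "49/16 * L * real n \<le> (\<Sum>i=1..n. (x i)\<^sup>2)" using d by (simp add: L2_set_def sum_nonneg power_mult_distrib power_divide)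
    moreover have "8/3 * L * real n \<le> 49/16 * L * real n" using d by (intro mult_right_mono) auto
    ultimately have "8/3 * L * real n \<le> (\<Sum>i=1..n. (x i)\<^sup>2)" by linarith
    then show "x \<in> ?F" using x unfolding L_def by blast
  qed
  have "1 - (\<Sum>k\<in>lattice_ball n \<epsilon>. cell_prob \<sigma> n k) = 1 - G.prob ?E"
    using prob_round_in_eq_sum(2)[OF e(1) order_refl] by (simp add: \<sigma>_def)
  also have "\<dots> = G.prob (space (std_gaussian n) - ?E)" using Es by (simp add: G.prob_compl)
  also have "\<dots> \<le> G.prob ?F" using sub Fs by (rule G.finite_measure_mono)
  also have "\<dots> \<le> (2 * d) ^ n" by (rule prob_large_norm[OF d(1)])
  finally show ?thesis by (simp add: d_def \<sigma>_def)
qed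

section \<open>Counting rows\<close>

text \<open>
  Every multiplicity is rounded down, except that the surplus \<open>N - N'\<close> is added at the origin. The surplus
  consists of the mass outside the ball and of less than one row for each lattice point in it.
\<close>

lemma count_rows_le:
  assumes e: "0 < \<epsilon>" "\<epsilon> < 1/2" and n: "n \<ge> 1" and N: "real n \<le> (1/100) * inverse (ln (1 / \<epsilon>)) * ln (real N)"
    and r: "\<And>x. x \<in> lattice_ball n \<epsilon> \<Longrightarrow> int (card {i\<in>{1..N}. r i = x}) = row_mult' N n \<epsilon> x"
    and A: "A \<subseteq> lattice_ball n \<epsilon>"
  shows "real (card {i\<in>{1..N}. r i \<in> A})
    \<le> real N * ((\<Sum>k\<in>A. cell_prob (sigma \<epsilon>) n k) + (2 * delta \<epsilon>) ^ n + delta \<epsilon> ^ n)"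
proof -
  let ?B = "lattice_ball n \<epsilon>"
  let ?\<mu> = "cell_prob (sigma \<epsilon>) n"
  have fA: "finite A" using finite_subset[OF A finite_lattice_ball] .
  have d: "0 < delta \<epsilon>" using delta_bounds[OF e] by simp
  \<comment> \<open>the surplus that is assigned to the origin\<close>
  define D where "D = real N - real_of_int (total_mult N n \<epsilon>)"
  have tot: "real_of_int (total_mult N n \<epsilon>) = (\<Sum>k\<in>?B. real_of_int \<lfloor>real N * ?\<mu> k\<rfloor>)"
    by (simp add: total_mult_def row_mult_eq[OF e(1)])
  have "(\<Sum>k\<in>?B. real_of_int \<lfloor>real N * ?\<mu> k\<rfloor>) \<le> (\<Sum>k\<in>?B. real N * ?\<mu> k)" by (intro sum_mono) linarith
  also have "\<dots> = real N * (\<Sum>k\<in>?B. ?\<mu> k)" by (simp add: sum_distrib_left)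
  also have "\<dots> \<le> real N * 1"
  proof (intro mult_left_mono)
    interpret G: prob_space "std_gaussian n" by (rule prob_space_std_gaussian)
    show "(\<Sum>k\<in>?B. ?\<mu> k) \<le> 1" using prob_round_in_eq_sum(2)[OF e(1) order_refl, of n] G.prob_le_1 by metis
  qed simp
  finally have D0: "0 \<le> D" by (simp add: D_def tot)
  have "(\<Sum>k\<in>?B. real N * ?\<mu> k - 1) \<le> (\<Sum>k\<in>?B. real_of_int \<lfloor>real N * ?\<mu> k\<rfloor>)" by (intro sum_mono) linarith
  then have "D \<le> real N * (1 - (\<Sum>k\<in>?B. ?\<mu> k)) + real (card ?B)"
    by (simp add: D_def tot sum_subtractf sum_distrib_left[symmetric] algebra_simps)
  also have "real N * (1 - (\<Sum>k\<in>?B. ?\<mu> k)) \<le> real N * (2 * delta \<epsilon>) ^ n"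
    by (intro mult_left_mono prob_round_outside_ball e) simp
  also have "real (card ?B) \<le> real N * delta \<epsilon> ^ n"
  proof -
    have p: "(delta \<epsilon> ^ 7) ^ n > 0" using d by simp
    have "real (card ?B) * (delta \<epsilon> ^ 7) ^ n \<le> real N * (delta \<epsilon> ^ 8) ^ n"
      using card_lattice_ball_le[OF e] sample_size_ge(2)[OF e n N] by (rule order_trans)
    also have "\<dots> = (real N * delta \<epsilon> ^ n) * (delta \<epsilon> ^ 7) ^ n"
      by (simp add: power_mult_distrib[symmetric] power_numeral_reduce mult_ac)
    finally show ?thesis using p by simp
  qed
  finally have D: "D \<le> real N * (2 * delta \<epsilon>) ^ n + real N * delta \<epsilon> ^ n" by simp
  have "card {i\<in>{1..N}. r i \<in> A} = (\<Sum>k\<in>A. card {i\<in>{1..N}. r i = k})"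
  proof -
    have "{i\<in>{1..N}. r i \<in> A} = (\<Union>k\<in>A. {i\<in>{1..N}. r i = k})" by auto
    then show ?thesis using fA by (simp only:) (rule card_UN_disjoint, auto)
  qed
  then have "real (card {i\<in>{1..N}. r i \<in> A}) = (\<Sum>k\<in>A. real (card {i\<in>{1..N}. r i = k}))" by simp
  also have "\<dots> = (\<Sum>k\<in>A. real_of_int (row_mult' N n \<epsilon> k))"
  proof (rule sum.cong)
    fix k assume "k \<in> A"
    then have "int (card {i\<in>{1..N}. r i = k}) = row_mult' N n \<epsilon> k" using r A by blast
    then show "real (card {i\<in>{1..N}. r i = k}) = real_of_int (row_mult' N n \<epsilon> k)" by (metis of_int_of_nat_eq)
  qed simp
  also have "\<dots> \<le> (\<Sum>k\<in>A. real N * ?\<mu> k + (if k = (\<lambda>_. 0) then D else 0))"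
  proof (rule sum_mono)
    fix k assume "k \<in> A"
    then have "real_of_int (row_mult N n \<epsilon> k) \<le> real N * ?\<mu> k" using A row_mult_eq[OF e(1), of k n N] by auto
    then show "real_of_int (row_mult' N n \<epsilon> k) \<le> real N * ?\<mu> k + (if k = (\<lambda>_. 0) then D else 0)"
      by (cases "k = (\<lambda>_. 0)") (simp_all add: row_mult'_def D_def)
  qed
  also have "\<dots> = real N * (\<Sum>k\<in>A. ?\<mu> k) + (\<Sum>k\<in>A. if k = (\<lambda>_. 0) then D else 0)"
    by (simp add: sum.distrib sum_distrib_left)
  also have "(\<Sum>k\<in>A. if k = (\<lambda>_. 0) then D else 0) \<le> D" using fA D0 by simp
  finally show ?thesis using D by (simp add: algebra_simps)
qed

definition row_proj :: "nat \<Rightarrow> (nat \<Rightarrow> real) \<Rightarrow> (nat \<Rightarrow> int) \<Rightarrow> real" where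
  "row_proj n \<theta> k = (\<Sum>j=1..n. row_vec n k j * \<theta> j)"

lemma row_proj_times_norm:
  assumes k: "\<And>i. i \<notin> {1..n} \<Longrightarrow> k i = 0"
  shows "row_proj n \<theta> k * L2_set (\<lambda>i. real_of_int (k i)) {1..n} = sqrt (real n) * (\<Sum>j=1..n. \<theta> j * real_of_int (k j))"
proof (cases "k = (\<lambda>_. 0)")
  case True then show ?thesis by (simp add: row_proj_def row_vec_def)
next
  case False
  then obtain i where i: "k i \<noteq> 0" by (auto simp: fun_eq_iff)
  then have "i \<in> {1..n}" using k by blast
  then have "0 < \<bar>real_of_int (k i)\<bar>" "\<bar>real_of_int (k i)\<bar> \<le> L2_set (\<lambda>i. \<bar>real_of_int (k i)\<bar>) {1..n}"
    using i member_le_L2_set[of "{1..n}" i "\<lambda>i. \<bar>real_of_int (k i)\<bar>"] by auto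
  then have nz: "L2_set (\<lambda>i. real_of_int (k i)) {1..n} \<noteq> 0" by (auto simp: L2_set_def)
  have "row_proj n \<theta> k = (\<Sum>j=1..n. sqrt (real n) / L2_set (\<lambda>i. real_of_int (k i)) {1..n} * (\<theta> j * real_of_int (k j)))"
    using False unfolding row_proj_def row_vec_def by (intro sum.cong) auto
  also have "\<dots> = sqrt (real n) / L2_set (\<lambda>i. real_of_int (k i)) {1..n} * (\<Sum>j=1..n. \<theta> j * real_of_int (k j))"
    by (simp only: sum_distrib_left)
  finally show ?thesis using nz by simp
qed

lemma row_proj_abs_le:
  assumes k: "\<And>i. i \<notin> {1..n} \<Longrightarrow> k i = 0" and \<theta>: "(\<Sum>i=1..n. (\<theta> i)\<^sup>2) = 1"
  shows "\<bar>row_proj n \<theta> k\<bar> \<le> sqrt (real n)"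
proof (cases "L2_set (\<lambda>i. real_of_int (k i)) {1..n} = 0")
  case True
  then have "\<forall>i\<in>{1..n}. k i = 0" by (simp add: L2_set_eq_0_iff)
  then have "k = (\<lambda>_. 0)" using k by (auto simp: fun_eq_iff)
  then show ?thesis by (simp add: row_proj_def row_vec_def)
next
  case False
  let ?l = "L2_set (\<lambda>i. real_of_int (k i)) {1..n}"
  have l: "?l > 0" using False L2_set_nonneg[of "\<lambda>i. real_of_int (k i)" "{1..n}"] by linarith
  have "\<bar>row_proj n \<theta> k\<bar> * ?l = \<bar>row_proj n \<theta> k * ?l\<bar>" using l by (simp add: abs_mult)
  also have "\<dots> = sqrt (real n) * \<bar>\<Sum>j=1..n. \<theta> j * real_of_int (k j)\<bar>"
  proof -
    have "row_proj n \<theta> k * ?l = sqrt (real n) * (\<Sum>j=1..n. \<theta> j * real_of_int (k j))"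
      by (rule row_proj_times_norm, rule k)
    then show ?thesis by (simp only: abs_mult abs_of_nonneg[OF real_sqrt_ge_zero] of_nat_0_le_iff)
  qed
  also have "\<dots> \<le> sqrt (real n) * (\<Sum>j=1..n. \<bar>\<theta> j\<bar> * \<bar>real_of_int (k j)\<bar>)"
    by (intro mult_left_mono order_trans[OF sum_abs]) (auto simp: abs_mult)
  also have "\<dots> \<le> sqrt (real n) * (L2_set \<theta> {1..n} * ?l)" by (intro mult_left_mono L2_set_mult_ineq) auto
  also have "L2_set \<theta> {1..n} = 1" by (simp only: L2_set_def \<theta> real_sqrt_one)
  finally show ?thesis using l by simp
qed

text \<open>
  If \<open>X\<close> is rounded to the label \<open>k\<close>, then \<open>sqrt n * \<langle>X, \<theta>\<rangle> / |X|\<close> exceeds the projection \<open>w\<close> of the row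
  labelled \<open>k\<close> by at most \<open>(sqrt n / (\<sigma> * |X|)) * (|w| / 2 + \<tau>)\<close>, unless the rounding error along
  \<open>\<theta>\<close> is at least \<open>\<tau> / \<sigma>\<close>; the part \<open>|w| / 2\<close> comes from the change of the norm under rounding. For
  \<open>|X| \<ge> \<delta> * sqrt n\<close> the first factor is at most \<open>\<delta> ^ 3\<close>.
\<close>

lemma empirical_distribution_le:
  assumes e: "0 < \<epsilon>" "\<epsilon> < 1/2" and n: "n \<ge> 1" and N: "real n \<le> (1/100) * inverse (ln (1 / \<epsilon>)) * ln (real N)"
    and T: "is_T_matrix N n \<epsilon> T" and \<theta>: "(\<Sum>i=1..n. (\<theta> i)\<^sup>2) = 1" and \<tau>: "\<tau> \<ge> 0"
  defines "d \<equiv> delta \<epsilon>"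
  shows "real (card {i\<in>{1..N}. (\<Sum>j=1..n. T i j * \<theta> j) \<le> s})
    \<le> real N * (sphere_Phi n (s + d ^ 3 * (\<bar>s\<bar> / 2 + \<tau>)) + 2 * (2 * d) ^ n + d ^ n + exp (- 2 * \<tau>\<^sup>2))"
proof -
  interpret G: prob_space "std_gaussian n" by (rule prob_space_std_gaussian)
  obtain r where r1: "\<And>i. i \<in> {1..N} \<Longrightarrow> r i \<in> lattice_ball n \<epsilon>"
    and r2: "\<And>x. x \<in> lattice_ball n \<epsilon> \<Longrightarrow> int (card {i\<in>{1..N}. r i = x}) = row_mult' N n \<epsilon> x"
    and r3: "\<And>i j. i \<in> {1..N} \<Longrightarrow> j \<in> {1..n} \<Longrightarrow> T i j = row_vec n (r i) j"
    using T unfolding is_T_matrix_def by blast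
  define \<sigma> where "\<sigma> = sigma \<epsilon>"
  have d: "0 < d" "d < 1/2858" using delta_bounds[OF e] by (auto simp: d_def)
  have s: "\<sigma> > 0" "1 / (\<sigma> * d) = d ^ 3" using sigma_pos[OF e(1)] d by (auto simp: \<sigma>_def sigma_def d_def power_numeral_reduce)
  define A where "A = {k \<in> lattice_ball n \<epsilon>. row_proj n \<theta> k \<le> s}"
  have A: "A \<subseteq> lattice_ball n \<epsilon>" by (auto simp: A_def)
  define s' where "s' = s + d ^ 3 * (\<bar>s\<bar> / 2 + \<tau>)"
  let ?S = "space (std_gaussian n)"
  define E1 where "E1 = {x \<in> ?S. sqrt (real n) * (\<Sum>i=1..n. \<theta> i * x i) / L2_set x {1..n} \<le> s'}"
  define E2 where "E2 = {x \<in> ?S. L2_set x {1..n} < d * sqrt (real n)}"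
  define E3 where "E3 = {x \<in> ?S. (\<Sum>i=1..n. \<theta> i * rounding_error \<sigma> (x i)) \<ge> \<tau> / \<sigma>}"
  have m3 [measurable]: "(\<lambda>x. \<Sum>i=1..n. \<theta> i * rounding_error \<sigma> (x i)) \<in> borel_measurable (std_gaussian n)"
    unfolding std_gaussian_eq by measurable
  have E1: "E1 \<in> G.events" unfolding E1_def by measurable
  have E2: "E2 \<in> G.events" unfolding E2_def by measurable
  have E3: "E3 \<in> G.events" unfolding E3_def by measurable
  note E = E1 E2 E3
  have sub: "{x \<in> ?S. lattice_round \<sigma> n x \<in> A} \<subseteq> E1 \<union> E2 \<union> E3"
  proof
    fix x assume x: "x \<in> {x \<in> ?S. lattice_round \<sigma> n x \<in> A}"
    define k where "k = lattice_round \<sigma> n x"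
    define w where "w = row_proj n \<theta> k"
    define l where "l = L2_set x {1..n}"
    define kl where "kl = L2_set (\<lambda>i. real_of_int (k i)) {1..n}"
    let ?k = "\<Sum>i=1..n. \<theta> i * real_of_int (k i)" and ?x = "\<Sum>i=1..n. \<theta> i * x i"
    have ws: "w \<le> s" using x by (simp add: A_def w_def k_def)
    have k0: "k i = 0" if "i \<notin> {1..n}" for i using that unfolding k_def lattice_round_def by (rule if_not_P)
    show "x \<in> E1 \<union> E2 \<union> E3"
    proof (rule ccontr)
      assume neg: "x \<notin> E1 \<union> E2 \<union> E3"
      then have l: "d * sqrt (real n) \<le> l" and err: "(\<Sum>i=1..n. \<theta> i * rounding_error \<sigma> (x i)) < \<tau> / \<sigma>"
        and Y: "s' < sqrt (real n) * ?x / l"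
        using x by (auto simp: E1_def E2_def E3_def l_def not_le not_less)
      have sn: "sqrt (real n) > 0" using n by simp
      have l0: "l > 0" using l d sn by (meson less_le_trans mult_pos_pos)
      have "(\<Sum>i=1..n. \<theta> i * rounding_error \<sigma> (x i)) = (\<Sum>i=1..n. \<theta> i * x i - (\<theta> i * real_of_int (k i)) / \<sigma>)"
        by (intro sum.cong) (auto simp: rounding_error_def k_def lattice_round_def algebra_simps)
      also have "\<dots> = ?x - ?k / \<sigma>"
        by (simp add: sum_subtractf sum_divide_distrib)
      finally have "?x \<le> ?k / \<sigma> + \<tau> / \<sigma>"
        using err by linarith
      then have "sqrt (real n) * ?x \<le> sqrt (real n) * (?k / \<sigma> + \<tau> / \<sigma>)"
        using sn by (intro mult_left_mono) auto
      also have "\<dots> = w * (kl / \<sigma>) + sqrt (real n) * \<tau> / \<sigma>"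
        using row_proj_times_norm[where \<theta> = \<theta>, OF k0] by (simp add: w_def kl_def algebra_simps)
      also have "w * (kl / \<sigma>) = w * l + w * (kl / \<sigma> - l)" by (simp add: algebra_simps)
      also have "w * (kl / \<sigma> - l) \<le> \<bar>w\<bar> * \<bar>kl / \<sigma> - l\<bar>" by (metis abs_ge_self abs_mult)
      also have "\<dots> \<le> \<bar>w\<bar> * (sqrt (real n) / (2 * \<sigma>))"
        using L2_set_round_diff[OF s(1), of n x] by (intro mult_left_mono) (auto simp: kl_def l_def k_def)
      finally have "sqrt (real n) * ?x \<le> w * l + sqrt (real n) / \<sigma> * (\<bar>w\<bar> / 2 + \<tau>)"
        by (simp add: algebra_simps)
      then have "sqrt (real n) * ?x / l \<le> (w * l + sqrt (real n) / \<sigma> * (\<bar>w\<bar> / 2 + \<tau>)) / l"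
        using l0 by (intro divide_right_mono) auto
      also have "\<dots> = w + (sqrt (real n) / (\<sigma> * l)) * (\<bar>w\<bar> / 2 + \<tau>)" using l0 by (simp add: add_divide_distrib)
      also have "(sqrt (real n) / (\<sigma> * l)) * (\<bar>w\<bar> / 2 + \<tau>) \<le> d ^ 3 * (\<bar>w\<bar> / 2 + \<tau>)"
      proof (intro mult_right_mono)
        have "sqrt (real n) / (\<sigma> * l) \<le> sqrt (real n) / (\<sigma> * (d * sqrt (real n)))"
          using l l0 s sn d by (intro divide_left_mono mult_left_mono mult_pos_pos) auto
        also have "\<dots> = 1 / (\<sigma> * d)" using sn by simp
        finally show "sqrt (real n) / (\<sigma> * l) \<le> d ^ 3" by (simp add: s(2))
      qed (use \<tau> in auto)
      also have "w + d ^ 3 * (\<bar>w\<bar> / 2 + \<tau>) \<le> s'"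
      proof -
        have "d ^ 3 \<le> 1 ^ 3" using d by (intro power_mono) auto
        then have "d ^ 3 * ((\<bar>w\<bar> - \<bar>s\<bar>) / 2) \<le> s - w"
        proof (cases "\<bar>w\<bar> \<le> \<bar>s\<bar>")
          case True
          then have "d ^ 3 * ((\<bar>w\<bar> - \<bar>s\<bar>) / 2) \<le> 0" using d by (intro mult_nonneg_nonpos) auto
          then show ?thesis using ws by linarith
        next
          case False
          then have "d ^ 3 * ((\<bar>w\<bar> - \<bar>s\<bar>) / 2) \<le> 1 * ((\<bar>w\<bar> - \<bar>s\<bar>) / 2)"
            using \<open>d ^ 3 \<le> 1 ^ 3\<close> by (intro mult_right_mono) auto
          also have "1 * ((\<bar>w\<bar> - \<bar>s\<bar>) / 2) \<le> s - w"
            using ws False abs_triangle_ineq2[of w s] by simp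
          finally show ?thesis .
        qed
        moreover have "d ^ 3 * (\<bar>w\<bar> / 2 + \<tau>) = d ^ 3 * ((\<bar>w\<bar> - \<bar>s\<bar>) / 2) + d ^ 3 * (\<bar>s\<bar> / 2 + \<tau>)"
          by (simp add: algebra_simps add_divide_distrib diff_divide_distrib)
        ultimately show ?thesis unfolding s'_def by linarith
      qed
      finally show False using Y by simp
    qed
  qed
  have "{i\<in>{1..N}. (\<Sum>j=1..n. T i j * \<theta> j) \<le> s} = {i\<in>{1..N}. r i \<in> A}"
  proof -
    have "(\<Sum>j=1..n. T i j * \<theta> j) = row_proj n \<theta> (r i)" if "i \<in> {1..N}" for i
      unfolding row_proj_def using r3[OF that] by (intro sum.cong) auto
    then show ?thesis using r1 by (auto simp: A_def)
  qed
  then have "real (card {i\<in>{1..N}. (\<Sum>j=1..n. T i j * \<theta> j) \<le> s})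
    \<le> real N * ((\<Sum>k\<in>A. cell_prob \<sigma> n k) + (2 * d) ^ n + d ^ n)"
    using count_rows_le[OF e n N r2 A] by (simp add: d_def \<sigma>_def)
  also have "\<dots> \<le> real N * ((sphere_Phi n s' + (2 * d) ^ n + exp (- 2 * \<tau>\<^sup>2)) + (2 * d) ^ n + d ^ n)"
  proof (intro mult_left_mono add_right_mono)
    have "(\<Sum>k\<in>A. cell_prob \<sigma> n k) = G.prob {x \<in> ?S. lattice_round \<sigma> n x \<in> A}"
      using prob_round_in_eq_sum(2)[OF e(1) A] by (simp add: \<sigma>_def)
    also have "\<dots> \<le> G.prob (E1 \<union> E2 \<union> E3)" using sub E by (intro G.finite_measure_mono) auto
    also have "\<dots> \<le> G.prob (E1 \<union> E2) + G.prob E3" using E by (intro measure_Un_le) auto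
    also have "G.prob (E1 \<union> E2) \<le> G.prob E1 + G.prob E2" using E by (intro measure_Un_le) auto
    also have "G.prob E1 = sphere_Phi n s'" unfolding E1_def by (rule sphere_Phi_direction[OF n \<theta>])
    also have "G.prob E2 \<le> (2 * d) ^ n" unfolding E2_def by (rule prob_small_norm[OF d(1)])
    also have "G.prob E3 \<le> exp (- 2 * \<tau>\<^sup>2)" unfolding E3_def by (rule prob_rounding_error_large[OF n s(1) \<theta> \<tau>])
    finally show "(\<Sum>k\<in>A. cell_prob \<sigma> n k) \<le> sphere_Phi n s' + (2 * d) ^ n + exp (- 2 * \<tau>\<^sup>2)" by simp
  qed simp
  finally show ?thesis by (simp add: s'_def algebra_simps)
qed


section \<open>Comparison with the quantiles\<close>

lemma power_sqrt_one_minus_ge_exp: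
  assumes T: "T\<^sup>2 < real n" and c: "c > 0" "c \<le> 1 - T\<^sup>2 / real n"
  shows "(sqrt (1 - T\<^sup>2 / real n)) ^ n \<ge> exp (- T\<^sup>2 / (2 * c))"
proof -
  define x where "x = T\<^sup>2 / real n"
  have n: "real n > 0" using T by (meson le_less_trans zero_le_power2)
  have x: "0 \<le> x" "x < 1" using T n by (auto simp: x_def)
  have x1: "1 - x > 0" using x by simp
  have "ln (1 / (1 - x)) = ln (1 + x / (1 - x))" using x by (simp add: field_simps)
  also have "\<dots> \<le> x / (1 - x)" using x by (intro ln_add_one_self_le_self) auto
  also have "\<dots> \<le> x / c" using x c by (intro divide_left_mono) (auto simp: x_def)
  finally have "- (x / c) \<le> ln (1 - x)" using x by (simp add: ln_div)
  then have "real n * (- (x / c) / 2) \<le> real n * (ln (1 - x) / 2)" by (intro mult_left_mono) auto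
  also have "ln (1 - x) / 2 = ln (sqrt (1 - x))" using x1 by (simp add: ln_sqrt)
  finally have "exp (real n * (- (x / c) / 2)) \<le> exp (real n * ln (sqrt (1 - x)))" by simp
  also have "\<dots> = sqrt (1 - x) ^ n" using x1 by (simp add: exp_of_nat_mult)
  also have "real n * (- (x / c) / 2) = - T\<^sup>2 / (2 * c)" using n by (simp add: x_def)
  finally show ?thesis by (simp add: x_def)
qed

text \<open>
  Two lower bounds for the mass of the interval are played off against the two kinds of error. With
  \<open>q\<^sup>2 = 1 - T\<^sup>2 / n \<ge> 16 * d\<close>, the mass is at least \<open>d / 9 * q ^ n\<close>. On the one hand
  \<open>q \<ge> 4 * sqrt d\<close>, which is so much larger than \<open>2 * d\<close> that the sixth power makes up for the
  factor \<open>d\<close>; on the other hand \<open>q ^ n \<ge> exp (- T\<^sup>2 / (32 * d))\<close>, and \<open>T\<^sup>2 / d\<close> is small against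
  \<open>m\<^sup>2 / d\<^sup>2\<close>.
\<close>

lemma sphere_Phi_gap:
  assumes n: "n \<ge> 6" and d: "0 < d" "d < 1/2858" and t: "\<bar>t\<bar> \<le> (1 - 17 * d) * sqrt (real n)"
  defines "m \<equiv> max 1 \<bar>t\<bar>"
  shows "2 * (2 * d) ^ n + d ^ n + exp (- 2 * (m / d)\<^sup>2) < sphere_Phi n t - sphere_Phi n (t - d * m / 2)"
proof -
  define s where "s = sqrt (real n)"
  define T where "T = \<bar>t\<bar> + d * m / 2"
  have s1: "1 \<le> s" using n by (simp add: s_def)
  have m1: "1 \<le> m" "\<bar>t\<bar> \<le> m" by (auto simp: m_def)
  have "(1 - 17 * d) * s \<le> 1 * s" using d s1 by (intro mult_right_mono) auto
  then have "\<bar>t\<bar> \<le> s" using t unfolding s_def by linarith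
  then have ms: "m \<le> s" using s1 by (simp add: m_def)
  have "d * m \<le> d * s" using d ms by (intro mult_left_mono) auto
  moreover have dm: "0 \<le> d * m" using d m1 by simp
  ultimately have "T \<le> (1 - 17 * d) * s + d * s" using t unfolding T_def s_def by linarith
  then have T_le: "T \<le> (1 - 16 * d) * s" by (simp add: algebra_simps)
  have T0: "0 \<le> T" using dm by (simp add: T_def)
  have s2: "s\<^sup>2 = real n" by (simp add: s_def)
  have Ts: "T < s"
  proof -
    have "(1 - 16 * d) * s < 1 * s" using d s1 by (intro mult_strict_right_mono) auto
    then show ?thesis using T_le by simp
  qed
  define x where "x = T\<^sup>2 / real n"
  have nx: "1 - x \<ge> 16 * d"
  proof -
    have "T\<^sup>2 \<le> ((1 - 16 * d) * s)\<^sup>2" using T_le T0 by (intro power_mono)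
    also have "\<dots> = (1 - 16 * d)\<^sup>2 * real n" by (simp add: power_mult_distrib s2)
    finally have "x \<le> (1 - 16 * d)\<^sup>2" using n by (simp add: x_def divide_le_eq)
    also have "\<dots> \<le> 1 - 16 * d"
      using d mult_left_le[of "1 - 16 * d" "1 - 16 * d"] by (simp add: power2_eq_square)
    finally show ?thesis by simp
  qed
  define q where "q = sqrt (1 - x)"
  have "4 * sqrt d = sqrt (16 * d)" by (simp add: real_sqrt_mult)
  then have q4: "4 * sqrt d \<le> q" unfolding q_def using nx by simp
  have c8: "2 * (pi * sqrt 2) \<le> 9"
  proof -
    have "sqrt 2 \<le> 71/50" by (rule real_le_lsqrt) (auto simp: power2_eq_square)
    then have "pi * sqrt 2 \<le> 3.15 * (71/50)" using pi_approx by (intro mult_mono) auto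
    then show ?thesis by simp
  qed
  have main: "(d * m / 2) / (pi * sqrt 2) * q ^ n \<le> sphere_Phi n t - sphere_Phi n (t - d * m / 2)"
    using sphere_Phi_interval_ge[of n "t - d * m / 2" T t] n dm Ts
    by (simp add: T_def[symmetric] q_def x_def s_def) (auto simp: T_def)
  have c9: "d / 9 \<le> (d * m / 2) / (pi * sqrt 2)"
  proof -
    have "d / 9 \<le> d / (2 * (pi * sqrt 2))" using d c8 by (intro divide_left_mono) auto
    also have "\<dots> \<le> d * m / (2 * (pi * sqrt 2))" using d m1 by (intro divide_right_mono) auto
    finally show ?thesis by simp
  qed
  have qn: "0 \<le> q ^ n" using q4 d by (intro zero_le_power) (auto intro: order_trans[of 0 "4 * sqrt d"])
  have A: "3 * (2 * d) ^ n \<le> d / 18 * q ^ n"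
  proof -
    \<comment> \<open>the ratio of \<open>4 * sqrt d\<close> to \<open>2 * d\<close>\<close>
    define r where "r = 2 / sqrt d"
    have sd: "sqrt d > 0" using d by simp
    have r6: "r ^ 6 = 64 / d ^ 3"
    proof -
      have "sqrt d ^ 6 = (sqrt d ^ 2) ^ 3" by (simp only: power_mult[symmetric]) simp
      then show ?thesis using d by (simp add: r_def power_divide)
    qed
    have r1: "1 \<le> r"
    proof -
      have "sqrt d \<le> sqrt 4" using d by (intro real_sqrt_le_mono) auto
      then show ?thesis using sd by (simp add: r_def)
    qed
    have "3 \<le> d / 18 * (64 / d ^ 3)"
    proof -
      have "d * d \<le> 1 * 1" using d by (intro mult_mono) auto
      then show ?thesis using d by (simp add: power3_eq_cube field_simps)
    qed
    also have "\<dots> \<le> d / 18 * r ^ n"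
      unfolding r6[symmetric] using r1 n d by (intro mult_left_mono power_increasing) auto
    finally have "3 * (2 * d) ^ n \<le> d / 18 * r ^ n * (2 * d) ^ n" using d by (intro mult_right_mono) auto
    also have "\<dots> = d / 18 * (r * (2 * d)) ^ n" by (simp only: power_mult_distrib mult.assoc)
    also have "r * (2 * d) = 4 * sqrt d"
    proof -
      have "r * (2 * d) = 4 * (d / sqrt d)" by (simp add: r_def)
      then show ?thesis using d by (simp only: real_div_sqrt less_imp_le)
    qed
    also have "d / 18 * (4 * sqrt d) ^ n \<le> d / 18 * q ^ n" using q4 d by (intro mult_left_mono power_mono) auto
    finally show ?thesis .
  qed
  have B: "exp (- 2 * (m / d)\<^sup>2) < d / 18 * q ^ n"
  proof -
    \<comment> \<open>\<open>T\<close> exceeds \<open>|t|\<close> by half a step only\<close>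
    have T2: "T\<^sup>2 \<le> 2 * m\<^sup>2"
    proof -
      have "d * m \<le> 1/4 * m" using d m1 by (intro mult_right_mono) auto
      then have "T \<le> 9/8 * m" using m1 unfolding T_def by linarith
      then have "T\<^sup>2 \<le> (9/8 * m)\<^sup>2" using T0 by (intro power_mono)
      also have "\<dots> \<le> 2 * m\<^sup>2" by (simp add: power_mult_distrib power_divide)
      finally show ?thesis .
    qed
    have "T\<^sup>2 < s\<^sup>2" using Ts T0 by (intro power_strict_mono) auto
    then have "q ^ n \<ge> exp (- T\<^sup>2 / (2 * (16 * d)))"
      unfolding q_def x_def using nx d by (intro power_sqrt_one_minus_ge_exp) (auto simp: s2 x_def)
    moreover have "exp (- T\<^sup>2 / (2 * (16 * d))) \<ge> exp (- (m\<^sup>2 / d\<^sup>2))"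
    proof -
      have "T\<^sup>2 / (2 * (16 * d)) \<le> 2 * m\<^sup>2 / (2 * (16 * d))" using T2 d by (intro divide_right_mono) auto
      also have "\<dots> = m\<^sup>2 / (16 * d)" by simp
      also have "\<dots> \<le> m\<^sup>2 / d\<^sup>2"
      proof (intro divide_left_mono)
        have "d * d \<le> 16 * d" using d by (intro mult_right_mono) auto
        then show "d\<^sup>2 \<le> 16 * d" by (simp add: power2_eq_square)
      qed (use d in auto)
      finally show ?thesis by simp
    qed
    ultimately have q1: "q ^ n \<ge> exp (- (m\<^sup>2 / d\<^sup>2))" by linarith
    have "exp (- 2 * (m / d)\<^sup>2) = exp (- (m\<^sup>2 / d\<^sup>2)) * exp (- (m\<^sup>2 / d\<^sup>2))"
      by (simp add: exp_add[symmetric] power_divide)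
    also have "\<dots> < d / 18 * exp (- (m\<^sup>2 / d\<^sup>2))"
    proof (intro mult_strict_right_mono)
      have "1 \<le> m\<^sup>2" using m1 by simp
      then have "1 / d\<^sup>2 \<le> m\<^sup>2 / d\<^sup>2" using d by (intro divide_right_mono) auto
      also have "\<dots> < exp (m\<^sup>2 / d\<^sup>2)" using exp_ge_add_one_self[of "m\<^sup>2 / d\<^sup>2"] by linarith
      finally have "inverse (exp (m\<^sup>2 / d\<^sup>2)) < inverse (1 / d\<^sup>2)" using d by (intro less_imp_inverse_less) auto
      then have "exp (- (m\<^sup>2 / d\<^sup>2)) < d\<^sup>2" by (simp add: exp_minus)
      also have "d\<^sup>2 \<le> d / 18" using d mult_left_mono[of d "1/18" d] by (simp add: power2_eq_square)
      finally show "exp (- (m\<^sup>2 / d\<^sup>2)) < d / 18" .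
    qed simp
    also have "\<dots> \<le> d / 18 * q ^ n" using q1 d by (intro mult_left_mono) auto
    finally show ?thesis .
  qed
  have "d ^ n \<le> (2 * d) ^ n" using d by (intro power_mono) auto
  then have "2 * (2 * d) ^ n + d ^ n + exp (- 2 * (m / d)\<^sup>2) < d / 9 * q ^ n" using A B by simp
  also have "\<dots> \<le> (d * m / 2) / (pi * sqrt 2) * q ^ n" using c9 qn by (intro mult_right_mono)
  also note main
  finally show ?thesis .
qed

text \<open>
  The tolerance \<open>\<tau> = m / \<delta>\<close> makes the exceptional probability tiny, while it shifts the argument of
  \<open>sphere_Phi n\<close> only by about \<open>\<delta>\<^sup>2 * m\<close>. This leaves half of the step \<open>\<delta> * m\<close> for the gap.
\<close>

lemma few_rows_below_quantile:
  assumes e: "0 < \<epsilon>" "\<epsilon> < 1/2" and n: "n \<ge> 6" and N: "real n \<le> (1/100) * inverse (ln (1 / \<epsilon>)) * ln (real N)"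
    and T: "is_T_matrix N n \<epsilon> T" and \<theta>: "(\<Sum>i=1..n. (\<theta> i)\<^sup>2) = 1"
    and t: "\<bar>t\<bar> \<le> (1 - 17 * delta \<epsilon>) * sqrt (real n)"
  shows "real (card {i\<in>{1..N}. (\<Sum>j=1..n. T i j * \<theta> j) \<le> t - delta \<epsilon> * max 1 \<bar>t\<bar>}) < real N * sphere_Phi n t"
proof -
  define d m where "d = delta \<epsilon>" and "m = max 1 \<bar>t\<bar>"
  have d: "0 < d" "d < 1/2858" using delta_bounds[OF e] by (auto simp: d_def)
  have n1: "n \<ge> 1" using n by simp
  have m1: "1 \<le> m" "\<bar>t\<bar> \<le> m" by (auto simp: m_def)
  define s where "s = t - d * m"
  have N0: "0 < real N" using sample_size_ge(1)[OF e n1 N] by simp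
  have "real (card {i\<in>{1..N}. (\<Sum>j=1..n. T i j * \<theta> j) \<le> s})
    \<le> real N * (sphere_Phi n (s + d ^ 3 * (\<bar>s\<bar> / 2 + m / d)) + 2 * (2 * d) ^ n + d ^ n + exp (- 2 * (m / d)\<^sup>2))"
    unfolding d_def using d m1 by (intro empirical_distribution_le[OF e n1 N T \<theta>]) (auto simp: d_def)
  also have "\<dots> < real N * sphere_Phi n t"
  proof (intro mult_strict_left_mono N0)
    have "s + d ^ 3 * (\<bar>s\<bar> / 2 + m / d) \<le> t - d * m / 2"
    proof -
      have "d * m \<le> 1 * m" using d m1 by (intro mult_right_mono) auto
      moreover have "0 \<le> d * m" using d m1 by simp
      moreover from this have "\<bar>s\<bar> \<le> \<bar>t\<bar> + d * m" unfolding s_def by linarith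
      ultimately have "\<bar>s\<bar> / 2 \<le> m" using m1 by linarith
      then have "d ^ 3 * (\<bar>s\<bar> / 2 + m / d) \<le> d ^ 3 * (m + m / d)" using d by (intro mult_left_mono) auto
      also have "\<dots> = d * m * (d\<^sup>2 + d)" using d by (simp add: power2_eq_square power3_eq_cube field_simps)
      also have "\<dots> \<le> d * m * (1 / 2)"
      proof (intro mult_left_mono)
        have "d * d \<le> 1/4 * 1" using d by (intro mult_mono) auto
        then show "d\<^sup>2 + d \<le> 1 / 2" using d by (simp add: power2_eq_square)
      qed (use d m1 in auto)
      finally have "d ^ 3 * (\<bar>s\<bar> / 2 + m / d) \<le> d * m * (1 / 2)" .
      then show ?thesis using s_def by linarith
    qed
    then have "sphere_Phi n (s + d ^ 3 * (\<bar>s\<bar> / 2 + m / d)) \<le> sphere_Phi n (t - d * m / 2)"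
      by (rule sphere_Phi_mono[OF n1])
    then show "sphere_Phi n (s + d ^ 3 * (\<bar>s\<bar> / 2 + m / d)) + 2 * (2 * d) ^ n + d ^ n + exp (- 2 * (m / d)\<^sup>2) < sphere_Phi n t"
      using sphere_Phi_gap[OF n d, of t] t by (simp add: d_def m_def)
  qed
  finally show ?thesis by (simp add: s_def d_def m_def)
qed

lemma exists_sorting_permutation:
  fixes w :: "nat \<Rightarrow> 'a::linorder"
  obtains \<tau> where "\<tau> permutes {1..N}" and "\<And>i j. 1 \<le> i \<Longrightarrow> i \<le> j \<Longrightarrow> j \<le> N \<Longrightarrow> w (\<tau> i) \<le> w (\<tau> j)"
proof -
  define xs where "xs = map w [1..<Suc N]"
  have len: "length xs = N" by (simp add: xs_def)
  have "mset (sort xs) = mset xs" by simp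
  then obtain p where p: "p permutes {..<length xs}" "permute_list p xs = sort xs"
    using mset_eq_permutation by blast
  define \<tau> where "\<tau> i = (if i \<in> {1..N} then p (i - 1) + 1 else i)" for i
  have bp: "bij_betw p {..<N} {..<N}" using permutes_imp_bij[OF p(1)] by (simp add: len)
  have "bij_betw (\<lambda>i. i - 1) {1..N} {..<N}"
    by (rule bij_betwI[where g = Suc]) auto
  moreover have "bij_betw Suc {..<N} {1..N}"
    by (rule bij_betwI[where g = "\<lambda>i. i - 1"]) auto
  ultimately have "bij_betw (Suc \<circ> (p \<circ> (\<lambda>i. i - 1))) {1..N} {1..N}"
    using bp by (meson bij_betw_trans)
  then have "bij_betw \<tau> {1..N} {1..N}"
    by (rule bij_betw_cong[THEN iffD1, rotated]) (auto simp: \<tau>_def)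
  then have perm: "\<tau> permutes {1..N}" by (rule bij_imp_permutes) (auto simp: \<tau>_def)
  have nth: "w (\<tau> i) = sort xs ! (i - 1)" if "1 \<le> i" "i \<le> N" for i
  proof -
    have i: "i - 1 < N" using that by auto
    then have pi: "p (i - 1) < N" using bp by (auto simp: bij_betw_def)
    have "sort xs ! (i - 1) = xs ! p (i - 1)"
      using p i len by (metis permute_list_nth)
    also have "\<dots> = w (\<tau> i)" using pi that by (simp add: xs_def \<tau>_def nth_append del: upt_Suc)
    finally show ?thesis by simp
  qed
  have "w (\<tau> i) \<le> w (\<tau> j)" if "1 \<le> i" "i \<le> j" "j \<le> N" for i j
    using that by (simp add: nth len sorted_nth_mono)
  then show ?thesis using that perm by blast
qed

lemma v_vec_cases:
  assumes n: "n \<ge> 6" and d: "0 < delta \<epsilon>" "delta \<epsilon> < 1/2858" and i: "1 \<le> i" "i \<le> N" and N: "N \<ge> 1"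
  defines "T \<equiv> (1 - 17 * delta \<epsilon>) * sqrt (real n)"
  obtains (low) "v_vec N n \<epsilon> i = - sqrt (real n)" "(real i - 1/2) / real N < sphere_Phi n (- T)"
    | (mid) "\<bar>v_vec N n \<epsilon> i\<bar> \<le> T" "sphere_Phi n (v_vec N n \<epsilon> i) = (real i - 1/2) / real N"
    | (high) "v_vec N n \<epsilon> i = sqrt (real n)" "sphere_Phi n T < (real i - 1/2) / real N"
proof -
  have n2: "n \<ge> 2" using n by simp
  have sn: "sqrt (real n) > 0" using n by simp
  have T: "0 \<le> T" "T < sqrt (real n)"
  proof -
    show "0 \<le> T" unfolding T_def using d by (intro mult_nonneg_nonneg) auto
    have "(1 - 17 * delta \<epsilon>) * sqrt (real n) < 1 * sqrt (real n)" using d sn by (intro mult_strict_right_mono) auto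
    then show "T < sqrt (real n)" by (simp add: T_def)
  qed
  have N0: "real N > 0" using N by simp
  have b: "b_param n \<epsilon> = sphere_Phi n T" by (simp add: b_param_def T_def)
  have b': "1 - b_param n \<epsilon> = sphere_Phi n (- T)" using sphere_Phi_uminus[OF n2, of T] T b by simp
  consider "real i - 1/2 < (1 - b_param n \<epsilon>) * real N"
    | "\<not> real i - 1/2 < (1 - b_param n \<epsilon>) * real N" "real i - 1/2 \<le> b_param n \<epsilon> * real N"
    | "\<not> real i - 1/2 < (1 - b_param n \<epsilon>) * real N" "\<not> real i - 1/2 \<le> b_param n \<epsilon> * real N" by blast
  then show ?thesis
  proof cases
    case 1
    then show ?thesis using low N0 b' by (simp add: v_vec_def divide_less_eq)
  next
    case 2
    define y where "y = (real i - 1/2) / real N"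
    have "1 - sphere_Phi n T \<le> y" "y \<le> sphere_Phi n T"
      using 2 N0 by (auto simp: y_def b divide_le_eq le_divide_eq)
    then obtain t where t: "\<bar>t\<bar> \<le> T" "sphere_Phi n t = y" "sphere_Phi_inv n y = t"
      using sphere_Phi_quantile[OF n2 T] by metis
    have "v_vec N n \<epsilon> i = t" using 2 t(3) by (simp add: v_vec_def y_def)
    then show ?thesis using mid t by (simp add: y_def)
  next
    case 3
    then show ?thesis using high N0 b by (simp add: v_vec_def less_divide_eq)
  qed
qed

text \<open>
  If the \<open>i\<close>-th smallest coordinate were far below the quantile, the first \<open>i\<close> coordinates would all be, which
  is too many. The upper bound is the same statement for \<open>- \<theta>\<close>. At both ends, where \<open>v\<close> is replaced by
  \<open>\<plusminus> sqrt n\<close>, the comparison is made with the last quantile \<open>\<plusminus> (1 - 17 * \<delta>) * sqrt n\<close>, which costs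
  another \<open>17 * \<delta> * sqrt n\<close>.
\<close>

lemma sorted_projection_close:
  assumes e: "0 < \<epsilon>" "\<epsilon> < 1/2" and n: "n \<ge> 6" and N: "real n \<le> (1/100) * inverse (ln (1 / \<epsilon>)) * ln (real N)"
    and T: "is_T_matrix N n \<epsilon> T" and \<theta>: "(\<Sum>i=1..n. (\<theta> i)\<^sup>2) = 1"
    and perm: "\<tau> permutes {1..N}"
    and sorted: "\<And>i j. 1 \<le> i \<Longrightarrow> i \<le> j \<Longrightarrow> j \<le> N \<Longrightarrow> (\<Sum>k=1..n. T (\<tau> i) k * \<theta> k) \<le> (\<Sum>k=1..n. T (\<tau> j) k * \<theta> k)"
    and i: "i \<in> {1..N}"
  shows "\<bar>(\<Sum>k=1..n. T (\<tau> i) k * \<theta> k) - v_vec N n \<epsilon> i\<bar> \<le> 18 * delta \<epsilon> * max 1 \<bar>v_vec N n \<epsilon> i\<bar>"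
proof -
  define d S where "d = delta \<epsilon>" and "S = sqrt (real n)"
  define w where "w i = (\<Sum>k=1..n. T i k * \<theta> k)" for i
  define u where "u i = w (\<tau> i)" for i
  define v where "v = v_vec N n \<epsilon> i"
  have d: "0 < d" "d < 1/2858" using delta_bounds[OF e] by (auto simp: d_def)
  have n1: "n \<ge> 1" "n \<ge> 2" using n by auto
  have S1: "1 \<le> S" using n by (simp add: S_def)
  have N1: "N \<ge> 1" using sample_size_ge(1)[OF e n1(1) N] .
  have N0: "real N > 0" using N1 by simp
  have bij: "bij_betw \<tau> {1..N} {1..N}" using permutes_imp_bij[OF perm] .
  have card_perm: "card {i\<in>{1..N}. P (\<tau> i)} = card {i\<in>{1..N}. P i}" for P
  proof -
    have "bij_betw \<tau> {i\<in>{1..N}. P (\<tau> i)} {i\<in>{1..N}. P i}"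
    proof (rule bij_betw_subset[OF bij])
      have "\<tau> ` {i \<in> {1..N}. P (\<tau> i)} = {i \<in> \<tau> ` {1..N}. P i}" by blast
      then show "\<tau> ` {i \<in> {1..N}. P (\<tau> i)} = {i \<in> {1..N}. P i}"
        by (simp only: bij_betw_imp_surj_on[OF bij])
    qed auto
    then show ?thesis by (rule bij_betw_same_card)
  qed
  define T0 where "T0 = (1 - 17 * d) * S"
  have T0: "0 \<le> T0" "T0 < S" "S - T0 = 17 * d * S"
    using d S1 by (auto simp: T0_def algebra_simps)
  have T0S: "d * max 1 T0 \<le> d * S" using d S1 T0 by (intro mult_left_mono) auto
  have wb: "\<bar>u i\<bar> \<le> S"
  proof -
    have "\<tau> i \<in> {1..N}" using i bij by (auto simp: bij_betw_def)
    moreover obtain r where r: "\<forall>i\<in>{1..N}. r i \<in> lattice_ball n \<epsilon>" "\<forall>i\<in>{1..N}. \<forall>j\<in>{1..n}. T i j = row_vec n (r i) j"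
      using T unfolding is_T_matrix_def by blast
    ultimately have "u i = row_proj n \<theta> (r (\<tau> i))" "r (\<tau> i) \<in> lattice_ball n \<epsilon>"
      unfolding u_def w_def row_proj_def by auto
    then show ?thesis using row_proj_abs_le[OF _ \<theta>, of "r (\<tau> i)"] by (auto simp: S_def lattice_ball_def)
  qed
  have lower: "t - d * max 1 \<bar>t\<bar> < u i" if t: "\<bar>t\<bar> \<le> T0" "sphere_Phi n t \<le> (real i - 1/2) / real N" for t
  proof (rule ccontr)
    assume "\<not> t - d * max 1 \<bar>t\<bar> < u i"
    then have "{1..i} \<subseteq> {j\<in>{1..N}. u j \<le> t - d * max 1 \<bar>t\<bar>}"
      using sorted i by (force simp: u_def w_def)
    then have "card {1..i} \<le> card {j\<in>{1..N}. u j \<le> t - d * max 1 \<bar>t\<bar>}" by (intro card_mono) auto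
    also have "\<dots> = card {j\<in>{1..N}. w j \<le> t - d * max 1 \<bar>t\<bar>}" unfolding u_def by (rule card_perm)
    finally have "real i \<le> real (card {j\<in>{1..N}. w j \<le> t - d * max 1 \<bar>t\<bar>})" by simp
    also have "\<dots> < real N * sphere_Phi n t"
      unfolding w_def d_def using t by (intro few_rows_below_quantile e n N T \<theta>) (simp add: T0_def S_def d_def)
    also have "\<dots> \<le> real i - 1/2" using t(2) N0 by (simp add: field_simps)
    finally show False by simp
  qed
  have upper: "u i < t + d * max 1 \<bar>t\<bar>" if t: "\<bar>t\<bar> \<le> T0" "(real i - 1/2) / real N \<le> sphere_Phi n t" for t
  proof (rule ccontr)
    assume "\<not> u i < t + d * max 1 \<bar>t\<bar>"
    then have "{i..N} \<subseteq> {j\<in>{1..N}. - u j \<le> - t - d * max 1 \<bar>- t\<bar>}"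
      using sorted i by (force simp: u_def w_def)
    then have "card {i..N} \<le> card {j\<in>{1..N}. - u j \<le> - t - d * max 1 \<bar>- t\<bar>}" by (intro card_mono) auto
    also have "\<dots> = card {j\<in>{1..N}. - w j \<le> - t - d * max 1 \<bar>- t\<bar>}" unfolding u_def by (rule card_perm)
    finally have "real N - real i + 1 \<le> real (card {j\<in>{1..N}. - w j \<le> - t - d * max 1 \<bar>- t\<bar>})" using i by simp
    also have "real (card {j\<in>{1..N}. - w j \<le> - t - d * max 1 \<bar>- t\<bar>}) < real N * sphere_Phi n (- t)"
    proof -
      have "- w j = (\<Sum>k=1..n. T j k * - \<theta> k)" for j by (simp add: w_def sum_negf)
      then show ?thesis
        unfolding d_def using t \<theta> few_rows_below_quantile[OF e n N T, of "\<lambda>k. - \<theta> k" "- t"]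
        by (simp add: T0_def S_def d_def)
    qed
    also have "\<dots> = real N * (1 - sphere_Phi n t)"
      using sphere_Phi_uminus[OF n1(2), of t] t(1) T0 by (simp add: S_def)
    also have "\<dots> \<le> real N - (real i - 1/2)" using t(2) N0 by (simp add: field_simps)
    finally show False by simp
  qed
  have "\<bar>u i - v\<bar> \<le> 18 * d * max 1 \<bar>v\<bar>"
  proof (rule v_vec_cases[OF n, of \<epsilon> i N])
    show "0 < delta \<epsilon>" "delta \<epsilon> < 1/2858" using d by (auto simp: d_def)
    show "1 \<le> i" "i \<le> N" "N \<ge> 1" using i N1 by auto
  next
    assume a: "v_vec N n \<epsilon> i = - sqrt (real n)" "(real i - 1/2) / real N < sphere_Phi n (- ((1 - 17 * delta \<epsilon>) * sqrt (real n)))"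
    then have "u i < - T0 + d * max 1 \<bar>- T0\<bar>" using T0 by (intro upper) (auto simp: T0_def S_def d_def)
    then have "u i < - T0 + d * S" using T0S T0 by simp
    moreover have "v = - S" "max 1 \<bar>v\<bar> = S" using a S1 by (auto simp: v_def S_def)
    ultimately show ?thesis using wb T0(3) by simp
  next
    assume a: "\<bar>v_vec N n \<epsilon> i\<bar> \<le> (1 - 17 * delta \<epsilon>) * sqrt (real n)" "sphere_Phi n (v_vec N n \<epsilon> i) = (real i - 1/2) / real N"
    have "v - d * max 1 \<bar>v\<bar> < u i" by (rule lower) (use a in \<open>auto simp: v_def T0_def S_def d_def\<close>)
    moreover have "u i < v + d * max 1 \<bar>v\<bar>" by (rule upper) (use a in \<open>auto simp: v_def T0_def S_def d_def\<close>)
    moreover have "0 \<le> d * max 1 \<bar>v\<bar>" using d by simp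
    ultimately show ?thesis by simp
  next
    assume a: "v_vec N n \<epsilon> i = sqrt (real n)" "sphere_Phi n ((1 - 17 * delta \<epsilon>) * sqrt (real n)) < (real i - 1/2) / real N"
    then have "T0 - d * max 1 \<bar>T0\<bar> < u i" using T0 by (intro lower) (auto simp: T0_def S_def d_def)
    then have "T0 - d * S < u i" using T0S T0 by simp
    moreover have "v = S" "max 1 \<bar>v\<bar> = S" using a S1 by (auto simp: v_def S_def)
    ultimately show ?thesis using wb T0(3) by simp
  qed
  then show ?thesis by (simp add: u_def w_def v_def d_def)
qed

text \<open>
  The sphere coordinate lies between \<open>1/2\<close> and \<open>1\<close> with probability at least \<open>1/18\<close>. Passing from \<open>1/18\<close>
  to \<open>1/19\<close> absorbs the half row that is lost by counting, as \<open>N\<close> is large.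
\<close>

lemma many_large_quantiles:
  assumes e: "0 < \<epsilon>" "\<epsilon> < 1/2" and n: "n \<ge> 6" and N: "real n \<le> (1/100) * inverse (ln (1 / \<epsilon>)) * ln (real N)"
  shows "N \<le> 19 * card {i\<in>{1..N}. v_vec N n \<epsilon> i \<ge> 1/2}"
proof -
  let ?v = "v_vec N n \<epsilon>" and ?A = "{i\<in>{1..N}. v_vec N n \<epsilon> i \<ge> 1/2}"
  interpret G: prob_space "std_gaussian n" by (rule prob_space_std_gaussian)
  define \<phi> where "\<phi> = sphere_Phi n (1/2)"
  have d: "0 < delta \<epsilon>" "delta \<epsilon> < 1/2858" using delta_bounds[OF e] by auto
  have n1: "n \<ge> 1" "n \<ge> 2" using n by auto
  have N1: "N \<ge> 1" using sample_size_ge(1)[OF e n1(1) N] .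
  have N0: "real N > 0" using N1 by simp
  have Nbig: "real N \<ge> 200"
  proof -
    have "(delta \<epsilon> ^ 8) ^ n \<le> (delta \<epsilon> ^ 8) ^ 1" using d n1 by (intro power_decreasing) (auto intro: power_le_one)
    also have "\<dots> \<le> delta \<epsilon> ^ 1" using d by (simp only: power_one_right, subst power_one_right[symmetric], intro power_decreasing) auto
    finally have "real N * (delta \<epsilon> ^ 8) ^ n \<le> real N * (1/2858)" using d by (intro mult_left_mono) auto
    then show ?thesis using sample_size_ge(2)[OF e n1(1) N] by simp
  qed
  have phi: "1/18 \<le> 1 - \<phi>"
  proof -
    have s: "1 < sqrt (real n)" using n by simp
    have "1/18 \<le> 1 / (4 * (pi * sqrt 2))"
    proof -
      have "sqrt 2 \<le> 1415/1000" by (rule real_le_lsqrt) (auto simp: power2_eq_square)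
      then have "pi * sqrt 2 \<le> 3.1416 * (1415/1000)" using pi_approx by (intro mult_mono) auto
      then show ?thesis by (intro divide_left_mono) auto
    qed
    also have "\<dots> \<le> (1 - 1/2) / (pi * sqrt 2) * (sqrt (1 - 1\<^sup>2 / real n)) ^ n"
    proof -
      have "exp (3/5 :: real) \<le> 2" using exp_bound[of "3/5 :: real"] by (simp add: power2_eq_square)
      then have "1/2 \<le> exp (- (3/5) :: real)" by (simp add: exp_minus field_simps)
      also have "exp (- (3/5) :: real) = exp (- 1\<^sup>2 / (2 * (5/6)))" by simp
      also have "\<dots> \<le> (sqrt (1 - 1\<^sup>2 / real n)) ^ n"
        using n by (intro power_sqrt_one_minus_ge_exp) (auto simp: field_simps)
      finally have "(1/2) / (pi * sqrt 2) * (1/2) \<le> (1/2) / (pi * sqrt 2) * (sqrt (1 - 1\<^sup>2 / real n)) ^ n"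
        by (intro mult_left_mono) auto
      then show ?thesis by simp
    qed
    also have "\<dots> \<le> sphere_Phi n 1 - \<phi>" unfolding \<phi>_def by (rule sphere_Phi_interval_ge[OF n1(2)]) (use s in auto)
    also have "sphere_Phi n 1 \<le> 1" unfolding sphere_Phi_def by (rule G.prob_le_1)
    finally show ?thesis by simp
  qed
  have big: "?v i \<ge> 1/2" if i: "i \<in> {1..N}" "real N * \<phi> \<le> real i - 1/2" for i
  proof -
    have y: "\<phi> \<le> (real i - 1/2) / real N" using i N0 by (simp add: le_divide_eq mult.commute)
    define T where "T = (1 - 17 * delta \<epsilon>) * sqrt (real n)"
    have s2: "2 \<le> sqrt (real n)" using n by (intro real_le_rsqrt) simp
    have T0: "0 \<le> T" unfolding T_def using d by (intro mult_nonneg_nonneg) auto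
    show ?thesis
    proof (rule v_vec_cases[OF n d, of i N])
      show "1 \<le> i" "i \<le> N" "N \<ge> 1" using i N1 by auto
    next
      assume "(real i - 1/2) / real N < sphere_Phi n (- ((1 - 17 * delta \<epsilon>) * sqrt (real n)))"
      moreover have "sphere_Phi n (- T) \<le> \<phi>" unfolding \<phi>_def using T0 by (intro sphere_Phi_mono n1) simp
      ultimately show ?thesis using y by (simp add: T_def)
    next
      assume a: "\<bar>?v i\<bar> \<le> (1 - 17 * delta \<epsilon>) * sqrt (real n)" "sphere_Phi n (?v i) = (real i - 1/2) / real N"
      show ?thesis
      proof (rule ccontr)
        assume "\<not> ?thesis"
        moreover have "(1 - 17 * delta \<epsilon>) * sqrt (real n) \<le> 1 * sqrt (real n)" using d by (intro mult_right_mono) auto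
        ultimately have "sphere_Phi n (?v i) < \<phi>"
          unfolding \<phi>_def using a s2 by (intro sphere_Phi_strict_mono n1) auto
        then show False using a y by simp
      qed
    next
      assume "?v i = sqrt (real n)"
      then show ?thesis using s2 by simp
    qed
  qed
  have "{1..N} \<subseteq> ?A \<union> {1..nat \<lfloor>real N * \<phi> + 1/2\<rfloor>}"
  proof
    fix i assume i: "i \<in> {1..N}"
    show "i \<in> ?A \<union> {1..nat \<lfloor>real N * \<phi> + 1/2\<rfloor>}"
    proof (cases "real N * \<phi> \<le> real i - 1/2")
      case True
      then show ?thesis using big i by blast
    next
      case False
      then have "int i \<le> \<lfloor>real N * \<phi> + 1/2\<rfloor>" by (simp add: le_floor_iff)
      then show ?thesis using i by auto
    qed
  qed
  then have "card {1..N} \<le> card (?A \<union> {1..nat \<lfloor>real N * \<phi> + 1/2\<rfloor>})" by (intro card_mono) auto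
  also have "\<dots> \<le> card ?A + card {1..nat \<lfloor>real N * \<phi> + 1/2\<rfloor>}" by (rule card_Un_le)
  finally have "N \<le> card ?A + nat \<lfloor>real N * \<phi> + 1/2\<rfloor>" by simp
  then have "real N \<le> real (card ?A) + real (nat \<lfloor>real N * \<phi> + 1/2\<rfloor>)" by linarith
  also have "real (nat \<lfloor>real N * \<phi> + 1/2\<rfloor>) \<le> real N * \<phi> + 1/2"
  proof -
    have "0 \<le> \<phi>" unfolding \<phi>_def sphere_Phi_def by simp
    then have "0 \<le> real N * \<phi> + 1/2" by simp
    then show ?thesis by (simp add: of_nat_floor)
  qed
  finally have "real N * (1 - \<phi>) - 1/2 \<le> real (card ?A)" by (simp add: algebra_simps)
  moreover have "real N * (1/18) \<le> real N * (1 - \<phi>)" using phi by (intro mult_left_mono) auto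
  ultimately have "real N \<le> 19 * real (card ?A)" using Nbig by linarith
  then show ?thesis by linarith
qed

section \<open>The embedding\<close>

text \<open>
  Homogeneity reduces the claim to unit vectors. The number \<open>1429\<close> enters here: with \<open>19\<close> blocks and the
  threshold \<open>1/2\<close>, the comparison lemma gives the factor \<open>(2 + 2 * 19 / (1/2)) * 18 = 1404\<close> in front of
  \<open>\<delta>\<close>.
\<close>

lemma embedding_bounds:
  fixes e :: "nat \<Rightarrow> 'a::real_normed_vector"
  assumes K: "K \<ge> 1" and eps: "0 < \<epsilon>" "\<epsilon> < 1 / (2 * K)"
    and bb: "basis_bound N e K" and pi: "permutation_invariant N e"
    and n: "6 \<le> n" and N: "real n \<le> (1/100) * inverse (ln (1 / \<epsilon>)) * ln (real N)" and T: "is_T_matrix N n \<epsilon> T"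
  shows "(1 - K * \<epsilon>) * M_const N n \<epsilon> e * sqrt (\<Sum>j=1..n. (x j)\<^sup>2)
          \<le> norm (\<Sum>i=1..N. (\<Sum>j=1..n. T i j * x j) *\<^sub>R e i)" (is "?L \<le> ?M")
    and "norm (\<Sum>i=1..N. (\<Sum>j=1..n. T i j * x j) *\<^sub>R e i)
          \<le> (1 + K * \<epsilon>) * M_const N n \<epsilon> e * sqrt (\<Sum>j=1..n. (x j)\<^sup>2)" (is "?M \<le> ?U")
proof -
  have "1 / (2 * K) \<le> 1 / 2" using K by (intro divide_left_mono) auto
  then have e: "0 < \<epsilon>" "\<epsilon> < 1/2" using eps by auto
  define \<rho> where "\<rho> = sqrt (\<Sum>j=1..n. (x j)\<^sup>2)"
  define V where "V = (\<Sum>i=1..N. v_vec N n \<epsilon> i *\<^sub>R e i)"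
  have Mc: "M_const N n \<epsilon> e = norm V" by (simp add: M_const_def V_def)
  have "\<bar>?M - norm V * \<rho>\<bar> \<le> K * \<epsilon> * norm V * \<rho>"
  proof (cases "\<rho> = 0")
    case True
    then have "\<forall>j\<in>{1..n}. x j = 0" by (simp add: \<rho>_def sum_nonneg_eq_0_iff)
    then show ?thesis using True by simp
  next
    case False
    then have \<rho>: "\<rho> > 0" by (simp add: \<rho>_def sum_nonneg less_le)
    define \<theta> where "\<theta> j = x j / \<rho>" for j
    have "(\<Sum>j=1..n. (\<theta> j)\<^sup>2) = (\<Sum>j=1..n. (x j)\<^sup>2) / \<rho>\<^sup>2" by (simp add: \<theta>_def power_divide sum_divide_distrib)
    also have "\<rho>\<^sup>2 = (\<Sum>j=1..n. (x j)\<^sup>2)" by (simp add: \<rho>_def sum_nonneg)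
    finally have \<theta>: "(\<Sum>j=1..n. (\<theta> j)\<^sup>2) = 1" using \<rho> \<open>\<rho>\<^sup>2 = _\<close> by (metis divide_self less_irrefl zero_less_power)
    define w where "w i = (\<Sum>j=1..n. T i j * \<theta> j)" for i
    obtain \<tau> where \<tau>: "\<tau> permutes {1..N}" "\<And>i j. 1 \<le> i \<Longrightarrow> i \<le> j \<Longrightarrow> j \<le> N \<Longrightarrow> w (\<tau> i) \<le> w (\<tau> j)"
      using exists_sorting_permutation[of N w] by blast
    define U where "U = (\<Sum>i=1..N. w (\<tau> i) *\<^sub>R e i)"
    have "norm (U - V) \<le> (2 + 2 * real 19 / (1/2)) * (18 * delta \<epsilon>) * K * norm V"
      unfolding U_def V_def
    proof (rule norm_comparison[OF bb pi])
      show "\<bar>w (\<tau> i) - v_vec N n \<epsilon> i\<bar> \<le> 18 * delta \<epsilon> * max 1 \<bar>v_vec N n \<epsilon> i\<bar>" if "i \<in> {1..N}" for i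
        unfolding w_def by (rule sorted_projection_close[OF e n N T \<theta> \<tau>(1) _ that]) (use \<tau>(2) in \<open>auto simp: w_def\<close>)
      show "N \<le> 19 * card {i\<in>{1..N}. v_vec N n \<epsilon> i \<ge> 1/2}" by (rule many_large_quantiles[OF e n N])
    qed (use delta_bounds[OF e] in auto)
    also have "(2 + 2 * real 19 / (1/2)) * (18 * delta \<epsilon>) * K * norm V \<le> \<epsilon> * K * norm V"
      using K e by (intro mult_right_mono) (auto simp: delta_def)
    finally have UV: "\<bar>norm U - norm V\<bar> \<le> K * \<epsilon> * norm V"
      using norm_triangle_ineq3[of U V] by (simp add: mult_ac)
    have "norm U = norm (\<Sum>i=1..N. w i *\<^sub>R e i)"
      unfolding U_def using pi \<tau>(1) unfolding permutation_invariant_def by blast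
    moreover have "(\<Sum>i=1..N. (\<Sum>j=1..n. T i j * x j) *\<^sub>R e i) = \<rho> *\<^sub>R (\<Sum>i=1..N. w i *\<^sub>R e i)"
    proof -
      have "(\<Sum>j=1..n. T i j * x j) = \<rho> * w i" for i
        using \<rho> by (simp add: w_def \<theta>_def sum_distrib_left)
      then show ?thesis by (simp add: scaleR_sum_right)
    qed
    ultimately have "?M = \<rho> * norm U" using \<rho> by simp
    then have "?M - norm V * \<rho> = \<rho> * (norm U - norm V)"
      by (simp only: right_diff_distrib mult.commute)
    then have "\<bar>?M - norm V * \<rho>\<bar> = \<rho> * \<bar>norm U - norm V\<bar>"
      using \<rho> by (simp only: abs_mult abs_of_pos)
    also have "\<dots> \<le> \<rho> * (K * \<epsilon> * norm V)" using UV \<rho> by (intro mult_left_mono) auto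
    finally show ?thesis by (simp add: mult_ac)
  qed
  then show "?L \<le> ?M" "?M \<le> ?U" unfolding Mc \<rho>_def[symmetric] by (simp_all add: algebra_simps abs_le_iff)
qed

text \<open>
  For \<open>k < 6\<close>, a vector in \<open>\<real>\<^sup>k\<close> is extended by zeros to a vector in \<open>\<real>\<^sup>6\<close>.
\<close>

theorem theorem1:
  fixes N :: nat and K \<epsilon> :: real and e :: "nat \<Rightarrow> 'a::real_normed_vector"
  assumes "K \<ge> 1" and "0 < \<epsilon>" and "\<epsilon> < 1 / (2 * K)"
    and "is_basis N e" and "is_basis_constant N e K" and "permutation_invariant N e"
  shows
    "(\<forall>(n::nat) T (x :: nat \<Rightarrow> real).
        6 \<le> n \<and> real n \<le> (1/100) * inverse (ln (1 / \<epsilon>)) * ln (real N) \<and> is_T_matrix N n \<epsilon> T \<longrightarrow>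
        (1 - K * \<epsilon>) * M_const N n \<epsilon> e * sqrt (\<Sum>j=1..n. (x j)\<^sup>2)
          \<le> norm (\<Sum>i=1..N. (\<Sum>j=1..n. T i j * x j) *\<^sub>R e i) \<and>
        norm (\<Sum>i=1..N. (\<Sum>j=1..n. T i j * x j) *\<^sub>R e i)
          \<le> (1 + K * \<epsilon>) * M_const N n \<epsilon> e * sqrt (\<Sum>j=1..n. (x j)\<^sup>2)) \<and>
     (\<forall>(k::nat) T (x :: nat \<Rightarrow> real).
        1 \<le> k \<and> k < 6 \<and> 6 \<le> (1/100) * inverse (ln (1 / \<epsilon>)) * ln (real N) \<and> is_T_matrix N 6 \<epsilon> T \<longrightarrow>
        (1 - K * \<epsilon>) * M_const N 6 \<epsilon> e * sqrt (\<Sum>j=1..k. (x j)\<^sup>2)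
          \<le> norm (\<Sum>i=1..N. (\<Sum>j=1..k. T i j * x j) *\<^sub>R e i) \<and>
        norm (\<Sum>i=1..N. (\<Sum>j=1..k. T i j * x j) *\<^sub>R e i)
          \<le> (1 + K * \<epsilon>) * M_const N 6 \<epsilon> e * sqrt (\<Sum>j=1..k. (x j)\<^sup>2))"
proof -
  have bb: "basis_bound N e K" using assms(5) by (simp add: is_basis_constant_def)
  note E = embedding_bounds[OF assms(1-3) bb assms(6)]
  show ?thesis
  proof (intro conjI allI impI; elim conjE)
    fix n T and x :: "nat \<Rightarrow> real"
    assume a: "6 \<le> n" "real n \<le> (1/100) * inverse (ln (1 / \<epsilon>)) * ln (real N)" "is_T_matrix N n \<epsilon> T"
    show "(1 - K * \<epsilon>) * M_const N n \<epsilon> e * sqrt (\<Sum>j=1..n. (x j)\<^sup>2) \<le> norm (\<Sum>i=1..N. (\<Sum>j=1..n. T i j * x j) *\<^sub>R e i)"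
      by (rule E(1)[OF a])
    show "norm (\<Sum>i=1..N. (\<Sum>j=1..n. T i j * x j) *\<^sub>R e i) \<le> (1 + K * \<epsilon>) * M_const N n \<epsilon> e * sqrt (\<Sum>j=1..n. (x j)\<^sup>2)"
      by (rule E(2)[OF a])
  next
    fix k :: nat and T and x :: "nat \<Rightarrow> real"
    assume k: "1 \<le> k" "k < 6" and a: "6 \<le> (1/100) * inverse (ln (1 / \<epsilon>)) * ln (real N)" "is_T_matrix N 6 \<epsilon> T"
    define x' where "x' j = (if j \<le> k then x j else 0)" for j
    have s1: "(\<Sum>j=1..6. (x' j)\<^sup>2) = (\<Sum>j=1..k. (x j)\<^sup>2)"
      using k by (intro sum.mono_neutral_cong_right) (auto simp: x'_def)
    have s2: "(\<Sum>j=1..6. T i j * x' j) = (\<Sum>j=1..k. T i j * x j)" for i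
      using k by (intro sum.mono_neutral_cong_right) (auto simp: x'_def)
    have a': "real 6 \<le> (1/100) * inverse (ln (1 / \<epsilon>)) * ln (real N)" using a(1) by simp
    show "(1 - K * \<epsilon>) * M_const N 6 \<epsilon> e * sqrt (\<Sum>j=1..k. (x j)\<^sup>2) \<le> norm (\<Sum>i=1..N. (\<Sum>j=1..k. T i j * x j) *\<^sub>R e i)"
      using E(1)[OF order_refl a' a(2), of x'] unfolding s1 s2 .
    show "norm (\<Sum>i=1..N. (\<Sum>j=1..k. T i j * x j) *\<^sub>R e i) \<le> (1 + K * \<epsilon>) * M_const N 6 \<epsilon> e * sqrt (\<Sum>j=1..k. (x j)\<^sup>2)"
      using E(2)[OF order_refl a' a(2), of x'] unfolding s1 s2 .
  qed
qed


end
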